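(* Consider the real scalar fast fading channel described in the context with i.i.d. fading of a regular fading distribution. Let $\epsilon>0$ be fixed and let $\mu^*(n,\epsilon)$ be the infimum of $\mu(S,\epsilon)$ over all $n$-dimensional infinite constellations $S$. Then, as $n\to\infty$, $$\mu^*(n,\epsilon)=1+\sqrt{\frac{2+\mathrm{Var}(\ln(H^2))}{n}}Q^{-1}(\epsilon)+O\!\left(\frac{\ln n}{n}\right).$$
   Context: Channel: $Y_i=H_iX_i+Z_i$, $\{H_i\}$ i.i.d. nonnegative with $E H_i^2=1$ and a regular fading distribution (PDF $f$ with $f(h)\propto h^{\alpha-1}$ for all small $h>0$, some $\alpha>0$), $\{Z_i\}$ i.i.d. $N(0,\sigma^2)$, all independent, receiver knows $\mathbf H=\mathrm{diag}(H_1,\dots,H_n)$. An IC is a countable $S\subset\mathbb R^n$ with density $\gamma=\limsup_{a}|S\cap\{|x_i|<a/2\}|/a^n$ and NLD $\delta(S)=\frac1n\ln\gamma$; its average error probability $P_e(S)$ is $E\{\limsup_a$ average over received points $s_{rc}\in\mathbf HS$ lying in $\mathbf H\cdot\{|x_i|<a/2\}$ of $\Pr\{s_{rc}+\mathbf z\notin W(s_{rc})\mid\mathbf H\}\}$, $W$ the Voronoi cell in $\mathbf HS$. The volume-to-noise ratio of $S$ at error probability $\epsilon$ is $\mu(S,\epsilon)=\frac{e^{-2\delta(S)+E\{\ln(H^2)\}}}{2\pi e\sigma^2(\epsilon)}$, where $\sigma^2(\epsilon)$ is the noise variance for which the average error probability of $S$ equals $\epsilon$. $Q$ is the standard Gaussian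 complementary CDF. *)

theory Defs
  imports "HOL-Probability.Probability" "HOL-Library.Landau_Symbols"
begin

definition Rn :: "nat \<Rightarrow> (nat \<Rightarrow> real) set" where
  "Rn n = PiE {..<n} (\<lambda>_. UNIV)"

definition sqdist_n :: "nat \<Rightarrow> (nat \<Rightarrow> real) \<Rightarrow> (nat \<Rightarrow> real) \<Rightarrow> real" where
  "sqdist_n n x y = (\<Sum>i<n. (x i - y i)^2)"

definition vadd :: "nat \<Rightarrow> (nat \<Rightarrow> real) \<Rightarrow> (nat \<Rightarrow> real) \<Rightarrow> (nat \<Rightarrow> real)" where
  "vadd n x y = (\<lambda>i\<in>{..<n}. x i + y i)"

definition hmul :: "nat \<Rightarrow> (nat \<Rightarrow> real) \<Rightarrow> (nat \<Rightarrow> real) \<Rightarrow> (nat \<Rightarrow> real)" where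
  "hmul n h x = (\<lambda>i\<in>{..<n}. h i * x i)"

definition cube :: "nat \<Rightarrow> real \<Rightarrow> (nat \<Rightarrow> real) set" where
  "cube n a = {x \<in> Rn n. \<forall>i<n. \<bar>x i\<bar> < a / 2}"

definition IC :: "nat \<Rightarrow> (nat \<Rightarrow> real) set \<Rightarrow> bool" where
  "IC n S \<longleftrightarrow> countable S \<and> S \<subseteq> Rn n"

definition npts :: "'a set \<Rightarrow> ereal" where
  "npts A = (if finite A then ereal (real (card A)) else \<infinity>)"

definition dens :: "nat \<Rightarrow> (nat \<Rightarrow> real) set \<Rightarrow> ereal" where
  "dens n S = Limsup at_top (\<lambda>a::real. npts (S \<inter> cube n a) / ereal (a ^ n))"

text \<open>Normalized log density (used only when 0 < dens < infinity).\<close>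
definition NLD :: "nat \<Rightarrow> (nat \<Rightarrow> real) set \<Rightarrow> real" where
  "NLD n S = ln (real_of_ereal (dens n S)) / real n"

definition fadingM :: "(real \<Rightarrow> real) \<Rightarrow> real measure" where
  "fadingM f = density lborel f"

definition fadingVecM :: "(real \<Rightarrow> real) \<Rightarrow> nat \<Rightarrow> (nat \<Rightarrow> real) measure" where
  "fadingVecM f n = PiM {..<n} (\<lambda>_. fadingM f)"

definition regular_fading :: "(real \<Rightarrow> real) \<Rightarrow> bool" where
  "regular_fading f \<longleftrightarrow>
     f \<in> borel_measurable lborel \<and> (\<forall>h. 0 \<le> f h) \<and> (\<forall>h<0. f h = 0) \<and>
     (\<integral>\<^sup>+ h. ennreal (f h) \<partial>lborel) = 1 \<and>
     integrable (fadingM f) (\<lambda>h. h^2) \<and> (\<integral>h. h^2 \<partial>fadingM f) = 1 \<and>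
     (\<exists>\<alpha>>0. \<exists>c>0. \<exists>h0>0. \<forall>h. 0 < h \<and> h < h0 \<longrightarrow> f h = c * h powr (\<alpha> - 1))"

definition noiseM :: "nat \<Rightarrow> real \<Rightarrow> (nat \<Rightarrow> real) measure" where
  "noiseM n v = PiM {..<n} (\<lambda>_. density lborel (normal_density 0 (sqrt v)))"

definition voronoi :: "nat \<Rightarrow> (nat \<Rightarrow> real) set \<Rightarrow> (nat \<Rightarrow> real) \<Rightarrow> (nat \<Rightarrow> real) set" where
  "voronoi n T p = {y \<in> Rn n. \<forall>q\<in>T. sqdist_n n y p \<le> sqdist_n n y q}"

definition perr :: "nat \<Rightarrow> real \<Rightarrow> (nat \<Rightarrow> real) set \<Rightarrow> (nat \<Rightarrow> real) \<Rightarrow> real" where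
  "perr n v T p = measure (noiseM n v)
     {z \<in> space (noiseM n v). vadd n p z \<notin> voronoi n T p}"

definition avg_err :: "nat \<Rightarrow> real \<Rightarrow> (nat \<Rightarrow> real) set \<Rightarrow> (nat \<Rightarrow> real) \<Rightarrow> real \<Rightarrow> real" where
  "avg_err n v S h a =
     (let T = hmul n h ` S; A = T \<inter> hmul n h ` cube n a
      in (\<Sum>p\<in>A. perr n v T p) / real (card A))"

definition Pe :: "(real \<Rightarrow> real) \<Rightarrow> nat \<Rightarrow> (nat \<Rightarrow> real) set \<Rightarrow> real \<Rightarrow> real" where
  "Pe f n S v = (\<integral>h. real_of_ereal (Limsup at_top (\<lambda>a::real. ereal (avg_err n v S h a)))
                   \<partial>fadingVecM f n)"

definition E_lnH2 :: "(real \<Rightarrow> real) \<Rightarrow> real" where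
  "E_lnH2 f = (\<integral>h. ln (h^2) \<partial>fadingM f)"

definition Var_lnH2 :: "(real \<Rightarrow> real) \<Rightarrow> real" where
  "Var_lnH2 f = (\<integral>h. (ln (h^2) - E_lnH2 f)^2 \<partial>fadingM f)"

definition VNR :: "(real \<Rightarrow> real) \<Rightarrow> nat \<Rightarrow> (nat \<Rightarrow> real) set \<Rightarrow> real \<Rightarrow> real" where
  "VNR f n S v = exp (- 2 * NLD n S + E_lnH2 f) / (2 * pi * exp 1 * v)"

text \<open>mu*(n, eps): infimum of mu(S, eps) over n-dimensional ICs S (with finite positive
  density), where sigma^2(eps) is any noise variance v at which Pe(S) = eps.\<close>
definition mu_star :: "(real \<Rightarrow> real) \<Rightarrow> nat \<Rightarrow> real \<Rightarrow> real" where
  "mu_star f n \<epsilon> = Inf {VNR f n S v | S v. IC n S \<and> 0 < dens n S \<and> dens n S < \<infinity> \<and>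
                              0 < v \<and> Pe f n S v = \<epsilon>}"

definition Qfun :: "real \<Rightarrow> real" where
  "Qfun x = measure (density lborel std_normal_density) {x<..}"

definition Qinv :: "real \<Rightarrow> real" where
  "Qinv e = (THE x. Qfun x = e)"

end

theory Submission
  imports Defs "HOL-Real_Asymp.Real_Asymp"
begin

text \<open>
  Write \<open>Y\<close> for the logarithm of the normalized squared noise norm minus the empirical mean of the
  centred \<open>ln H\<^sup>2\<close>. Up to \<open>O(ln n / n)\<close>, \<open>Y\<close> is an average of independent letters
  \<open>Z\<^sup>2/\<sigma>\<^sup>2 - 1 - (ln H\<^sup>2 - E ln H\<^sup>2)\<close> of variance \<open>2 + Var ln H\<^sup>2\<close>. The characteristic function of
  \<open>Z\<^sup>2\<close> decays like a power, so Levy inversion gives a Berry-Esseen bound without any smoothing.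

  Converse: a cell of given volume captures at most as much Gaussian mass as a ball of that volume,
  so the error probability is at least the probability that \<open>Y\<close> exceeds the logarithm of the
  volume-to-noise ratio (up to \<open>O(ln n / n)\<close>).

  Achievability: points of a torus chosen greedily so that the average number of competitors within
  a fading dependent radius is \<open>O(1 / sqrt n)\<close>; the radius is below the effective one by a factor
  whose logarithm is only \<open>O(ln n / n)\<close>. An intermediate value argument in the noise variance then
  makes the error probability exactly \<open>\<epsilon>\<close>.
\<close>

section \<open>Characteristic functions and the Berry-Esseen bound\<close>

text \<open>The slope of \<open>Qfun\<close> sets the accuracy: moving the threshold for
  \<open>Y\<close> by \<open>ln n / n\<close> changes a probability by order
  \<open>ln n / sqrt n\<close>, which beats any error of order \<open>1 / sqrt n\<close>. Hence a
  Berry-Esseen bound, competitors of total probability O(1 / sqrt n) and a Stirling bound with error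
  O(ln n) are all sharp enough.

  Two obstacles shape the rest. The code may not depend on the fading, so competitors are averaged
  over channel and torus jointly before a point is fixed; in the converse only the total volume of
  the cells is known, hence a bound on cell mass that is linear in the volume. And the infimum runs
  over pairs of a code and a variance with error exactly \<epsilon>, where the error is an integral
  of a limsup over real cube sizes: its measurability, also at fading vectors with zero entries, and
  its continuity in the variance must come first. The power law of the fading density near 0 enters
  through the third absolute moment of \<open>ln H^2\<close>.\<close>

lemma integral_inverse_1_plus_square:
  shows "integrable lborel (\<lambda>x::real. inverse (1 + x\<^sup>2))"
    and "(\<integral>x. inverse (1 + x\<^sup>2) \<partial>(lborel :: real measure)) = pi"
  using integrable_inverse_1_plus_square LBINT_inverse_1_plus_square
  by (simp_all add: set_integrable_def interval_lebesgue_integral_def set_lebesgue_integral_def)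

text \<open>Levy inversion integrates the difference of the characteristic functions against a
  kernel of modulus at most \<open>2 / |t|\<close>. The factor \<open>|t|\<close> in the hypothesis
  cancels this singularity and leaves \<open>2 * K / (1 + t\<^sup>2)\<close>, with integral
  \<open>2 * pi * K\<close>; the prefactor \<open>1 / (2 * pi)\<close> makes the constant exactly
  \<open>K\<close>, whatever the interval and the truncation.\<close>

lemma measure_Ioc_diff_le_of_char:
  fixes M1 M2 :: "real measure"
  assumes "real_distribution M1" "real_distribution M2"
    and K: "\<And>t. cmod (char M1 t - char M2 t) \<le> K * (\<bar>t\<bar> / (1 + t\<^sup>2))"
    and ab: "a \<le> b"
    and at: "measure M1 {a} = 0" "measure M1 {b} = 0" "measure M2 {a} = 0" "measure M2 {b} = 0"
  shows "\<bar>measure M1 {a<..b} - measure M2 {a<..b}\<bar> \<le> K"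
proof -
  interpret M1: real_distribution M1 by (rule assms)
  interpret M2: real_distribution M2 by (rule assms)
  define F where "F t = (iexp (-(t * a)) - iexp (-(t * b))) / (\<i> * t)" for t :: real
  define J where "J M T = 1 / (2 * pi) * (CLBINT t=-T..T. F t * char M t)" for M and T :: real
  have [measurable]: "F \<in> borel_measurable borel" unfolding F_def by measurable
  have Fb: "cmod (F t) \<le> b - a" for t
  proof (cases "t = 0")
    case False
    then show ?thesis using Levy_Inversion_aux2[of "-b" "-a" t] ab by (simp add: F_def)
  qed (simp add: F_def ab)
  have Fc: "cmod (F t) * \<bar>t\<bar> \<le> 2" for t
  proof (cases "t = 0")
    case False
    have "cmod (iexp (-(t * a)) - iexp (-(t * b))) \<le> cmod (iexp (-(t * a))) + cmod (iexp (-(t * b)))"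
      by (rule norm_triangle_ineq4)
    then have "cmod (iexp (-(t * a)) - iexp (-(t * b))) \<le> 2" by (simp only: norm_exp_i_times)
    then show ?thesis using False by (simp add: F_def norm_divide norm_mult)
  qed simp
  have int: "integrable lborel (\<lambda>t. indicator (einterval (ereal (-T)) (ereal T)) t *\<^sub>R (F t * char M t))"
    if M: "real_distribution M" for M T
  proof -
    interpret M: real_distribution M by (rule M)
    have [measurable]: "char M \<in> borel_measurable borel"
      by (rule M.char_measurable)
    show ?thesis
    proof (rule Bochner_Integration.integrable_bound)
      show "integrable lborel (\<lambda>t. indicator {-T..T} t * (b - a) :: real)"
        by (intro integrable_mult_left integrable_real_indicator) (auto simp: emeasure_lborel_Icc_eq)
      have "cmod (F t * char M t) \<le> b - a" for t
        unfolding norm_mult using mult_mono[OF Fb[of t] M.cmod_char_le_1[of t]] ab by simp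
      then show "AE t in lborel. norm (indicator (einterval (ereal (-T)) (ereal T)) t *\<^sub>R (F t * char M t))
          \<le> norm (indicator {-T..T} t * (b - a) :: real)"
        using ab by (intro AE_I2) (auto simp: indicator_def einterval_def)
    qed measurable
  qed
  have bound: "cmod (J M1 T - J M2 T) \<le> K" if "T \<ge> 0" for T
  proof -
    have *: "(CLBINT t=-T..T. F t * char M t) =
      (CLINT t|lborel. indicator (einterval (ereal (-T)) (ereal T)) t *\<^sub>R (F t * char M t))" for M
      using that by (simp add: interval_lebesgue_integral_def set_lebesgue_integral_def)
    have K0: "0 \<le> K" using order_trans[OF norm_ge_zero K[of 1]] by simp
    have "cmod ((CLBINT t=-T..T. F t * char M1 t) - (CLBINT t=-T..T. F t * char M2 t))
      = cmod (CLINT t|lborel. indicator (einterval (ereal (-T)) (ereal T)) t *\<^sub>R (F t * char M1 t)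
         - indicator (einterval (ereal (-T)) (ereal T)) t *\<^sub>R (F t * char M2 t))"
      unfolding * by (subst Bochner_Integration.integral_diff) (use int assms(1,2) in auto)
    also have "\<dots> \<le> (\<integral>t. (2 * K) * inverse (1 + t\<^sup>2) \<partial>lborel)"
    proof (rule Bochner_Integration.integral_norm_bound_integral)
      show "integrable lborel (\<lambda>t. indicator (einterval (ereal (-T)) (ereal T)) t *\<^sub>R (F t * char M1 t)
         - indicator (einterval (ereal (-T)) (ereal T)) t *\<^sub>R (F t * char M2 t))"
        by (intro Bochner_Integration.integrable_diff int assms(1,2))
      show "integrable lborel (\<lambda>t::real. 2 * K * inverse (1 + t\<^sup>2))"
        by (intro integrable_mult_right integral_inverse_1_plus_square)
      show "cmod (indicator (einterval (ereal (-T)) (ereal T)) t *\<^sub>R (F t * char M1 t)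
         - indicator (einterval (ereal (-T)) (ereal T)) t *\<^sub>R (F t * char M2 t)) \<le> 2 * K * inverse (1 + t\<^sup>2)" for t
      proof -
        have "cmod (F t * char M1 t - F t * char M2 t) = cmod (F t) * cmod (char M1 t - char M2 t)"
          by (simp add: norm_mult[symmetric] right_diff_distrib)
        also have "\<dots> \<le> cmod (F t) * (K * (\<bar>t\<bar> / (1 + t\<^sup>2)))"
          by (intro mult_left_mono K) auto
        also have "\<dots> = (cmod (F t) * \<bar>t\<bar>) * (K * inverse (1 + t\<^sup>2))" by (simp add: field_simps)
        also have "\<dots> \<le> 2 * (K * inverse (1 + t\<^sup>2))"
          by (intro mult_right_mono Fc) (use K0 in \<open>auto intro!: mult_nonneg_nonneg add_nonneg_nonneg\<close>)
        finally have "cmod (F t * char M1 t - F t * char M2 t) \<le> 2 * K * inverse (1 + t\<^sup>2)" by simp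
        moreover have "0 \<le> 2 * K * inverse (1 + t\<^sup>2)"
          using K0 by (auto intro!: mult_nonneg_nonneg add_nonneg_nonneg)
        ultimately show ?thesis by (auto simp: indicator_def)
      qed
    qed
    also have "\<dots> = 2 * pi * K" using integral_inverse_1_plus_square(2) by simp
    finally have "cmod ((CLBINT t=-T..T. F t * char M1 t) - (CLBINT t=-T..T. F t * char M2 t)) \<le> 2 * pi * K" .
    then show ?thesis
      unfolding J_def right_diff_distrib[symmetric] norm_mult by (simp add: field_simps norm_divide norm_mult)
  qed
  have L1: "(\<lambda>T. J M1 (real T)) \<longlonglongrightarrow> complex_of_real (measure M1 {a<..b})"
    unfolding J_def F_def using M1.Levy_Inversion[OF ab at(1,2)] by simp
  have L2: "(\<lambda>T. J M2 (real T)) \<longlonglongrightarrow> complex_of_real (measure M2 {a<..b})"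
    unfolding J_def F_def using M2.Levy_Inversion[OF ab at(3,4)] by simp
  have "(\<lambda>T. cmod (J M1 (real T) - J M2 (real T))) \<longlonglongrightarrow>
      cmod (complex_of_real (measure M1 {a<..b}) - complex_of_real (measure M2 {a<..b}))"
    by (intro tendsto_intros L1 L2)
  then have "cmod (complex_of_real (measure M1 {a<..b}) - complex_of_real (measure M2 {a<..b})) \<le> K"
    by (rule LIMSEQ_le_const2) (use bound in auto)
  then show ?thesis by (simp flip: of_real_diff)
qed

text \<open>Levy inversion needs endpoints without mass. The atoms of both measures are countable,
  so \<open>a\<close> can be taken far to the left and \<open>b\<close> just to the right of
  \<open>x\<close> outside them; the limit at minus infinity and right continuity cost
  \<open>\<epsilon> / 2\<close> each.\<close>

lemma cdf_diff_le_of_char: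
  fixes M1 M2 :: "real measure"
  assumes "real_distribution M1" "real_distribution M2"
    and K: "\<And>t. cmod (char M1 t - char M2 t) \<le> K * (\<bar>t\<bar> / (1 + t\<^sup>2))"
  shows "\<bar>cdf M1 x - cdf M2 x\<bar> \<le> K"
proof (rule field_le_epsilon)
  interpret M1: real_distribution M1 by (rule assms)
  interpret M2: real_distribution M2 by (rule assms)
  have "countable ({x. measure M1 {x} \<noteq> 0} \<union> {x. measure M2 {x} \<noteq> 0})"
    by (intro countable_Un M2.countable_support M1.countable_support)
  then have count: "countable {x. measure M1 {x} \<noteq> 0 \<or> measure M2 {x} \<noteq> 0}"
    by (simp add: Un_def)
  let ?D = "\<lambda>x. cdf M1 x - cdf M2 x"
  fix \<epsilon> :: real
  assume "\<epsilon> > 0"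
  have "(?D \<longlongrightarrow> 0) at_bot"
    using M1.cdf_lim_at_bot M2.cdf_lim_at_bot by (intro tendsto_eq_intros) auto
  then have "eventually (\<lambda>y. \<bar>?D y\<bar> < \<epsilon> / 2 \<and> y \<le> x) at_bot"
    using \<open>\<epsilon> > 0\<close> by (simp only: tendsto_iff dist_real_def diff_0_right eventually_conj eventually_le_at_bot)
  then obtain M where "\<And>y. y \<le> M \<Longrightarrow> \<bar>?D y\<bar> < \<epsilon> / 2" "M \<le> x"
    unfolding eventually_at_bot_linorder by auto
  with open_minus_countable[OF count, of "{..< M}"] obtain a where a:
    "measure M1 {a} = 0" "measure M2 {a} = 0" "a < M" "a \<le> x" and 1: "\<bar>?D a\<bar> < \<epsilon> / 2"
    by auto
  have "(?D \<longlongrightarrow> ?D x) (at_right x)"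
    using M1.cdf_is_right_cont [of x] M2.cdf_is_right_cont [of x]
    by (intro tendsto_intros) (auto simp add: continuous_within)
  then have "eventually (\<lambda>y. \<bar>?D y - ?D x\<bar> < \<epsilon> / 2) (at_right x)"
    using \<open>\<epsilon> > 0\<close> by (simp only: tendsto_iff dist_real_def eventually_conj eventually_at_right_less)
  then obtain N where "N > x" "\<And>y. x < y \<Longrightarrow> y < N \<Longrightarrow> \<bar>?D y - ?D x\<bar> < \<epsilon> / 2"
    by (auto simp add: eventually_at_right[OF less_add_one])
  with open_minus_countable[OF count, of "{x <..< N}"] obtain b where b: "x < b" "b < N"
      "measure M1 {b} = 0" "measure M2 {b} = 0" and 2: "\<bar>?D b - ?D x\<bar> < \<epsilon> / 2"
    by (auto simp: abs_minus_commute)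
  from a b have "a < b" by auto
  then have "\<bar>measure M1 {a<..b} - measure M2 {a<..b}\<bar> \<le> K"
    using a b assms by (intro measure_Ioc_diff_le_of_char) auto
  then have "\<bar>?D b - ?D a\<bar> \<le> K"
    unfolding M1.cdf_diff_eq[OF \<open>a < b\<close>, symmetric] M2.cdf_diff_eq[OF \<open>a < b\<close>, symmetric]
    by (simp add: algebra_simps)
  with 1 2 show "\<bar>?D x\<bar> \<le> K + \<epsilon>" by linarith
qed

text \<open>Substituting \<^term>\<open>x = w + u / 2\<close> and \<^term>\<open>y = w - u / 2\<close> in the double integral for the
  squared modulus makes the phase \<^term>\<open>t * (x\<^sup>2 - y\<^sup>2)\<close> bilinear, so both integrals are Gaussian.\<close>
lemma norm_char_normal_square:
  "cmod (CLINT z|std_normal_distribution. iexp (t * z\<^sup>2)) = (1 + 4 * t\<^sup>2) powr (- (1 / 4))"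
proof -
  define g where "g x = std_normal_density x *\<^sub>R iexp (t * x\<^sup>2)" for x :: real
  define G where "G u y = g (y + u) * cnj (g y)" for u y
  define I where "I = (CLINT z|std_normal_distribution. iexp (t * z\<^sup>2))"
  have [measurable]: "g \<in> borel_measurable borel" unfolding g_def by measurable
  have [measurable]: "cnj \<in> borel_measurable borel"
    by (intro borel_measurable_continuous_onI continuous_on_cnj continuous_on_id)
  have I: "I = (CLINT x|lborel. g x)"
    unfolding I_def g_def by (subst integral_density) auto
  have ng: "norm (g x) = std_normal_density x" for x
    by (simp add: g_def)
  have intg: "integrable lborel g"
    by (rule Bochner_Integration.integrable_bound[OF integrable_normal_density[of 1 0]]) (auto simp: ng)
  \<comment> \<open>Absolute integrability for Fubini: the modulus of \<open>G\<close> is a product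
    of two normal densities, and its double integral is 1.\<close>
  have intG: "integrable (lborel \<Otimes>\<^sub>M lborel) (case_prod G)"
  proof (rule integrableI_bounded)
    show m[measurable]: "case_prod G \<in> borel_measurable (lborel \<Otimes>\<^sub>M lborel)"
      unfolding G_def by measurable
    have "(\<integral>\<^sup>+ p. ennreal (norm (case_prod G p)) \<partial>(lborel \<Otimes>\<^sub>M lborel)) =
        (\<integral>\<^sup>+ y. \<integral>\<^sup>+ u. ennreal (std_normal_density (y + u)) * ennreal (std_normal_density y) \<partial>lborel \<partial>lborel)"
      by (subst lborel_pair.nn_integral_snd[symmetric])
         (auto simp: G_def norm_mult ng ennreal_mult)
    also have "\<dots> = (\<integral>\<^sup>+ y. ennreal (std_normal_density y) \<partial>lborel)"
    proof (rule nn_integral_cong)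
      fix y
      have "(\<integral>\<^sup>+ u. ennreal (std_normal_density (y + u)) \<partial>lborel) = (\<integral>\<^sup>+ u. ennreal (std_normal_density u) \<partial>lborel)"
        using nn_integral_real_affine[of "\<lambda>u. ennreal (std_normal_density u)" 1 y] by simp
      also have "\<dots> = 1"
        by (subst nn_integral_eq_integral) auto
      finally show "(\<integral>\<^sup>+ u. ennreal (std_normal_density (y + u)) * ennreal (std_normal_density y) \<partial>lborel)
        = ennreal (std_normal_density y)"
        by (subst nn_integral_multc) auto
    qed
    also have "\<dots> = 1" by (subst nn_integral_eq_integral) auto
    finally show "(\<integral>\<^sup>+ p. ennreal (norm (case_prod G p)) \<partial>(lborel \<Otimes>\<^sub>M lborel)) < \<infinity>" by simp
  qed
  have "I * cnj I = (CLINT y|lborel. I * cnj (g y))"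
    using intg by (simp add: I)
  also have "\<dots> = (CLINT y|lborel. CLINT u|lborel. G u y)"
  proof (rule Bochner_Integration.integral_cong[OF refl])
    fix y
    have "I = (CLINT u|lborel. g (y + u))"
      unfolding I using lborel_integral_real_affine[of 1 g y] by simp
    then show "I * cnj (g y) = (CLINT u|lborel. G u y)" by (simp add: G_def)
  qed
  also have "\<dots> = (CLINT u|lborel. CLINT y|lborel. G u y)"
    by (rule lborel_pair.Fubini_integral[OF intG])
  also have "\<dots> = (CLINT u|lborel. complex_of_real ((1 + 4 * t\<^sup>2) powr (- (1 / 2)) * normal_density 0 (sqrt (2 / (1 + 4 * t\<^sup>2))) u))"
  proof (rule Bochner_Integration.integral_cong[OF refl])
    fix u :: real
    have p: "1 + 4 * t\<^sup>2 > 0" by (intro add_pos_nonneg) auto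
    \<comment> \<open>Centring \<open>y\<close> at \<open>- u / 2\<close> and rescaling by
      \<open>1 / sqrt 2\<close> splits the two densities into a Gaussian in \<open>u\<close> and a
      standard normal density in \<open>s\<close>. The phase is linear in \<open>s\<close>, so the
      integral over \<open>s\<close> is a standard normal characteristic function.\<close>
    have "(CLINT y|lborel. G u y) = \<bar>1 / sqrt 2\<bar> *\<^sub>R (CLINT s|lborel. G u (- u / 2 + 1 / sqrt 2 * s))"
      by (rule lborel_integral_real_affine) auto
    also have "(\<lambda>s. G u (- u / 2 + 1 / sqrt 2 * s)) =
      (\<lambda>s. complex_of_real (1 / sqrt (2 * pi) * exp (- u\<^sup>2 / 4)) * (std_normal_density s *\<^sub>R iexp (sqrt 2 * t * u * s)))"
    proof
      fix s
      define a where "a = - u / 2 + 1 / sqrt 2 * s + u"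
      define b where "b = - u / 2 + 1 / sqrt 2 * s"
      have ab: "a\<^sup>2 - b\<^sup>2 = sqrt 2 * u * s" "a\<^sup>2 + b\<^sup>2 = s\<^sup>2 + u\<^sup>2 / 2"
        unfolding a_def b_def by (simp_all add: field_simps power2_eq_square)
      have "G u b = (std_normal_density a * std_normal_density b) *\<^sub>R (iexp (t * a\<^sup>2) * cnj (iexp (t * b\<^sup>2)))"
        unfolding G_def g_def a_def b_def by (simp add: scaleR_conv_of_real)
      also have "iexp (t * a\<^sup>2) * cnj (iexp (t * b\<^sup>2)) = iexp (t * (a\<^sup>2 - b\<^sup>2))"
        by (simp add: exp_cnj exp_add[symmetric] algebra_simps)
      also have "t * (a\<^sup>2 - b\<^sup>2) = sqrt 2 * t * u * s"
        unfolding ab by simp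
      also have "std_normal_density a * std_normal_density b = 1 / (2 * pi) * exp (- (a\<^sup>2 + b\<^sup>2) / 2)"
        by (simp add: std_normal_density_def exp_add[symmetric] field_simps)
      also have "\<dots> = (1 / sqrt (2 * pi) * exp (- u\<^sup>2 / 4)) * std_normal_density s"
        unfolding ab std_normal_density_def by (simp add: exp_add[symmetric] field_simps)
      finally show "G u (- u / 2 + 1 / sqrt 2 * s) = complex_of_real (1 / sqrt (2 * pi) * exp (- u\<^sup>2 / 4)) * (std_normal_density s *\<^sub>R iexp (sqrt 2 * t * u * s))"
        unfolding b_def by (simp add: scaleR_conv_of_real mult_ac)
    qed
    also have "(CLINT s|lborel. complex_of_real (1 / sqrt (2 * pi) * exp (- u\<^sup>2 / 4)) * (std_normal_density s *\<^sub>R iexp (sqrt 2 * t * u * s)))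
      = complex_of_real (1 / sqrt (2 * pi) * exp (- u\<^sup>2 / 4)) * char std_normal_distribution (sqrt 2 * t * u)"
      unfolding char_def
      by (subst integral_density) (simp_all only: integral_mult_right_zero, auto)
    also have "char std_normal_distribution (sqrt 2 * t * u) = exp (- (sqrt 2 * t * u)\<^sup>2 / 2)"
      by (simp add: char_std_normal_distribution)
    also have "\<bar>1 / sqrt 2\<bar> *\<^sub>R (complex_of_real (1 / sqrt (2 * pi) * exp (- u\<^sup>2 / 4)) * complex_of_real (exp (- (sqrt 2 * t * u)\<^sup>2 / 2)))
      = complex_of_real (1 / sqrt 2 * (1 / sqrt (2 * pi)) * (exp (- u\<^sup>2 / 4) * exp (- (sqrt 2 * t * u)\<^sup>2 / 2)))"
      by (simp add: scaleR_conv_of_real mult_ac)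
    also have "exp (- u\<^sup>2 / 4) * exp (- (sqrt 2 * t * u)\<^sup>2 / 2) = exp (- (u\<^sup>2 * (1 + 4 * t\<^sup>2) / 4))"
      unfolding exp_add[symmetric] by (simp add: field_simps power_mult_distrib)
    also have "1 / sqrt 2 * (1 / sqrt (2 * pi)) * exp (- (u\<^sup>2 * (1 + 4 * t\<^sup>2) / 4)) =
       (1 + 4 * t\<^sup>2) powr (- (1 / 2)) * normal_density 0 (sqrt (2 / (1 + 4 * t\<^sup>2))) u"
      using p by (simp add: normal_density_def powr_minus powr_half_sqrt real_sqrt_divide real_sqrt_mult field_simps)
    finally show "(CLINT y|lborel. G u y) = complex_of_real ((1 + 4 * t\<^sup>2) powr (- (1 / 2)) * normal_density 0 (sqrt (2 / (1 + 4 * t\<^sup>2))) u)" .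
  qed
  also have "\<dots> = complex_of_real ((1 + 4 * t\<^sup>2) powr (- (1 / 2)))"
  proof -
    have "sqrt (2 / (1 + 4 * t\<^sup>2)) > 0" by (auto intro!: divide_pos_pos add_pos_nonneg)
    then show ?thesis
      unfolding Bochner_Integration.integral_complex_of_real by (subst integral_mult_right_zero) (simp add: integral_normal_density)
  qed
  finally have "(cmod I)\<^sup>2 = (1 + 4 * t\<^sup>2) powr (- (1 / 2))"
    unfolding complex_norm_square[symmetric] of_real_eq_iff by (metis of_real_eq_iff)
  also have "\<dots> = ((1 + 4 * t\<^sup>2) powr (- (1 / 4)))\<^sup>2"
    by (simp add: power2_eq_square powr_add[symmetric])
  finally show ?thesis unfolding I_def[symmetric]
    by (simp add: power2_eq_iff_nonneg)
qed

text \<open>Dividing by \<open>r\<close> moves both points into the unit disc, where the power is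
  Lipschitz with constant \<open>n\<close>. Scaling back keeps the factor \<open>r ^ n\<close>,
  which later becomes the Gaussian factor \<open>exp (- t\<^sup>2 / 4)\<close>; the stray
  \<open>1 / r\<close> is at most 2.\<close>

lemma norm_power_diff_le:
  fixes z w :: complex
  assumes "norm z \<le> r" "norm w \<le> r" "1 \<le> 2 * r" "n > 0"
  shows "norm (z ^ n - w ^ n) \<le> 2 * real n * r ^ n * norm (z - w)"
proof -
  have r: "r > 0" using assms by simp
  have "norm ((z / r) ^ n - (w / r) ^ n) \<le> n * norm (z / r - w / r)"
    using assms r by (intro norm_power_diff) (simp_all add: norm_divide)
  also have "z / r - w / r = (z - w) / r" by (simp add: diff_divide_distrib)
  also have "(z / r) ^ n - (w / r) ^ n = (z ^ n - w ^ n) / r ^ n" by (simp add: power_divide diff_divide_distrib)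
  finally have "norm (z ^ n - w ^ n) \<le> n * r ^ n * (norm (z - w) / r)"
    using r by (simp add: norm_divide norm_power field_simps)
  also have "n * r ^ n * (norm (z - w) / r) \<le> n * r ^ n * (2 * norm (z - w))"
    using r mult_right_mono[OF assms(3) norm_ge_zero[of "z - w"]]
    by (intro mult_left_mono) (auto simp: field_simps)
  finally show ?thesis using r by (simp add: mult_ac)
qed

lemma exp_minus_second_order:
  fixes x :: real assumes "x \<ge> 0"
  shows "\<bar>exp (- x) - (1 - x)\<bar> \<le> x\<^sup>2 / 2"
proof -
  have 1: "1 - x \<le> exp (- x)" using exp_ge_add_one_self[of "-x"] by simp
  have "(\<lambda>x::real. 1 - x + x\<^sup>2 / 2 - exp (- x)) 0 \<le> (\<lambda>x. 1 - x + x\<^sup>2 / 2 - exp (- x)) x"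
  proof (rule DERIV_nonneg_imp_nondecreasing[OF assms])
    fix y :: real assume "0 \<le> y"
    show "\<exists>d. ((\<lambda>x. 1 - x + x\<^sup>2 / 2 - exp (- x)) has_real_derivative d) (at y) \<and> 0 \<le> d"
      by (rule exI[of _ "- 1 + y + exp (- y)"]) (use exp_ge_add_one_self[of "-y"] in \<open>auto intro!: derivative_eq_intros\<close>)
  qed
  with 1 show ?thesis by auto
qed

lemma exp_ge_quadratic: "(1::real) + x + x\<^sup>2 / 2 \<le> exp x" if "x \<ge> 0"
  using exp_lower_Taylor_quadratic[OF that] by simp

lemma integrable_moments_of_third:
  fixes X :: "'a \<Rightarrow> real"
  assumes "prob_space M" and [measurable]: "X \<in> borel_measurable M" and "integrable M (\<lambda>x. \<bar>X x\<bar> ^ 3)"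
  shows "integrable M X" "integrable M (\<lambda>x. (X x)\<^sup>2)"
proof -
  interpret prob_space M by fact
  show i2: "integrable M (\<lambda>x. (X x)\<^sup>2)"
  proof (rule Bochner_Integration.integrable_bound)
    show "integrable M (\<lambda>x. 1 + \<bar>X x\<bar> ^ 3)" using assms by simp
    show "AE x in M. norm ((X x)\<^sup>2) \<le> norm (1 + \<bar>X x\<bar> ^ 3)"
    proof (rule AE_I2)
      fix w
      define x where "x = X w"
      have "x\<^sup>2 \<le> 1 + \<bar>x\<bar> ^ 3"
      proof (cases "\<bar>x\<bar> \<le> 1")
        case True then have "x\<^sup>2 \<le> 1" by (simp add: abs_square_le_1)
        then show ?thesis by (simp add: add_increasing2)
      next
        case False
        then have "\<bar>x\<bar> ^ 2 \<le> \<bar>x\<bar> ^ 3" by (intro power_increasing) auto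
        then show ?thesis by simp
      qed
      then show "norm ((X w)\<^sup>2) \<le> norm (1 + \<bar>X w\<bar> ^ 3)" by (simp add: x_def)
    qed
  qed measurable
  show "integrable M X"
    by (rule square_integrable_imp_integrable) (use i2 in auto)
qed

context
  fixes \<mu> :: "real measure" and s :: real
  assumes mu: "real_distribution \<mu>"
    and int3: "integrable \<mu> (\<lambda>x. \<bar>x\<bar> ^ 3)"
    and mean: "(\<integral>x. x \<partial>\<mu>) = 0"
    and var: "(\<integral>x. x\<^sup>2 \<partial>\<mu>) = s\<^sup>2"
    and s: "s > 0"
begin

lemma char_diff_gaussian:
  obtains \<rho> where "\<rho> \<ge> 0" "\<And>t. cmod (char \<mu> t - (1 - t\<^sup>2 * s\<^sup>2 / 2)) \<le> \<rho> * \<bar>t\<bar> ^ 3"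
proof -
  interpret real_distribution \<mu> by (rule mu)
  have id: "(\<lambda>x. x) \<in> borel_measurable \<mu>" by simp
  note i1 = integrable_moments_of_third(1)[OF prob_space_axioms id int3]
    and i2 = integrable_moments_of_third(2)[OF prob_space_axioms id int3]
  define \<rho> where "\<rho> = expectation (\<lambda>x. \<bar>x\<bar> ^ 3) / 6"
  have *: "cmod (char \<mu> t - (1 - t\<^sup>2 * s\<^sup>2 / 2)) \<le> \<rho> * \<bar>t\<bar> ^ 3" for t
  proof -
    have "cmod (char \<mu> t - (1 - t\<^sup>2 * s\<^sup>2 / 2)) \<le>
      (t\<^sup>2 / 6) * expectation (\<lambda>x. min (6 * x\<^sup>2) (\<bar>t\<bar> * \<bar>x\<bar> ^ 3))"
      by (rule char_approx3[OF i1 mean i2]) (simp add: mean var)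
    also have "expectation (\<lambda>x. min (6 * x\<^sup>2) (\<bar>t\<bar> * \<bar>x\<bar> ^ 3)) \<le> expectation (\<lambda>x. \<bar>t\<bar> * \<bar>x\<bar> ^ 3)"
      using i2 int3 by (intro integral_mono integrable_min) auto
    also have "\<dots> = \<bar>t\<bar> * (6 * \<rho>)" by (simp add: \<rho>_def)
    also have "t\<^sup>2 / 6 * (\<bar>t\<bar> * (6 * \<rho>)) = \<rho> * \<bar>t\<bar> ^ 3"
      by (simp add: power2_eq_square power3_eq_cube)
    finally show ?thesis by (simp add: mult_left_mono)
  qed
  show thesis by (rule that[of \<rho>]) (use * in \<open>auto simp: \<rho>_def\<close>)
qed

text \<open>Put \<open>x = |t| / sqrt n\<close>. The characteristic function of one letter and
  \<open>exp (- x\<^sup>2 / 2)\<close> both lie in the disc of radius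
  \<open>exp (- x\<^sup>2 / 4)\<close> and differ by a multiple of \<open>x ^ 3\<close>. The
  difference of their powers is then of order \<open>n * x ^ 3 = |t| ^ 3 / sqrt n\<close>, with the
  Gaussian factor kept.\<close>

lemma char_power_diff_gaussian_small:
  obtains \<delta> C where "\<delta> > 0" "C \<ge> 0"
    "\<And>n t. n > 0 \<Longrightarrow> \<bar>t\<bar> \<le> \<delta> * sqrt (real n) \<Longrightarrow>
      cmod (char \<mu> (t / (s * sqrt (real n))) ^ n - exp (- t\<^sup>2 / 2)) \<le> C / sqrt (real n) * (\<bar>t\<bar> ^ 3 * exp (- t\<^sup>2 / 4))"
proof -
  obtain \<rho> where rho: "\<rho> \<ge> 0" "\<And>t. cmod (char \<mu> t - (1 - t\<^sup>2 * s\<^sup>2 / 2)) \<le> \<rho> * \<bar>t\<bar> ^ 3"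
    using char_diff_gaussian by blast
  \<comment> \<open>\<open>\<delta>\<close> keeps the cubic remainder below
    \<open>x\<^sup>2 / 4\<close>, half of the quadratic decrease, so that the modulus stays below
    \<open>1 - x\<^sup>2 / 4\<close>. In \<open>C\<close>, the term \<open>1 / 8\<close> is the
    second order error of the exponential and the factor 2 comes from
    \<open>norm_power_diff_le\<close>.\<close>
  define \<delta> where "\<delta> = min 1 (s ^ 3 / (4 * (\<rho> + 1)))"
  define C where "C = 2 * (\<rho> / s ^ 3 + 1 / 8)"
  have d: "\<delta> > 0" "\<delta> \<le> 1" "\<rho> * \<delta> \<le> s ^ 3 / 4"
  proof -
    show "\<delta> > 0" "\<delta> \<le> 1" using s rho by (auto simp: \<delta>_def)
    have "\<rho> * \<delta> \<le> \<rho> * (s ^ 3 / (4 * (\<rho> + 1)))" by (rule mult_left_mono) (auto simp: \<delta>_def rho)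
    also have "\<dots> \<le> s ^ 3 / 4" using rho s by (simp add: field_simps)
    finally show "\<rho> * \<delta> \<le> s ^ 3 / 4" .
  qed
  show thesis
  proof (rule that[of \<delta> C])
    show "\<delta> > 0" "C \<ge> 0" using d rho s by (auto simp: C_def)
    fix n :: nat and t :: real
    assume n: "n > 0" and t: "\<bar>t\<bar> \<le> \<delta> * sqrt (real n)"
    define q where "q = sqrt (real n)"
    have q: "q > 0" "q\<^sup>2 = real n" using n by (auto simp: q_def)
    define x where "x = \<bar>t\<bar> / q"
    have x: "x \<ge> 0" "x \<le> \<delta>" using t q d by (auto simp: x_def q_def field_simps)
    then have x1: "x \<le> 1" using d by simp
    have x2: "x\<^sup>2 = t\<^sup>2 / n" using q by (simp add: x_def power_divide)
    define \<tau> where "\<tau> = t / (s * q)"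
    have tau: "\<bar>\<tau>\<bar> = x / s" "\<tau>\<^sup>2 * s\<^sup>2 = x\<^sup>2" using s q by (simp_all add: \<tau>_def x_def power_divide power_mult_distrib abs_mult)
    define z where "z = char \<mu> \<tau>"
    define w where "w = complex_of_real (exp (- (x\<^sup>2 / 2)))"
    define r where "r = exp (- (x\<^sup>2 / 4))"
    have x2le: "x\<^sup>2 \<le> 1" using x x1 by (simp add: power_le_one)
    have 1: "cmod (z - complex_of_real (1 - x\<^sup>2 / 2)) \<le> \<rho> / s ^ 3 * x ^ 3"
      using rho(2)[of \<tau>] unfolding tau z_def by (simp add: power_divide)
    have x32: "\<rho> / s ^ 3 * x ^ 3 \<le> x\<^sup>2 / 4"
    proof -
      have "\<rho> / s ^ 3 * x ^ 3 = (\<rho> * x) * (x\<^sup>2 / s ^ 3)" by (simp add: power2_eq_square power3_eq_cube)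
      also have "\<dots> \<le> (s ^ 3 / 4) * (x\<^sup>2 / s ^ 3)"
      proof (rule mult_right_mono)
        have "\<rho> * x \<le> \<rho> * \<delta>" using x rho by (intro mult_left_mono) auto
        with d show "\<rho> * x \<le> s ^ 3 / 4" by simp
      qed (use s in auto)
      finally show ?thesis using s by simp
    qed
    have "cmod z \<le> cmod (z - complex_of_real (1 - x\<^sup>2 / 2)) + cmod (complex_of_real (1 - x\<^sup>2 / 2))"
      using norm_triangle_ineq[of "z - complex_of_real (1 - x\<^sup>2 / 2)" "complex_of_real (1 - x\<^sup>2 / 2)"] by simp
    also have "cmod (complex_of_real (1 - x\<^sup>2 / 2)) = 1 - x\<^sup>2 / 2" unfolding norm_of_real using x2le by simp
    finally have "cmod z \<le> 1 - x\<^sup>2 / 4" using 1 x32 by linarith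
    also have "\<dots> \<le> r" using exp_ge_add_one_self[of "- (x\<^sup>2 / 4)"] by (simp add: r_def)
    finally have zr: "cmod z \<le> r" .
    have wr: "cmod w \<le> r" by (simp add: w_def r_def)
    have r1: "1 \<le> 2 * r" using exp_ge_add_one_self[of "- (x\<^sup>2 / 4)"] x2le unfolding r_def by linarith
    have "cmod (z - w) \<le> cmod (z - complex_of_real (1 - x\<^sup>2 / 2)) + cmod (complex_of_real (1 - x\<^sup>2 / 2) - w)"
      using norm_triangle_ineq[of "z - complex_of_real (1 - x\<^sup>2 / 2)" "complex_of_real (1 - x\<^sup>2 / 2) - w"] by simp
    also have "cmod (complex_of_real (1 - x\<^sup>2 / 2) - w) \<le> x ^ 3 / 8"
    proof -
      have "cmod (complex_of_real (1 - x\<^sup>2 / 2) - w) = \<bar>exp (- (x\<^sup>2 / 2)) - (1 - x\<^sup>2 / 2)\<bar>"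
        unfolding w_def of_real_diff[symmetric] norm_of_real by simp
      also have "\<dots> \<le> (x\<^sup>2 / 2)\<^sup>2 / 2" by (rule exp_minus_second_order) simp
      also have "\<dots> = x ^ 4 / 8" by (simp add: power2_eq_square eval_nat_numeral)
      also have "x ^ 4 \<le> x ^ 3" using x x1 by (intro power_decreasing) auto
      finally show ?thesis by simp
    qed
    finally have zw: "cmod (z - w) \<le> (\<rho> / s ^ 3 + 1 / 8) * x ^ 3" using 1 by (simp add: algebra_simps)
    have rn: "r ^ n = exp (- t\<^sup>2 / 4)" "w ^ n = exp (- t\<^sup>2 / 2)"
      using n unfolding r_def w_def x2 of_real_power[symmetric] exp_of_nat_mult[symmetric] by (simp_all add: field_simps)
    have "cmod (z ^ n - w ^ n) \<le> 2 * real n * r ^ n * cmod (z - w)"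
      by (rule norm_power_diff_le[OF zr wr r1 n])
    also have "\<dots> \<le> 2 * real n * r ^ n * ((\<rho> / s ^ 3 + 1 / 8) * x ^ 3)"
      by (intro mult_left_mono zw) (auto simp: r_def)
    also have "\<dots> = C * r ^ n * (real n * x ^ 3)" by (simp add: C_def)
    also have "real n * x ^ 3 = \<bar>t\<bar> ^ 3 / q"
      using q by (simp add: x_def power_divide q(2)[symmetric] power2_eq_square power3_eq_cube)
    finally show "cmod (char \<mu> (t / (s * sqrt (real n))) ^ n - exp (- t\<^sup>2 / 2)) \<le> C / sqrt (real n) * (\<bar>t\<bar> ^ 3 * exp (- t\<^sup>2 / 4))"
      unfolding rn z_def \<tau>_def q_def by (simp add: mult_ac)
  qed
qed

text \<open>Near the origin the Gaussian comparison applies. Beyond \<open>\<delta> * sqrt n\<close>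
  both terms are small by themselves: \<open>n\<close> factors of power decay, each bounded away
  from 1, are exponentially small, and one factor \<open>1 / (1 + 4 * \<tau>\<^sup>2)\<close> can be
  set aside for integrability in \<open>t\<close>.\<close>

lemma char_power_diff_gaussian:
  assumes dec: "\<And>t. cmod (char \<mu> t) \<le> (1 + 4 * t\<^sup>2) powr (- (1 / 4))"
  obtains C where "C \<ge> 0" "\<And>n t. n \<ge> 4 \<Longrightarrow>
      cmod (char \<mu> (t / (s * sqrt (real n))) ^ n - exp (- t\<^sup>2 / 2)) \<le> C / sqrt (real n) * (\<bar>t\<bar> / (1 + t\<^sup>2))"
proof -
  obtain \<delta> C0 where d: "\<delta> > 0" "C0 \<ge> 0"
    and small: "\<And>n t. n > 0 \<Longrightarrow> \<bar>t\<bar> \<le> \<delta> * sqrt (real n) \<Longrightarrow>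
      cmod (char \<mu> (t / (s * sqrt (real n))) ^ n - exp (- t\<^sup>2 / 2)) \<le> C0 / sqrt (real n) * (\<bar>t\<bar> ^ 3 * exp (- t\<^sup>2 / 4))"
    using char_power_diff_gaussian_small by blast
  \<comment> \<open>Outside the small region \<open>1 + 4 * \<tau>\<^sup>2\<close> is at least
    \<open>b\<close>, which makes high powers negligible, and at least
    \<open>c * (1 + t\<^sup>2) / n\<close>, which supplies decay in \<open>t\<close>.\<close>
  define b where "b = 1 + 4 * (\<delta> / s)\<^sup>2"
  define c where "c = min 1 (4 / s\<^sup>2)"
  have b: "b > 1" using d s by (simp add: b_def)
  have c: "c > 0" using s by (simp add: c_def)
  have "((\<lambda>n. real n * (b powr (1/4)) powr (- real n)) \<longlonglongrightarrow> 0)"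
  proof -
    have "norm (b powr (- 1/4)) < 1" using b powr_less_mono[of "-1/4" 0 b] by simp
    then have "(\<lambda>n. real n * (b powr (- 1/4)) ^ n) \<longlonglongrightarrow> 0" by (rule powser_times_n_limit_0)
    then show ?thesis using b by (simp add: powr_powr powr_realpow[symmetric])
  qed
  then have "Bseq (\<lambda>n. real n * (b powr (1/4)) powr (- real n))" by (intro convergent_imp_Bseq convergentI)
  then obtain B where B: "B > 0" "\<And>n. norm (real n * (b powr (1/4)) powr (- real n)) \<le> B" by (auto simp: Bseq_def)
  define C where "C = max (32 * C0) ((2 + B * b / c) / \<delta>)"
  show thesis
  proof (rule that[of C])
    show "C \<ge> 0" using d by (simp add: C_def)
    fix n :: nat and t :: real assume n4: "n \<ge> 4"
    then have n: "n > 0" by simp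
    have q: "sqrt (real n) > 0" using n by simp
    show "cmod (char \<mu> (t / (s * sqrt (real n))) ^ n - exp (- t\<^sup>2 / 2)) \<le> C / sqrt (real n) * (\<bar>t\<bar> / (1 + t\<^sup>2))"
    proof (cases "\<bar>t\<bar> \<le> \<delta> * sqrt (real n)")
      case True
      define y where "y = t\<^sup>2 / 4"
      have y: "y \<ge> 0" by (simp add: y_def)
      have "\<bar>t\<bar> ^ 3 * exp (- t\<^sup>2 / 4) \<le> 32 * (\<bar>t\<bar> / (1 + t\<^sup>2))"
      proof -
        have "t\<^sup>2 * (1 + t\<^sup>2) = 4 * y + 16 * y\<^sup>2" by (simp add: y_def power2_eq_square field_simps)
        also have "\<dots> \<le> 32 * (1 + y + y\<^sup>2 / 2)" using y by simp
        also have "\<dots> \<le> 32 * exp y" using exp_ge_quadratic[OF y] by simp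
        finally have "t\<^sup>2 * (1 + t\<^sup>2) \<le> 32 * exp y" .
        then obtain E where E: "t\<^sup>2 * (1 + t\<^sup>2) \<le> 32 * E" "exp (- t\<^sup>2 / 4) = 1 / E" "E > 0"
          by (metis exp_gt_zero exp_minus inverse_eq_divide minus_divide_left y_def)
        have "\<bar>t\<bar> * (t\<^sup>2 * (1 + t\<^sup>2)) \<le> \<bar>t\<bar> * (32 * E)" using E(1) by (intro mult_left_mono) auto
        moreover have "\<bar>t\<bar> ^ 3 = \<bar>t\<bar> * t\<^sup>2" by (simp add: power3_eq_cube power2_eq_square)
        moreover have "1 + t\<^sup>2 > 0" by (simp add: add_pos_nonneg)
        ultimately show ?thesis unfolding E(2) using E(3) by (simp add: field_simps)
      qed
      then have "C0 / sqrt (real n) * (\<bar>t\<bar> ^ 3 * exp (- t\<^sup>2 / 4)) \<le> C0 / sqrt (real n) * (32 * (\<bar>t\<bar> / (1 + t\<^sup>2)))"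
        using d by (intro mult_left_mono) auto
      also have "\<dots> = (32 * C0) * (1 / sqrt (real n) * (\<bar>t\<bar> / (1 + t\<^sup>2)))" by simp
      also have "\<dots> \<le> C * (1 / sqrt (real n) * (\<bar>t\<bar> / (1 + t\<^sup>2)))"
        by (intro mult_right_mono) (auto simp: C_def add_nonneg_nonneg)
      finally show ?thesis using small[OF n True] by simp
    next
      case False
      define \<tau> where "\<tau> = t / (s * sqrt (real n))"
      have tau2: "\<tau>\<^sup>2 = t\<^sup>2 / (s\<^sup>2 * n)" using n by (simp add: \<tau>_def power_divide power_mult_distrib)
      have t2: "\<delta>\<^sup>2 * n \<le> t\<^sup>2"
      proof -
        have "(\<delta> * sqrt (real n))\<^sup>2 \<le> \<bar>t\<bar>\<^sup>2" using False d by (intro power_mono) auto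
        then show ?thesis by (simp add: power_mult_distrib)
      qed
      have tb: "1 + 4 * \<tau>\<^sup>2 \<ge> b"
        using t2 n s unfolding b_def tau2 by (simp add: power_divide field_simps)
      have tc: "1 + 4 * \<tau>\<^sup>2 \<ge> c * (1 + t\<^sup>2) / n"
      proof -
        have "c * (1 + t\<^sup>2) = c + c * t\<^sup>2" by (simp add: algebra_simps)
        also have "\<dots> \<le> n + 4 / s\<^sup>2 * t\<^sup>2"
        proof (rule add_mono)
          show "c \<le> n" using n by (simp add: c_def min_def)
          show "c * t\<^sup>2 \<le> 4 / s\<^sup>2 * t\<^sup>2" by (rule mult_right_mono) (auto simp: c_def)
        qed
        finally have "c * (1 + t\<^sup>2) / n \<le> (n + 4 / s\<^sup>2 * t\<^sup>2) / n" by (rule divide_right_mono) simp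
        also have "\<dots> = 1 + 4 * \<tau>\<^sup>2" using n unfolding tau2 by (simp add: add_divide_distrib)
        finally show ?thesis .
      qed
      have t1: "1 + t\<^sup>2 > 0" by (simp add: add_pos_nonneg)
      have pos: "1 + 4 * \<tau>\<^sup>2 > 0" using tb b by simp
      have "cmod (char \<mu> \<tau> ^ n) \<le> ((1 + 4 * \<tau>\<^sup>2) powr (- (1 / 4))) ^ n"
        unfolding norm_power by (intro power_mono dec) auto
      also have "\<dots> = (1 + 4 * \<tau>\<^sup>2) powr (- (real n / 4))"
        using pos by (simp add: powr_realpow[symmetric] powr_powr)
      \<comment> \<open>The factor split off gives \<open>n / (c * (1 + t\<^sup>2))\<close>. Its
        \<open>n\<close> is repaid by the remaining power, which is O(1 / n); that power can be
        compared with \<open>b\<close> because its exponent is nonpositive for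
        \<open>n \<ge> 4\<close>.\<close>
      also have "\<dots> = (1 + 4 * \<tau>\<^sup>2) powr (1 - real n / 4) / (1 + 4 * \<tau>\<^sup>2)"
        using pos powr_diff[of "1 + 4 * \<tau>\<^sup>2" "1 - real n / 4" 1] by (simp add: powr_one)
      finally have A: "cmod (char \<mu> \<tau> ^ n) \<le> (1 + 4 * \<tau>\<^sup>2) powr (1 - real n / 4) / (1 + 4 * \<tau>\<^sup>2)" .
      have "(1 + 4 * \<tau>\<^sup>2) powr (1 - real n / 4) \<le> b powr (1 - real n / 4)"
        using tb b n4 by (intro powr_mono2') auto
      also have "\<dots> = b * (b powr (1 / 4)) powr (- real n)"
        using b powr_add[of b 1 "- (real n / 4)"] by (simp add: powr_powr powr_one)
      also have "\<dots> \<le> b * (B / n)"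
        using B(2)[of n] n b by (intro mult_left_mono) (auto simp: field_simps)
      finally have D: "(1 + 4 * \<tau>\<^sup>2) powr (1 - real n / 4) \<le> b * (B / n)" .
      have E: "1 / (1 + 4 * \<tau>\<^sup>2) \<le> n / (c * (1 + t\<^sup>2))"
      proof -
        have "1 / (1 + 4 * \<tau>\<^sup>2) \<le> 1 / (c * (1 + t\<^sup>2) / n)"
          using c t1 n pos by (intro divide_left_mono tc mult_pos_pos divide_pos_pos) auto
        then show ?thesis by simp
      qed
      have "cmod (char \<mu> \<tau> ^ n) \<le> (b * (B / n)) * (n / (c * (1 + t\<^sup>2)))"
        using mult_mono[OF D E] pos b B A by simp
      also have "\<dots> = (B * b / c) * (1 / (1 + t\<^sup>2))" using n by simp
      finally have F: "cmod (char \<mu> \<tau> ^ n) \<le> (B * b / c) * (1 / (1 + t\<^sup>2))" .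
      have G: "exp (- t\<^sup>2 / 2) \<le> 2 * (1 / (1 + t\<^sup>2))"
        using exp_ge_add_one_self[of "t\<^sup>2 / 2"] t1 by (simp add: exp_minus field_simps)
      have "cmod (char \<mu> \<tau> ^ n - exp (- t\<^sup>2 / 2)) \<le> cmod (char \<mu> \<tau> ^ n) + exp (- t\<^sup>2 / 2)"
        using norm_triangle_ineq4[of "char \<mu> \<tau> ^ n" "complex_of_real (exp (- t\<^sup>2 / 2))"] unfolding norm_of_real by simp
      also have "\<dots> \<le> (2 + B * b / c) * (1 / (1 + t\<^sup>2))"
        unfolding distrib_right using F G by linarith
      \<comment> \<open>In this region \<open>|t| / (\<delta> * sqrt n)\<close> exceeds 1, so
        multiplying by it produces both the rate \<open>1 / sqrt n\<close> and the numerator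
        \<open>|t|\<close>.\<close>
      also have "\<dots> \<le> (2 + B * b / c) * (1 / (1 + t\<^sup>2)) * (\<bar>t\<bar> / (\<delta> * sqrt (real n)))"
      proof -
        have "1 \<le> \<bar>t\<bar> / (\<delta> * sqrt (real n))" using False d q by (simp add: field_simps)
        moreover have "0 \<le> (2 + B * b / c) * (1 / (1 + t\<^sup>2))" using b c B t1 by simp
        ultimately show ?thesis using mult_left_mono by fastforce
      qed
      also have "\<dots> = (2 + B * b / c) / \<delta> * (1 / sqrt (real n) * (\<bar>t\<bar> / (1 + t\<^sup>2)))" by simp
      also have "\<dots> \<le> C * (1 / sqrt (real n) * (\<bar>t\<bar> / (1 + t\<^sup>2)))"
        by (intro mult_right_mono) (auto simp: C_def add_nonneg_nonneg)
      finally show ?thesis by (simp add: \<tau>_def)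
    qed
  qed
qed

text \<open>Only the characteristic function of \<open>\<nu>\<close> is prescribed, so its
  application to the block sum needs nothing beyond the factorization of one integral. The constant
  is uniform in \<open>n\<close> and \<open>y\<close>.\<close>

theorem berry_esseen_of_char_decay:
  assumes dec: "\<And>t. cmod (char \<mu> t) \<le> (1 + 4 * t\<^sup>2) powr (- (1 / 4))"
  obtains C where "C \<ge> 0" "\<And>n \<nu> y. n \<ge> 4 \<Longrightarrow> real_distribution \<nu> \<Longrightarrow>
      (\<And>t. char \<nu> t = char \<mu> (t / (s * sqrt (real n))) ^ n) \<Longrightarrow>
      \<bar>measure \<nu> {y<..} - Qfun y\<bar> \<le> C / sqrt (real n)"
proof -
  obtain C where C: "C \<ge> 0" "\<And>n t. n \<ge> 4 \<Longrightarrow>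
      cmod (char \<mu> (t / (s * sqrt (real n))) ^ n - exp (- t\<^sup>2 / 2)) \<le> C / sqrt (real n) * (\<bar>t\<bar> / (1 + t\<^sup>2))"
    using char_power_diff_gaussian[OF dec] by blast
  show thesis
  proof (rule that[OF C(1)])
    fix n :: nat and \<nu> y assume n: "n \<ge> 4" and nu: "real_distribution \<nu>"
      and ch: "\<And>t. char \<nu> t = char \<mu> (t / (s * sqrt (real n))) ^ n"
    have tail: "measure M {y<..} = 1 - cdf M y" if "real_distribution M" for M
    proof -
      interpret real_distribution M by (rule that)
      have "{y<..} = space M - {..y}" by auto
      then show ?thesis using prob_compl[of "{..y}"] by (simp add: cdf_def)
    qed
    have "\<bar>cdf \<nu> y - cdf std_normal_distribution y\<bar> \<le> C / sqrt (real n)"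
      by (rule cdf_diff_le_of_char[OF nu real_dist_normal_dist])
        (use C(2)[OF n] in \<open>simp add: ch char_std_normal_distribution\<close>)
    then show "\<bar>measure \<nu> {y<..} - Qfun y\<bar> \<le> C / sqrt (real n)"
      unfolding Qfun_def tail[OF nu] tail[OF real_dist_normal_dist] by simp
  qed
qed

end

section \<open>Blocks of independent letters\<close>

lemma product_integral:
  fixes f :: "'a \<Rightarrow> 'c::{real_normed_field, banach, second_countable_topology}" and g :: "'b \<Rightarrow> 'c"
  assumes "sigma_finite_measure M" "sigma_finite_measure N" "integrable M f" "integrable N g"
  shows "integrable (M \<Otimes>\<^sub>M N) (\<lambda>w. f (fst w) * g (snd w))"
    and "(\<integral>w. f (fst w) * g (snd w) \<partial>(M \<Otimes>\<^sub>M N)) = (\<integral>x. f x \<partial>M) * (\<integral>y. g y \<partial>N)"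
proof -
  interpret M: sigma_finite_measure M by fact
  interpret N: sigma_finite_measure N by fact
  interpret P: pair_sigma_finite M N ..
  note [measurable] = borel_measurable_integrable[OF assms(3)] borel_measurable_integrable[OF assms(4)]
  show int: "integrable (M \<Otimes>\<^sub>M N) (\<lambda>w. f (fst w) * g (snd w))"
  proof (rule P.Fubini_integrable)
    show "integrable M (\<lambda>x. \<integral>y. norm (f (fst (x, y)) * g (snd (x, y))) \<partial>N)"
      using assms(3,4) by (simp add: norm_mult)
    show "AE x in M. integrable N (\<lambda>y. f (fst (x, y)) * g (snd (x, y)))"
      using assms(4) by simp
  qed measurable
  show "(\<integral>w. f (fst w) * g (snd w) \<partial>(M \<Otimes>\<^sub>M N)) = (\<integral>x. f x \<partial>M) * (\<integral>y. g y \<partial>N)"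
    using P.integral_fst'[OF int] by simp
qed

abbreviation normalM :: "real \<Rightarrow> real measure" where
  "normalM v \<equiv> density lborel (\<lambda>x. ennreal (normal_density 0 (sqrt v) x))"

lemma prob_space_normalM: "v > 0 \<Longrightarrow> prob_space (normalM v)"
  by (rule prob_space_normal_density) simp

lemma prob_space_noiseM: "v > 0 \<Longrightarrow> prob_space (noiseM n v)"
  unfolding noiseM_def by (intro prob_space_PiM prob_space_normalM)

lemma sets_noiseM [measurable_cong]: "sets (noiseM n v) = sets (PiM {..<n} (\<lambda>_. borel))"
  unfolding noiseM_def by (intro sets_PiM_cong) simp_all

text \<open>The law of \<open>Z\<^sup>2 / v\<close> is free of \<open>v\<close>. This makes the tail
  constants below uniform in the noise variance, which matters because the variance varies with the
  code.\<close>

lemma integral_normalM_scale: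
  fixes g :: "real \<Rightarrow> complex"
  assumes v: "v > 0" and [measurable]: "g \<in> borel_measurable borel"
  shows "(\<integral>z. g (z\<^sup>2 / v) \<partial>normalM v) = (\<integral>z. g (z\<^sup>2) \<partial>normalM 1)"
proof -
  have "(\<integral>z. g (z\<^sup>2 / v) \<partial>normalM v) = (\<integral>z. normal_density 0 (sqrt v) z *\<^sub>R g (z\<^sup>2 / v) \<partial>lborel)"
    by (subst integral_density) auto
  also have "\<dots> = \<bar>sqrt v\<bar> *\<^sub>R (\<integral>z. normal_density 0 (sqrt v) (0 + sqrt v * z) *\<^sub>R g ((0 + sqrt v * z)\<^sup>2 / v) \<partial>lborel)"
    by (rule lborel_integral_real_affine) (use v in auto)
  also have "\<dots> = (\<integral>z. sqrt v *\<^sub>R (normal_density 0 (sqrt v) (0 + sqrt v * z) *\<^sub>R g ((0 + sqrt v * z)\<^sup>2 / v)) \<partial>lborel)"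
    using v by (simp add: scaleR_conv_of_real)
  also have "\<dots> = (\<integral>z. std_normal_density z *\<^sub>R g (z\<^sup>2) \<partial>lborel)"
  proof (rule Bochner_Integration.integral_cong[OF refl])
    fix z :: real
    have "sqrt v * normal_density 0 (sqrt v) (0 + sqrt v * z) = std_normal_density z"
      using v by (simp add: normal_density_def real_sqrt_mult power_mult_distrib field_simps)
    then show "sqrt v *\<^sub>R (normal_density 0 (sqrt v) (0 + sqrt v * z) *\<^sub>R g ((0 + sqrt v * z)\<^sup>2 / v)) = std_normal_density z *\<^sub>R g (z\<^sup>2)"
      using v by (simp add: power_mult_distrib)
  qed
  also have "\<dots> = (\<integral>z. g (z\<^sup>2) \<partial>normalM 1)"
    by (subst integral_density) auto
  finally show ?thesis .
qed

lemma normalM_moments: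
  shows "integrable (normalM 1) (\<lambda>z. z ^ k)"
    and "(\<integral>z. z\<^sup>2 \<partial>normalM 1) = 1" "(\<integral>z. z ^ 4 \<partial>normalM 1) = 3"
proof -
  show "integrable (normalM 1) (\<lambda>z. z ^ k)"
    using integrable_std_normal_moment[of k] by (subst integrable_density) auto
  show "(\<integral>z. z\<^sup>2 \<partial>normalM 1) = 1"
    using integral_std_normal_moment_even[of 1] by (subst integral_density) auto
  show "(\<integral>z. z ^ 4 \<partial>normalM 1) = 3"
    using integral_std_normal_moment_even[of 2] by (subst integral_density) (auto simp: fact_numeral)
qed

lemma abs_diff_cube_le:
  fixes a b :: real
  shows "\<bar>a - b\<bar> ^ 3 \<le> 4 * (\<bar>a\<bar> ^ 3 + \<bar>b\<bar> ^ 3)"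
proof -
  have "\<bar>a - b\<bar> ^ 3 \<le> (\<bar>a\<bar> + \<bar>b\<bar>) ^ 3" by (intro power_mono) auto
  also have "\<dots> \<le> 4 * (\<bar>a\<bar> ^ 3 + \<bar>b\<bar> ^ 3)"
  proof -
    have "4 * (\<bar>a\<bar> ^ 3 + \<bar>b\<bar> ^ 3) - (\<bar>a\<bar> + \<bar>b\<bar>) ^ 3 = 3 * (\<bar>a\<bar> + \<bar>b\<bar>) * (\<bar>a\<bar> - \<bar>b\<bar>)\<^sup>2"
      by (simp only: power3_eq_cube power2_eq_square) (simp only: algebra_simps)
    also have "\<dots> \<ge> 0" by simp
    finally show ?thesis by simp
  qed
  finally show ?thesis .
qed

context
  fixes M :: "'a measure" and X :: "'a \<Rightarrow> real" and V s :: real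
  assumes M: "prob_space M" and X[measurable]: "X \<in> borel_measurable M"
    and X3: "integrable M (\<lambda>x. \<bar>X x\<bar> ^ 3)" and X1: "(\<integral>x. X x \<partial>M) = 0"
  defines "V \<equiv> \<integral>x. (X x)\<^sup>2 \<partial>M" and "s \<equiv> sqrt (2 + V)"
begin

text \<open>\<open>X\<close> stays abstract because the letter is used twice: with the centred log
  fading for the main term, and with \<open>X = 0\<close> to control the noise norm alone when the
  logarithm is linearized.\<close>

definition letter :: "real measure" where
  "letter = distr (M \<Otimes>\<^sub>M normalM 1) borel (\<lambda>w. (snd w)\<^sup>2 - 1 - X (fst w))"

lemma s_pos: "s > 0" "s\<^sup>2 = 2 + V"
proof -
  have "V \<ge> 0" unfolding V_def by (intro Bochner_Integration.integral_nonneg) auto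
  then show "s > 0" "s\<^sup>2 = 2 + V" unfolding s_def by auto
qed

lemma letter_moments:
  shows "real_distribution letter" "integrable letter (\<lambda>x. \<bar>x\<bar> ^ 3)"
    "(\<integral>x. x \<partial>letter) = 0" "(\<integral>x. x\<^sup>2 \<partial>letter) = s\<^sup>2"
proof -
  interpret M: prob_space M by fact
  interpret N: prob_space "normalM 1" by (rule prob_space_normalM) simp
  interpret P: pair_prob_space M "normalM 1" ..
  note sf = M.sigma_finite_measure_axioms N.sigma_finite_measure_axioms
  have [measurable]: "(\<lambda>w. (snd w)\<^sup>2 - 1 - X (fst w)) \<in> borel_measurable (M \<Otimes>\<^sub>M normalM 1)" by measurable
  note iX = integrable_moments_of_third[OF M X X3]
  have fsti: "integrable (M \<Otimes>\<^sub>M normalM 1) (\<lambda>w. h (fst w))"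
       "(\<integral>w. h (fst w) \<partial>(M \<Otimes>\<^sub>M normalM 1)) = (\<integral>x. h x \<partial>M)" if "integrable M h" for h :: "'a \<Rightarrow> real"
    using product_integral[OF sf that N.integrable_const, of 1] N.prob_space by simp_all
  have sndi: "integrable (M \<Otimes>\<^sub>M normalM 1) (\<lambda>w. h (snd w))"
       "(\<integral>w. h (snd w) \<partial>(M \<Otimes>\<^sub>M normalM 1)) = (\<integral>x. h x \<partial>normalM 1)" if "integrable (normalM 1) h" for h :: "real \<Rightarrow> real"
    using product_integral[OF sf M.integrable_const that, of 1] M.prob_space by simp_all
  show "real_distribution letter" unfolding letter_def by (rule P.real_distribution_distr) measurable
  have "integrable (M \<Otimes>\<^sub>M normalM 1) (\<lambda>w. \<bar>(snd w)\<^sup>2 - 1 - X (fst w)\<bar> ^ 3)"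
  proof (rule Bochner_Integration.integrable_bound)
    show "integrable (M \<Otimes>\<^sub>M normalM 1) (\<lambda>w. 4 * (4 * ((snd w) ^ 6 + 1) + \<bar>X (fst w)\<bar> ^ 3))"
      by (intro integrable_mult_right Bochner_Integration.integrable_add P.integrable_const
          sndi(1)[OF normalM_moments(1)[of 6]] fsti(1)[OF X3])
    show "AE w in M \<Otimes>\<^sub>M normalM 1. norm (\<bar>(snd w)\<^sup>2 - 1 - X (fst w)\<bar> ^ 3) \<le> norm (4 * (4 * ((snd w) ^ 6 + 1) + \<bar>X (fst w)\<bar> ^ 3))"
    proof (rule AE_I2)
      fix w :: "'a \<times> real"
      have "\<bar>(snd w)\<^sup>2 - 1 - X (fst w)\<bar> ^ 3 \<le> 4 * (\<bar>(snd w)\<^sup>2 - 1\<bar> ^ 3 + \<bar>X (fst w)\<bar> ^ 3)" by (rule abs_diff_cube_le)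
      moreover have "\<bar>(snd w)\<^sup>2 - 1\<bar> ^ 3 \<le> 4 * ((snd w) ^ 6 + 1)"
        using abs_diff_cube_le[of "(snd w)\<^sup>2" 1] by (simp add: power_mult[symmetric])
      ultimately show "norm (\<bar>(snd w)\<^sup>2 - 1 - X (fst w)\<bar> ^ 3) \<le> norm (4 * (4 * ((snd w) ^ 6 + 1) + \<bar>X (fst w)\<bar> ^ 3))"
        by simp
    qed
  qed measurable
  then show "integrable letter (\<lambda>x. \<bar>x\<bar> ^ 3)"
    unfolding letter_def by (subst integrable_distr_eq) auto
  have one: "integrable (normalM 1) (\<lambda>_. c)" for c :: real by (rule N.integrable_const)
  have z2: "integrable (normalM 1) (\<lambda>z. z\<^sup>2 - 1)" "(\<integral>z. z\<^sup>2 - 1 \<partial>normalM 1) = 0"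
    using normalM_moments N.prob_space one by simp_all
  have z4: "integrable (normalM 1) (\<lambda>z. (z\<^sup>2 - 1)\<^sup>2)" "(\<integral>z. (z\<^sup>2 - 1)\<^sup>2 \<partial>normalM 1) = 2"
  proof -
    have *: "(\<lambda>z::real. (z\<^sup>2 - 1)\<^sup>2) = (\<lambda>z. z ^ 4 - 2 * z\<^sup>2 + 1)" by (auto simp: power2_eq_square eval_nat_numeral algebra_simps)
    show "integrable (normalM 1) (\<lambda>z. (z\<^sup>2 - 1)\<^sup>2)" "(\<integral>z. (z\<^sup>2 - 1)\<^sup>2 \<partial>normalM 1) = 2"
      unfolding * using normalM_moments N.prob_space one by simp_all
  qed
  show "(\<integral>x. x \<partial>letter) = 0"
    unfolding letter_def using sndi[OF z2(1)] fsti[OF iX(1)] z2 X1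
    by (subst integral_distr) auto
  note c = product_integral[OF sf iX(1) z2(1)]
  have e: "(\<lambda>w. ((snd w)\<^sup>2 - 1 - X (fst w))\<^sup>2) = (\<lambda>w::'a\<times>real. ((snd w)\<^sup>2 - 1)\<^sup>2 - 2 * (X (fst w) * ((snd w)\<^sup>2 - 1)) + (X (fst w))\<^sup>2)"
    by (auto simp: power2_diff)
  have "(\<integral>w. ((snd w)\<^sup>2 - 1 - X (fst w))\<^sup>2 \<partial>(M \<Otimes>\<^sub>M normalM 1)) = 2 + V"
    unfolding e using sndi[OF z4(1)] fsti[OF iX(2)] c z4(2) X1
    by (simp add: V_def)
  then show "(\<integral>x. x\<^sup>2 \<partial>letter) = s\<^sup>2"
    unfolding letter_def s_pos by (subst integral_distr) auto
qed

lemma char_letter: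
  "char letter t = (CLINT h|M. iexp (- (t * X h))) * (CLINT z|normalM 1. iexp (t * (z\<^sup>2 - 1)))"
proof -
  interpret M: prob_space M by fact
  interpret N: prob_space "normalM 1" by (rule prob_space_normalM) simp
  interpret P: pair_prob_space M "normalM 1" ..
  note sf = M.sigma_finite_measure_axioms N.sigma_finite_measure_axioms
  have "integrable M (\<lambda>h. iexp (- (t * X h)))"
    by (rule M.integrable_const_bound[of _ 1]) auto
  moreover have "integrable (normalM 1) (\<lambda>z. iexp (t * (z\<^sup>2 - 1)))"
    by (rule N.integrable_const_bound[of _ 1]) (auto simp del: of_real_diff of_real_mult)
  ultimately have "(CLINT h|M. iexp (- (t * X h))) * (CLINT z|normalM 1. iexp (t * (z\<^sup>2 - 1)))
     = (CLINT w|M \<Otimes>\<^sub>M normalM 1. iexp (- (t * X (fst w))) * iexp (t * ((snd w)\<^sup>2 - 1)))"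
    by (rule product_integral(2)[OF sf, symmetric])
  also have "\<dots> = (CLINT w|M \<Otimes>\<^sub>M normalM 1. iexp (t * ((snd w)\<^sup>2 - 1 - X (fst w))))"
    by (intro Bochner_Integration.integral_cong refl) (simp add: exp_add[symmetric] algebra_simps)
  also have "\<dots> = char letter t"
    unfolding char_def letter_def by (subst integral_distr) measurable
  finally show ?thesis ..
qed

text \<open>The fading factor has modulus at most 1, so the noise factor supplies all of the decay;
  the phase that comes from centring \<open>Z\<^sup>2\<close> has modulus 1.\<close>

lemma norm_char_letter: "cmod (char letter t) \<le> (1 + 4 * t\<^sup>2) powr (- (1 / 4))"
proof -
  interpret M: prob_space M by fact
  have 1: "cmod (CLINT h|M. iexp (- (t * X h))) \<le> 1"
    using integral_norm_bound[of M "\<lambda>h. iexp (- (t * X h))"] M.prob_space by simp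
  have "(CLINT z|normalM 1. iexp (t * (z\<^sup>2 - 1))) = (CLINT z|normalM 1. iexp (- t) * iexp (t * z\<^sup>2))"
    by (intro Bochner_Integration.integral_cong refl) (simp only: exp_add[symmetric], simp add: algebra_simps)
  also have "\<dots> = iexp (- t) * (CLINT z|normalM 1. iexp (t * z\<^sup>2))"
    by (rule integral_mult_right_zero)
  finally have E: "(CLINT z|normalM 1. iexp (t * (z\<^sup>2 - 1))) = iexp (- t) * (CLINT z|normalM 1. iexp (t * z\<^sup>2))" .
  have "cmod (CLINT z|normalM 1. iexp (t * (z\<^sup>2 - 1))) = (1 + 4 * t\<^sup>2) powr (- (1 / 4))"
    unfolding E norm_mult norm_exp_i_times using norm_char_normal_square[of t] by simp
  then show ?thesis unfolding char_letter norm_mult using mult_right_mono[OF 1] by fastforce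
qed

text \<open>The exponential of the sum is a product over letters, so the integral over the product
  space splits into \<open>n\<close> equal fading factors and \<open>n\<close> equal noise
  factors.\<close>

lemma char_block_sum:
  assumes v: "v > 0" and n: "n > 0"
  shows "char (distr (PiM {..<n} (\<lambda>_. M) \<Otimes>\<^sub>M noiseM n v) borel
      (\<lambda>w. (\<Sum>i<n. (snd w i)\<^sup>2 / v - 1 - X (fst w i)) / c)) t = char letter (t / c) ^ n"
proof -
  interpret M: prob_space M by fact
  interpret N: prob_space "normalM v" by (rule prob_space_normalM) fact
  interpret PM: product_sigma_finite "\<lambda>_::nat. M" ..
  interpret PN: product_sigma_finite "\<lambda>_::nat. normalM v" ..
  interpret A: prob_space "PiM {..<n} (\<lambda>_. M)" by (intro prob_space_PiM M)
  interpret B: prob_space "noiseM n v" by (rule prob_space_noiseM) fact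
  note sf = A.sigma_finite_measure_axioms B.sigma_finite_measure_axioms
  define u where "u = t / c"
  have iM: "integrable M (\<lambda>h. iexp (- (u * X h)))"
    by (rule M.integrable_const_bound[of _ 1]) auto
  have iN: "integrable (normalM v) (\<lambda>z. iexp (u * (z\<^sup>2 / v - 1)))"
    by (rule N.integrable_const_bound[of _ 1]) (auto simp del: of_real_diff of_real_mult)
  have [measurable]: "(\<lambda>w. (\<Sum>i<n. (snd w i)\<^sup>2 / v - 1 - X (fst w i)) / c) \<in> borel_measurable (PiM {..<n} (\<lambda>_. M) \<Otimes>\<^sub>M noiseM n v)"
    unfolding noiseM_def by measurable
  have "char (distr (PiM {..<n} (\<lambda>_. M) \<Otimes>\<^sub>M noiseM n v) borel
      (\<lambda>w. (\<Sum>i<n. (snd w i)\<^sup>2 / v - 1 - X (fst w i)) / c)) t =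
     (CLINT w|PiM {..<n} (\<lambda>_. M) \<Otimes>\<^sub>M noiseM n v. iexp (t * ((\<Sum>i<n. (snd w i)\<^sup>2 / v - 1 - X (fst w i)) / c)))"
    unfolding char_def by (subst integral_distr) auto
  also have "\<dots> = (CLINT w|PiM {..<n} (\<lambda>_. M) \<Otimes>\<^sub>M noiseM n v.
      (\<Prod>i<n. iexp (- (u * X (fst w i)))) * (\<Prod>i<n. iexp (u * ((snd w i)\<^sup>2 / v - 1))))"
  proof (rule Bochner_Integration.integral_cong[OF refl])
    fix w :: "(nat \<Rightarrow> 'a) \<times> (nat \<Rightarrow> real)"
    have "t * ((\<Sum>i<n. (snd w i)\<^sup>2 / v - 1 - X (fst w i)) / c) = (\<Sum>i<n. u * ((snd w i)\<^sup>2 / v - 1 - X (fst w i)))"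
      by (simp add: u_def sum_distrib_left sum_divide_distrib)
    also have "\<i> * complex_of_real \<dots> = (\<Sum>i<n. \<i> * complex_of_real (- (u * X (fst w i))) + \<i> * complex_of_real (u * ((snd w i)\<^sup>2 / v - 1)))"
      by (simp add: sum_distrib_left of_real_sum algebra_simps)
    also have "exp \<dots> = (\<Prod>i<n. iexp (- (u * X (fst w i))) * iexp (u * ((snd w i)\<^sup>2 / v - 1)))"
      by (simp only: exp_sum[OF finite_lessThan] exp_add)
    also have "\<dots> = (\<Prod>i<n. iexp (- (u * X (fst w i)))) * (\<Prod>i<n. iexp (u * ((snd w i)\<^sup>2 / v - 1)))"
      by (rule prod.distrib)
    finally show "iexp (t * ((\<Sum>i<n. (snd w i)\<^sup>2 / v - 1 - X (fst w i)) / c)) =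
       (\<Prod>i<n. iexp (- (u * X (fst w i)))) * (\<Prod>i<n. iexp (u * ((snd w i)\<^sup>2 / v - 1)))" .
  qed
  also have "\<dots> = (CLINT h|PiM {..<n} (\<lambda>_. M). (\<Prod>i<n. iexp (- (u * X (h i))))) * (CLINT z|noiseM n v. (\<Prod>i<n. iexp (u * ((z i)\<^sup>2 / v - 1))))"
  proof (rule product_integral(2)[OF sf])
    show "integrable (PiM {..<n} (\<lambda>_. M)) (\<lambda>h. \<Prod>i<n. iexp (- (u * X (h i))))"
      by (rule PM.product_integrable_prod[OF finite_lessThan iM])
    show "integrable (noiseM n v) (\<lambda>z. \<Prod>i<n. iexp (u * ((z i)\<^sup>2 / v - 1)))"
      unfolding noiseM_def by (rule PN.product_integrable_prod[OF finite_lessThan iN])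
  qed
  also have "(CLINT h|PiM {..<n} (\<lambda>_. M). (\<Prod>i<n. iexp (- (u * X (h i))))) = (CLINT h|M. iexp (- (u * X h))) ^ n"
    using PM.product_integral_prod[of "{..<n}" "\<lambda>_ h. iexp (- (u * X h))"] iM by simp
  also have "(CLINT z|noiseM n v. (\<Prod>i<n. iexp (u * ((z i)\<^sup>2 / v - 1)))) = (CLINT z|normalM v. iexp (u * (z\<^sup>2 / v - 1))) ^ n"
    unfolding noiseM_def using PN.product_integral_prod[of "{..<n}" "\<lambda>_ z. iexp (u * (z\<^sup>2 / v - 1))"] iN by simp
  also have "(CLINT z|normalM v. iexp (u * (z\<^sup>2 / v - 1))) = (CLINT z|normalM 1. iexp (u * (z\<^sup>2 - 1)))"
    by (rule integral_normalM_scale[OF v, of "\<lambda>y. iexp (u * (y - 1))"]) measurable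
  finally show ?thesis unfolding char_letter u_def power_mult_distrib .
qed

lemma block_sum_tail:
  obtains C where "C \<ge> 0" "\<And>n v y. n \<ge> 4 \<Longrightarrow> v > 0 \<Longrightarrow>
    \<bar>measure (PiM {..<n} (\<lambda>_. M) \<Otimes>\<^sub>M noiseM n v)
      {w \<in> space (PiM {..<n} (\<lambda>_. M) \<Otimes>\<^sub>M noiseM n v).
        y * (s * sqrt (real n)) < (\<Sum>i<n. (snd w i)\<^sup>2 / v - 1 - X (fst w i))} - Qfun y\<bar> \<le> C / sqrt (real n)"
proof -
  obtain C where C: "C \<ge> 0" "\<And>n \<nu> y. n \<ge> 4 \<Longrightarrow> real_distribution \<nu> \<Longrightarrow>
      (\<And>t. char \<nu> t = char letter (t / (s * sqrt (real n))) ^ n) \<Longrightarrow>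
      \<bar>measure \<nu> {y<..} - Qfun y\<bar> \<le> C / sqrt (real n)"
    using berry_esseen_of_char_decay[OF letter_moments s_pos(1) norm_char_letter] by blast
  show thesis
  proof (rule that[OF C(1)])
    fix n :: nat and v y :: real assume n: "n \<ge> 4" and v: "v > 0"
    interpret A: prob_space "PiM {..<n} (\<lambda>_. M)" by (intro prob_space_PiM M)
    interpret B: prob_space "noiseM n v" by (rule prob_space_noiseM) fact
    interpret P: pair_prob_space "PiM {..<n} (\<lambda>_. M)" "noiseM n v" ..
    let ?S = "\<lambda>w. (\<Sum>i<n. (snd w i)\<^sup>2 / v - 1 - X (fst w i)) / (s * sqrt (real n))"
    have [measurable]: "?S \<in> borel_measurable (PiM {..<n} (\<lambda>_. M) \<Otimes>\<^sub>M noiseM n v)"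
      unfolding noiseM_def by measurable
    have c: "s * sqrt (real n) > 0" using n s_pos by simp
    have "\<bar>measure (distr (PiM {..<n} (\<lambda>_. M) \<Otimes>\<^sub>M noiseM n v) borel ?S) {y<..} - Qfun y\<bar> \<le> C / sqrt (real n)"
      by (rule C(2)[OF n]) (use n v in \<open>auto simp: char_block_sum\<close>)
    also have "measure (distr (PiM {..<n} (\<lambda>_. M) \<Otimes>\<^sub>M noiseM n v) borel ?S) {y<..} =
       measure (PiM {..<n} (\<lambda>_. M) \<Otimes>\<^sub>M noiseM n v)
      {w \<in> space (PiM {..<n} (\<lambda>_. M) \<Otimes>\<^sub>M noiseM n v).
        y * (s * sqrt (real n)) < (\<Sum>i<n. (snd w i)\<^sup>2 / v - 1 - X (fst w i))}"
      using c by (subst measure_distr) (auto intro!: arg_cong2[where f=measure] simp: less_divide_eq)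
    finally show "\<bar>measure (PiM {..<n} (\<lambda>_. M) \<Otimes>\<^sub>M noiseM n v)
      {w \<in> space (PiM {..<n} (\<lambda>_. M) \<Otimes>\<^sub>M noiseM n v).
        y * (s * sqrt (real n)) < (\<Sum>i<n. (snd w i)\<^sup>2 / v - 1 - X (fst w i))} - Qfun y\<bar> \<le> C / sqrt (real n)" .
  qed
qed

end

section \<open>Moments of the logarithm of the fading\<close>

context
  fixes f :: "real \<Rightarrow> real"
  assumes f: "regular_fading f"
begin

lemma fading_density:
  "f \<in> borel_measurable borel" "0 \<le> f h" "h < 0 \<Longrightarrow> f h = 0"
  using f by (auto simp: regular_fading_def)

lemma sets_fadingM [measurable_cong, simp]: "sets (fadingM f) = sets borel"
  by (simp add: fadingM_def)

lemma space_fadingM [simp]: "space (fadingM f) = UNIV"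
  by (simp add: fadingM_def)

lemma prob_space_fadingM: "prob_space (fadingM f)"
proof
  note [measurable] = fading_density(1)
  have "(\<integral>\<^sup>+ h. ennreal (f h) \<partial>lborel) = 1" using f by (simp add: regular_fading_def)
  then show "emeasure (fadingM f) (space (fadingM f)) = 1"
    by (simp add: fadingM_def emeasure_density)
qed

lemma AE_fadingM_pos: "AE h in fadingM f. 0 < h"
proof -
  note [measurable] = fading_density(1)
  have "AE h in lborel. h \<noteq> (0::real)" by (rule AE_lborel_singleton)
  then have "AE h in lborel. 0 < f h \<longrightarrow> 0 < h"
  proof eventually_elim
    case (elim h)
    then show ?case using fading_density(3)[of h] by (cases "h < 0") auto
  qed
  then show ?thesis
    unfolding fadingM_def by (subst AE_density) auto
qed

text \<open>At infinity the cubed logarithm is dominated by \<open>h\<^sup>2\<close>, which is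
  integrable by the unit second moment. Near 0 it is dominated by
  \<open>h powr (- \<alpha> / 2)\<close>, and against a density
  \<open>c * h powr (\<alpha> - 1)\<close> this still leaves an integrable power.\<close>

lemma integrable_ln_cube: "integrable (fadingM f) (\<lambda>h. \<bar>ln (h\<^sup>2)\<bar> ^ 3)"
proof -
  note [measurable] = fading_density(1)
  obtain \<alpha> c h0 where a: "\<alpha> > 0" "c > 0" "h0 > 0" and small: "\<And>h. 0 < h \<Longrightarrow> h < h0 \<Longrightarrow> f h = c * h powr (\<alpha> - 1)"
    using f unfolding regular_fading_def by blast
  have i2: "integrable (fadingM f) (\<lambda>h. h\<^sup>2)" using f by (simp add: regular_fading_def)
  have im: "integrable (fadingM f) (\<lambda>h. h powr (- \<alpha> / 2))"
  proof (rule integrableI_bounded)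
    have hi: "((\<lambda>x. x powr (\<alpha> / 2 - 1)) has_integral (h0 powr (\<alpha> / 2 - 1 + 1) / (\<alpha> / 2 - 1 + 1))) {0..h0}"
      using a by (intro has_integral_powr_from_0) auto
    have "(\<integral>\<^sup>+ h. ennreal (norm (h powr (- \<alpha> / 2))) \<partial>fadingM f) = (\<integral>\<^sup>+ h. ennreal (f h) * ennreal (h powr (- \<alpha> / 2)) \<partial>lborel)"
      unfolding fadingM_def by (subst nn_integral_density) auto
    also have "\<dots> \<le> (\<integral>\<^sup>+ h. ennreal c * (ennreal (h powr (\<alpha> / 2 - 1)) * indicator {0..h0} h) + ennreal (h0 powr (- \<alpha> / 2)) * ennreal (f h) \<partial>lborel)"
    proof (intro nn_integral_mono)
      fix h :: real
      consider "h \<le> 0" | "0 < h" "h < h0" | "h \<ge> h0" by linarith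
      then show "ennreal (f h) * ennreal (h powr (- \<alpha> / 2)) \<le> ennreal c * (ennreal (h powr (\<alpha> / 2 - 1)) * indicator {0..h0} h) + ennreal (h0 powr (- \<alpha> / 2)) * ennreal (f h)"
      proof cases
        case 1
        \<comment> \<open>At \<open>h = 0\<close> the density may be nonzero, but
          \<open>0 powr x\<close> is 0.\<close>
        then have "f h = 0 \<or> h = 0" using fading_density(3)[of h] by force
        then show ?thesis by auto
      next
        case 2
        have "f h * h powr (- \<alpha> / 2) = c * h powr (\<alpha> / 2 - 1)"
          using 2 by (simp add: small powr_add[symmetric] field_simps)
        then show ?thesis using 2 a fading_density(2)[of h]
          by (simp add: ennreal_mult'[symmetric] add_increasing2 ennreal_mult[symmetric])
      next
        case 3
        have "h powr (- \<alpha> / 2) \<le> h0 powr (- \<alpha> / 2)" using 3 a by (intro powr_mono2') auto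
        then show ?thesis using fading_density(2)[of h]
          by (intro add_increasing) (auto simp: mult.commute intro!: mult_left_mono ennreal_leI)
      qed
    qed
    also have "\<dots> = ennreal c * (\<integral>\<^sup>+ h. ennreal (h powr (\<alpha> / 2 - 1)) * indicator {0..h0} h \<partial>lborel) + ennreal (h0 powr (- \<alpha> / 2)) * (\<integral>\<^sup>+ h. ennreal (f h) \<partial>lborel)"
      by (subst nn_integral_add) (auto simp: nn_integral_cmult)
    also have "(\<integral>\<^sup>+ h. ennreal (h powr (\<alpha> / 2 - 1)) * indicator {0..h0} h \<partial>lborel) = (\<integral>\<^sup>+ h. ennreal (indicator {0..h0} h * h powr (\<alpha> / 2 - 1)) \<partial>lborel)"
      by (intro nn_integral_cong) (auto simp: indicator_def)
    also have "\<dots> = ennreal (h0 powr (\<alpha> / 2 - 1 + 1) / (\<alpha> / 2 - 1 + 1))"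
      using nn_integral_has_integral_lebesgue[OF _ hi] by simp
    also have "(\<integral>\<^sup>+ h. ennreal (f h) \<partial>lborel) = 1" using f by (simp add: regular_fading_def)
    finally show "(\<integral>\<^sup>+ h. ennreal (norm (h powr (- \<alpha> / 2))) \<partial>fadingM f) < \<infinity>"
      by (rule order.strict_trans1) (simp add: ennreal_mult_less_top ennreal_add_less_top)
  qed measurable
  \<comment> \<open>\<open>\<beta> = \<alpha> / 6\<close> because the cube of
    \<open>h powr (- \<beta>)\<close> has to be \<open>h powr (- \<alpha> / 2)\<close>. For
    \<open>h \<ge> 1\<close> the exponent \<open>2 / 3\<close> has the same origin: its cube is
    \<open>h\<^sup>2\<close>.\<close>
  define \<beta> where "\<beta> = \<alpha> / 6"
  have b: "\<beta> > 0" using a by (simp add: \<beta>_def)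
  have bnd: "\<bar>ln (h\<^sup>2)\<bar> ^ 3 \<le> 27 * h\<^sup>2 + 8 / \<beta> ^ 3 * h powr (- \<alpha> / 2)" if "h > 0" for h
  proof -
    have e: "\<bar>ln (h\<^sup>2)\<bar> ^ 3 = 8 * \<bar>ln h\<bar> ^ 3" using that by (simp add: ln_realpow abs_mult power_mult_distrib)
    show ?thesis
    proof (cases "h \<ge> 1")
      case True
      have "\<bar>ln h\<bar> \<le> h powr (2 / 3) / (2 / 3)" using ln_powr_bound[OF True, of "2/3"] True by simp
      then have "\<bar>ln h\<bar> ^ 3 \<le> (h powr (2 / 3) / (2 / 3)) ^ 3" by (intro power_mono) auto
      also have "\<dots> = 27 / 8 * h\<^sup>2"
        using that by (simp add: power_divide powr_power )
      finally show ?thesis unfolding e using b by (simp add: add_increasing2)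
    next
      case False
      have "\<bar>ln h\<bar> = ln (1 / h)" using that False by (simp add: ln_div)
      also have "\<dots> \<le> (1 / h) powr \<beta> / \<beta>" using that False b by (intro ln_powr_bound) auto
      finally have "\<bar>ln h\<bar> ^ 3 \<le> ((1 / h) powr \<beta> / \<beta>) ^ 3" by (intro power_mono) auto
      also have "\<dots> = h powr (- \<alpha> / 2) / \<beta> ^ 3"
        using that by (simp add: power_divide power_mult_distrib powr_power powr_divide powr_minus_divide \<beta>_def)
      finally show ?thesis unfolding e by (simp add: add_increasing)
    qed
  qed
  show ?thesis
  proof (rule Bochner_Integration.integrable_bound)
    show "integrable (fadingM f) (\<lambda>h. 27 * h\<^sup>2 + 8 / \<beta> ^ 3 * h powr (- \<alpha> / 2))"
      by (intro Bochner_Integration.integrable_add integrable_mult_right i2 im)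
    show "AE h in fadingM f. norm (\<bar>ln (h\<^sup>2)\<bar> ^ 3) \<le> norm (27 * h\<^sup>2 + 8 / \<beta> ^ 3 * h powr (- \<alpha> / 2))"
      using AE_fadingM_pos by eventually_elim (use bnd in force)
  qed measurable
qed

lemma ln_fading_moments:
  shows "(\<lambda>h. ln (h\<^sup>2) - E_lnH2 f) \<in> borel_measurable (fadingM f)"
    "integrable (fadingM f) (\<lambda>h. \<bar>ln (h\<^sup>2) - E_lnH2 f\<bar> ^ 3)"
    "(\<integral>h. ln (h\<^sup>2) - E_lnH2 f \<partial>fadingM f) = 0"
    "(\<integral>h. (ln (h\<^sup>2) - E_lnH2 f)\<^sup>2 \<partial>fadingM f) = Var_lnH2 f"
proof -
  interpret prob_space "fadingM f" by (rule prob_space_fadingM)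
  show [measurable]: "(\<lambda>h. ln (h\<^sup>2) - E_lnH2 f) \<in> borel_measurable (fadingM f)" by measurable
  have i1: "integrable (fadingM f) (\<lambda>h. ln (h\<^sup>2))"
    by (rule integrable_moments_of_third[OF prob_space_fadingM _ integrable_ln_cube]) measurable
  show "(\<integral>h. ln (h\<^sup>2) - E_lnH2 f \<partial>fadingM f) = 0"
    using i1 prob_space by (simp add: E_lnH2_def)
  show "(\<integral>h. (ln (h\<^sup>2) - E_lnH2 f)\<^sup>2 \<partial>fadingM f) = Var_lnH2 f"
    by (simp add: Var_lnH2_def)
  show "integrable (fadingM f) (\<lambda>h. \<bar>ln (h\<^sup>2) - E_lnH2 f\<bar> ^ 3)"
  proof (rule Bochner_Integration.integrable_bound)
    show "integrable (fadingM f) (\<lambda>h. 4 * (\<bar>ln (h\<^sup>2)\<bar> ^ 3 + \<bar>E_lnH2 f\<bar> ^ 3))"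
      using integrable_ln_cube by simp
    show "AE h in fadingM f. norm (\<bar>ln (h\<^sup>2) - E_lnH2 f\<bar> ^ 3) \<le> norm (4 * (\<bar>ln (h\<^sup>2)\<bar> ^ 3 + \<bar>E_lnH2 f\<bar> ^ 3))"
      using abs_diff_cube_le by (intro AE_I2) simp
  qed measurable
qed

end

section \<open>Tail of the normalized log ratio\<close>

text \<open>Change of measure: the standard density is at most \<open>exp (- m\<^sup>2 / 2)\<close>
  times the normal density centred at \<open>m\<close> wherever
  \<open>m\<^sup>2 \<le> m * x\<close>. The two tails are the cases \<open>m = u\<close> and
  \<open>m = - u\<close>.\<close>

lemma normal_tail_le:
  assumes u: "u \<ge> 0"
  shows "measure (normalM 1) {u<..} \<le> exp (- u\<^sup>2 / 2)" "measure (normalM 1) {..-u} \<le> exp (- u\<^sup>2 / 2)"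
proof -
  interpret N: prob_space "normalM 1" by (rule prob_space_normalM) simp
  have gen: "measure (normalM 1) A \<le> exp (- m\<^sup>2 / 2)"
    if A: "A \<in> sets borel" and le: "\<And>x. x \<in> A \<Longrightarrow> m\<^sup>2 \<le> m * x" for A and m :: real
  proof -
    have "emeasure (normalM 1) A = (\<integral>\<^sup>+x. ennreal (std_normal_density x) * indicator A x \<partial>lborel)"
      using A by (subst emeasure_density) auto
    also have "\<dots> \<le> (\<integral>\<^sup>+x. ennreal (exp (- m\<^sup>2 / 2)) * ennreal (normal_density m 1 x) \<partial>lborel)"
    proof (intro nn_integral_mono)
      fix x :: real
      have "std_normal_density x \<le> exp (- m\<^sup>2 / 2) * normal_density m 1 x" if "x \<in> A"
      proof -
        have "exp (- m\<^sup>2 / 2) * normal_density m 1 x = 1 / sqrt (2 * pi) * exp (- x\<^sup>2 / 2 + (m * x - m\<^sup>2))"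
          by (simp add: normal_density_def exp_add[symmetric] power2_diff field_simps)
        moreover have "exp (- x\<^sup>2 / 2) \<le> exp (- x\<^sup>2 / 2 + (m * x - m\<^sup>2))" using le[OF that] by simp
        ultimately show ?thesis by (simp add: normal_density_def divide_right_mono)
      qed
      then show "ennreal (std_normal_density x) * indicator A x \<le> ennreal (exp (- m\<^sup>2 / 2)) * ennreal (normal_density m 1 x)"
        by (auto simp: indicator_def ennreal_mult[symmetric] intro!: ennreal_leI)
    qed
    also have "\<dots> = ennreal (exp (- m\<^sup>2 / 2))"
      by (subst nn_integral_cmult) (auto simp: nn_integral_eq_integral)
    finally show ?thesis unfolding N.emeasure_eq_measure by (subst (asm) ennreal_le_iff) auto
  qed
  show "measure (normalM 1) {u<..} \<le> exp (- u\<^sup>2 / 2)"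
    using u by (intro gen) (auto simp: power2_eq_square intro!: mult_left_mono)
  have "measure (normalM 1) {..-u} \<le> exp (- (-u)\<^sup>2 / 2)"
  proof (rule gen)
    fix x assume "x \<in> {..-u}"
    then have "u * x \<le> u * (- u)" using u by (intro mult_left_mono) auto
    then show "(-u)\<^sup>2 \<le> - u * x" by (simp add: power2_eq_square)
  qed simp
  then show "measure (normalM 1) {..-u} \<le> exp (- u\<^sup>2 / 2)" by simp
qed

lemma Qfun_le:
  assumes "u \<ge> 0"
  shows "Qfun u \<le> exp (- u\<^sup>2 / 2)" "1 - exp (- u\<^sup>2 / 2) \<le> Qfun (- u)"
proof -
  interpret N: prob_space "normalM 1" by (rule prob_space_normalM) simp
  show "Qfun u \<le> exp (- u\<^sup>2 / 2)" using normal_tail_le(1)[OF assms] by (simp add: Qfun_def)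
  have "{- u<..} = space (normalM 1) - {..-u}" by auto
  then have "Qfun (- u) = 1 - measure (normalM 1) {..-u}"
    using N.prob_compl[of "{..-u}"] by (simp add: Qfun_def)
  then show "1 - exp (- u\<^sup>2 / 2) \<le> Qfun (- u)" using normal_tail_le(2)[OF assms] by simp
qed

definition channel :: "(real \<Rightarrow> real) \<Rightarrow> nat \<Rightarrow> real \<Rightarrow> ((nat \<Rightarrow> real) \<times> (nat \<Rightarrow> real)) measure" where
  "channel f n v = fadingVecM f n \<Otimes>\<^sub>M noiseM n v"

definition log_ratio :: "(real \<Rightarrow> real) \<Rightarrow> nat \<Rightarrow> real \<Rightarrow> (nat \<Rightarrow> real) \<times> (nat \<Rightarrow> real) \<Rightarrow> real" where
  "log_ratio f n v w = ln ((\<Sum>i<n. (snd w i)\<^sup>2) / (n * v)) - (\<Sum>i<n. ln ((fst w i)\<^sup>2) - E_lnH2 f) / n"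

text \<open>The positivity conjunct excludes the zero noise vector, where \<open>ln\<close> takes a
  default value and \<open>log_ratio\<close> has no meaning.\<close>

definition exceed :: "(real \<Rightarrow> real) \<Rightarrow> nat \<Rightarrow> real \<Rightarrow> real \<Rightarrow> ((nat \<Rightarrow> real) \<times> (nat \<Rightarrow> real)) set" where
  "exceed f n v y = {w \<in> space (channel f n v). 0 < (\<Sum>i<n. (snd w i)\<^sup>2) \<and> y < log_ratio f n v w}"

context
  fixes f :: "real \<Rightarrow> real"
  assumes f: "regular_fading f"
begin

lemma sets_fadingVecM [measurable_cong]: "sets (fadingVecM f n) = sets (PiM {..<n} (\<lambda>_. borel))"
  unfolding fadingVecM_def by (intro sets_PiM_cong) (simp_all add: f)

lemma prob_space_fadingVecM: "prob_space (fadingVecM f n)"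
  unfolding fadingVecM_def by (intro prob_space_PiM prob_space_fadingM f)

lemma prob_space_channel: "v > 0 \<Longrightarrow> prob_space (channel f n v)"
  unfolding channel_def by (intro prob_space_pair prob_space_fadingVecM prob_space_noiseM)

lemma measurable_exceed [measurable]: "exceed f n v y \<in> sets (channel f n v)"
  unfolding exceed_def log_ratio_def channel_def by measurable

text \<open>Linearizing the logarithm is asymmetric. \<open>ln x \<le> x - 1\<close> always holds,
  so the upper bound has no shift. For the lower bound the normalized noise must be close to 1,
  where the quadratic loss is at most \<open>4 * ln n / n\<close>; it fails to be close with
  probability O(1 / sqrt n).\<close>

lemma exceed_tail:
  fixes s
  defines "s \<equiv> sqrt (2 + Var_lnH2 f)"
  obtains C N where "C \<ge> 0"
    "\<And>n v y. n \<ge> N \<Longrightarrow> v > 0 \<Longrightarrow>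
      measure (channel f n v) (exceed f n v y) \<le> Qfun (y * sqrt n / s) + C / sqrt n"
    "\<And>n v y. n \<ge> N \<Longrightarrow> v > 0 \<Longrightarrow>
      Qfun ((y + 4 * ln n / n) * sqrt n / s) - C / sqrt n \<le> measure (channel f n v) (exceed f n v y)"
proof -
  interpret F: prob_space "fadingM f" by (rule prob_space_fadingM[OF f])
  note m = ln_fading_moments[OF f]
  define X where "X h = ln (h\<^sup>2) - E_lnH2 f" for h :: real
  have s: "s > 0"
  proof -
    have "Var_lnH2 f \<ge> 0" unfolding Var_lnH2_def by (intro Bochner_Integration.integral_nonneg) auto
    then show ?thesis by (simp add: s_def)
  qed
  obtain C1 where C1: "C1 \<ge> 0" "\<And>n v y. n \<ge> 4 \<Longrightarrow> v > 0 \<Longrightarrow>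
    \<bar>measure (channel f n v) {w \<in> space (channel f n v). y * (s * sqrt (real n)) < (\<Sum>i<n. (snd w i)\<^sup>2 / v - 1 - X (fst w i))} - Qfun y\<bar> \<le> C1 / sqrt (real n)"
    using block_sum_tail[OF prob_space_fadingM[OF f] m(1-3)] unfolding m(4) s_def channel_def fadingVecM_def X_def by blast
  \<comment> \<open>Second use of the block bound, now with \<open>X = 0\<close>: it controls the
    noise norm without the fading.\<close>
  obtain C2 where C2: "C2 \<ge> 0" "\<And>n v y. n \<ge> 4 \<Longrightarrow> v > 0 \<Longrightarrow>
    \<bar>measure (channel f n v) {w \<in> space (channel f n v). y * (sqrt 2 * sqrt (real n)) < (\<Sum>i<n. (snd w i)\<^sup>2 / v - 1)} - Qfun y\<bar> \<le> C2 / sqrt (real n)"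
    using block_sum_tail[OF prob_space_fadingM[OF f], of "\<lambda>_. 0"] unfolding channel_def fadingVecM_def by auto
  have "(\<lambda>n::nat. 2 * ln (real n) / real n) \<longlonglongrightarrow> 0" by real_asymp
  then have "eventually (\<lambda>n::nat. 2 * ln (real n) / real n < 1 / 4) sequentially"
    by (rule order_tendstoD) simp
  then obtain N0 where N0: "\<And>n. n \<ge> N0 \<Longrightarrow> 2 * ln (real n) / real n < 1 / 4" by (auto simp: eventually_sequentially)
  define N where "N = max N0 4"
  \<comment> \<open>\<open>C1\<close> is the error of the main tail. Each of the two exceptional
    tails costs \<open>C2 + 1\<close>, the 1 being the Gaussian tail at \<open>u\<close>.\<close>
  define C where "C = C1 + 2 * C2 + 2"
  have CC: "C1 / sqrt n \<le> C / sqrt n" for n :: nat using C1 C2 by (intro divide_right_mono) (auto simp: C_def)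
  have sum_eq: "(\<Sum>i<n. z i ^ 2 / v - 1) = n * ((\<Sum>i<n. (z i)\<^sup>2) / (n * v) - 1)" if "n > 0" for n and z :: "nat \<Rightarrow> real" and v
    using that by (simp add: sum_subtractf sum_divide_distrib[symmetric] field_simps)
  show thesis
  proof (rule that[of C N])
    show "C \<ge> 0" using C1 C2 by (simp add: C_def)
  next
    fix n :: nat and v y :: real assume n: "n \<ge> N" and v: "v > 0"
    interpret P: prob_space "channel f n v" by (rule prob_space_channel[OF v])
    have n4: "n \<ge> 4" and n0: "n > 0" using n by (auto simp: N_def)
    let ?S = "{w \<in> space (channel f n v). (y * sqrt n / s) * (s * sqrt (real n)) < (\<Sum>i<n. (snd w i)\<^sup>2 / v - 1 - X (fst w i))}"
    have "exceed f n v y \<subseteq> ?S"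
    proof
      fix w assume w: "w \<in> exceed f n v y"
      define x where "x = (\<Sum>i<n. (snd w i)\<^sup>2) / (n * v)"
      have "x > 0" using w v n0 by (simp add: exceed_def x_def)
      then have "ln x \<le> x - 1" by (rule ln_le_minus_one)
      moreover have "y < ln x - (\<Sum>i<n. X (fst w i)) / n" using w by (simp add: exceed_def log_ratio_def x_def X_def)
      ultimately have "y < x - 1 - (\<Sum>i<n. X (fst w i)) / n" by simp
      then have "n * y < n * (x - 1) - (\<Sum>i<n. X (fst w i))" using n0 by (simp add: field_simps)
      also have "\<dots> = (\<Sum>i<n. (snd w i)\<^sup>2 / v - 1 - X (fst w i))"
        unfolding sum_subtractf[of _ "\<lambda>i. X (fst w i)"] sum_eq[OF n0] x_def by simp
      finally have "n * y < (\<Sum>i<n. (snd w i)\<^sup>2 / v - 1 - X (fst w i))" .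
      moreover have "(y * sqrt n / s) * (s * sqrt n) = n * y" using s by (simp add: mult.assoc)
      ultimately show "w \<in> ?S" using w unfolding exceed_def by (simp only: mem_Collect_eq)
    qed
    then have "measure (channel f n v) (exceed f n v y) \<le> measure (channel f n v) ?S"
      by (rule P.finite_measure_mono) (auto simp: channel_def X_def)
    also have "\<dots> \<le> Qfun (y * sqrt n / s) + C1 / sqrt n" using C1(2)[OF n4 v, of "y * sqrt n / s"] by simp
    finally show "measure (channel f n v) (exceed f n v y) \<le> Qfun (y * sqrt n / s) + C / sqrt n" using CC[of n] by simp
  next
    fix n :: nat and v y :: real assume n: "n \<ge> N" and v: "v > 0"
    interpret P: prob_space "channel f n v" by (rule prob_space_channel[OF v])
    have n4: "n \<ge> 4" and n0: "n > 0" using n by (auto simp: N_def)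
    define L where "L = 2 * ln (real n) / real n"
    have L: "0 \<le> L" "L < 1 / 4" using N0[of n] n n0 by (auto simp: L_def N_def)
    \<comment> \<open>\<open>u\<close> is chosen to have
      \<open>exp (- u\<^sup>2 / 2) = 1 / sqrt n\<close>. For the mean of
      \<open>Z\<^sup>2 / v - 1\<close> it amounts to a deviation of \<open>sqrt L\<close>, so the
      quadratic loss of the logarithm is at most \<open>2 * L\<close>.\<close>
    define u where "u = sqrt (ln (real n))"
    have u: "u \<ge> 0" "u\<^sup>2 = ln (real n)" using n4 by (auto simp: u_def)
    have eu: "exp (- u\<^sup>2 / 2) = 1 / sqrt n"
    proof -
      have "- u\<^sup>2 / 2 = - ln (sqrt n)" using n0 by (simp add: u ln_sqrt)
      then show ?thesis using n0 by (simp only: exp_minus exp_ln real_sqrt_gt_zero of_nat_0_less_iff inverse_eq_divide)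
    qed
    have uL: "u * (sqrt 2 * sqrt n) = n * sqrt L"
    proof -
      have "(u * (sqrt 2 * sqrt n))\<^sup>2 = (n * sqrt L)\<^sup>2"
        unfolding power_mult_distrib u(2) real_sqrt_pow2[OF L(1)] using n0 by (simp add: L_def power2_eq_square)
      then show ?thesis using u L by (subst (asm) power2_eq_iff_nonneg) auto
    qed
    let ?S = "{w \<in> space (channel f n v). ((y + 2 * L) * sqrt n / s) * (s * sqrt (real n)) < (\<Sum>i<n. (snd w i)\<^sup>2 / v - 1 - X (fst w i))}"
    let ?U = "\<lambda>u. {w \<in> space (channel f n v). u * (sqrt 2 * sqrt (real n)) < (\<Sum>i<n. (snd w i)\<^sup>2 / v - 1)}"
    have sets: "?S \<in> sets (channel f n v)" "\<And>u. ?U u \<in> sets (channel f n v)"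
      unfolding channel_def X_def by measurable
    have "?S \<subseteq> exceed f n v y \<union> ?U u \<union> (space (channel f n v) - ?U (- u))"
    proof
      fix w assume w: "w \<in> ?S"
      define x where "x = (\<Sum>i<n. (snd w i)\<^sup>2) / (n * v) - 1"
      have nx: "(\<Sum>i<n. (snd w i)\<^sup>2 / v - 1) = n * x" unfolding sum_eq[OF n0] x_def ..
      show "w \<in> exceed f n v y \<union> ?U u \<union> (space (channel f n v) - ?U (- u))"
      proof (cases "w \<in> ?U u \<union> (space (channel f n v) - ?U (- u))")
        case False
        then have "n * x \<le> n * sqrt L" "n * (- sqrt L) < n * x" using w by (auto simp: uL nx)
        then have "x \<le> sqrt L" "- sqrt L < x"
          using n0 by (simp_all only: mult_le_cancel_left_pos mult_less_cancel_left_pos of_nat_0_less_iff)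
        then have xL: "\<bar>x\<bar> \<le> sqrt L" by simp
        have L4: "sqrt L \<le> sqrt ((1/2)\<^sup>2)" using L by (intro real_sqrt_le_mono) (simp add: power2_eq_square)
        have x: "\<bar>x\<bar> \<le> 1 / 2" using xL L4 by simp
        have x2: "x\<^sup>2 \<le> L" using power_mono[OF xL, of 2] L by simp
        have pos: "0 < (\<Sum>i<n. (snd w i)\<^sup>2)"
        proof -
          have "0 < 1 + x" using x by auto
          then show ?thesis using n0 v sum_nonneg[of "{..<n}" "\<lambda>i. (snd w i)\<^sup>2"] by (auto simp: x_def zero_less_divide_iff not_less)
        qed
        have "(y + 2 * L) * n < (\<Sum>i<n. (snd w i)\<^sup>2 / v - 1 - X (fst w i))" using w s by (simp add: mult.assoc)
        also have "\<dots> = n * x - (\<Sum>i<n. X (fst w i))"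
          unfolding sum_subtractf[of _ "\<lambda>i. X (fst w i)"] nx by simp
        finally have "y + 2 * L < x - (\<Sum>i<n. X (fst w i)) / n" using n0 by (simp add: field_simps)
        also have "x \<le> ln (1 + x) + 2 * L" using abs_ln_one_plus_x_minus_x_bound[OF x] x2 by simp
        finally have "y < ln (1 + x) - (\<Sum>i<n. X (fst w i)) / n" by simp
        then show ?thesis using w pos by (auto simp: exceed_def log_ratio_def x_def X_def)
      qed simp
    qed
    then have "measure (channel f n v) ?S \<le> measure (channel f n v) (exceed f n v y \<union> ?U u \<union> (space (channel f n v) - ?U (- u)))"
      by (rule P.finite_measure_mono) (intro sets.Un sets.Diff sets.top measurable_exceed sets)
    also have "\<dots> \<le> measure (channel f n v) (exceed f n v y \<union> ?U u) + measure (channel f n v) (space (channel f n v) - ?U (- u))"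
      by (intro measure_Un_le sets.Un sets.Diff sets.top measurable_exceed sets)
    also have "measure (channel f n v) (exceed f n v y \<union> ?U u) \<le> measure (channel f n v) (exceed f n v y) + measure (channel f n v) (?U u)"
      by (intro measure_Un_le sets.Un sets.Diff sets.top measurable_exceed sets)
    also have "measure (channel f n v) (?U u) \<le> 1 / sqrt n + C2 / sqrt n"
      using C2(2)[OF n4 v, of u] Qfun_le(1)[OF u(1)] eu by simp
    also have "measure (channel f n v) (space (channel f n v) - ?U (- u)) \<le> 1 / sqrt n + C2 / sqrt n"
      unfolding P.prob_compl[OF sets(2)]
      using abs_le_D2[OF C2(2)[OF n4 v, of "- u"]] Qfun_le(2)[OF u(1)] eu by linarith
    finally have "measure (channel f n v) ?S \<le> measure (channel f n v) (exceed f n v y) + (1 / sqrt n + C2 / sqrt n) + (1 / sqrt n + C2 / sqrt n)"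
      by simp
    moreover have "Qfun ((y + 2 * L) * sqrt n / s) - C1 / sqrt n \<le> measure (channel f n v) ?S"
      using C1(2)[OF n4 v, of "(y + 2 * L) * sqrt n / s"] by simp
    moreover have "C / sqrt n = C1 / sqrt n + (1 / sqrt n + C2 / sqrt n) + (1 / sqrt n + C2 / sqrt n)"
      by (simp add: C_def add_divide_distrib)
    ultimately show "Qfun ((y + 4 * ln n / n) * sqrt n / s) - C / sqrt n \<le> measure (channel f n v) (exceed f n v y)"
      unfolding L_def by simp
  qed
qed

end

section \<open>The Gaussian tail and the volume of the ball\<close>

lemma Qfun_diff_bounds:
  assumes ab: "a \<le> b" and R: "\<bar>a\<bar> \<le> R" "\<bar>b\<bar> \<le> R"
  shows "std_normal_density R * (b - a) \<le> Qfun a - Qfun b" "Qfun a - Qfun b \<le> b - a"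
proof -
  interpret N: prob_space "normalM 1" by (rule prob_space_normalM) simp
  have "{a<..} - {b<..} = {a<..b}" using ab by auto
  then have "measure (normalM 1) {a<..b} = measure (normalM 1) {a<..} - measure (normalM 1) {b<..}"
    using N.finite_measure_Diff[of "{a<..}" "{b<..}"] ab by auto
  then have Q: "Qfun a - Qfun b = measure (normalM 1) {a<..b}" by (simp add: Qfun_def)
  have e: "emeasure (normalM 1) {a<..b} = (\<integral>\<^sup>+x. ennreal (std_normal_density x) * indicator {a<..b} x \<partial>lborel)"
    by (subst emeasure_density) auto
  have "ennreal (std_normal_density R * (b - a)) = (\<integral>\<^sup>+x. ennreal (std_normal_density R) * indicator {a<..b} x \<partial>lborel)"
    using ab by (subst nn_integral_cmult_indicator) (auto simp: ennreal_mult)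
  also have "\<dots> \<le> (\<integral>\<^sup>+x. ennreal (std_normal_density x) * indicator {a<..b} x \<partial>lborel)"
  proof (intro nn_integral_mono)
    fix x :: real
    have "std_normal_density R \<le> std_normal_density x" if "a < x" "x \<le> b"
    proof -
      have "x\<^sup>2 \<le> R\<^sup>2" using that R by (intro abs_le_square_iff[THEN iffD1]) auto
      then show ?thesis by (simp add: normal_density_def divide_right_mono)
    qed
    then show "ennreal (std_normal_density R) * indicator {a<..b} x \<le> ennreal (std_normal_density x) * indicator {a<..b} x"
      by (auto simp: indicator_def intro!: ennreal_leI)
  qed
  also have "\<dots> = ennreal (Qfun a - Qfun b)" unfolding e[symmetric] Q N.emeasure_eq_measure ..
  finally show "std_normal_density R * (b - a) \<le> Qfun a - Qfun b"
    by (subst (asm) ennreal_le_iff) (auto simp: Q)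
  have "ennreal (Qfun a - Qfun b) \<le> (\<integral>\<^sup>+x. indicator {a<..b} x \<partial>lborel)"
    unfolding Q N.emeasure_eq_measure[symmetric] e
  proof (intro nn_integral_mono)
    fix x :: real
    have "std_normal_density x \<le> 1"
    proof -
      have "std_normal_density x \<le> 1 / sqrt (2 * pi)" by (simp add: normal_density_def divide_right_mono)
      also have "\<dots> \<le> 1" using pi_gt3 by simp
      finally show ?thesis .
    qed
    then show "ennreal (std_normal_density x) * indicator {a<..b} x \<le> indicator {a<..b} x"
      by (auto simp: indicator_def ennreal_le_1)
  qed
  also have "\<dots> = ennreal (b - a)" using ab by simp
  finally show "Qfun a - Qfun b \<le> b - a" using ab by (subst (asm) ennreal_le_iff) auto
qed

lemma Qfun_strict_antimono: "a < b \<Longrightarrow> Qfun b < Qfun a"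
proof -
  assume "a < b"
  then have "0 < std_normal_density (max \<bar>a\<bar> \<bar>b\<bar>) * (b - a)" by (simp add: normal_density_pos)
  also have "\<dots> \<le> Qfun a - Qfun b" by (rule Qfun_diff_bounds) (use \<open>a < b\<close> in auto)
  finally show ?thesis by simp
qed

lemma Qfun_antimono: "a \<le> b \<Longrightarrow> Qfun b \<le> Qfun a"
  using Qfun_strict_antimono[of a b] by (cases "a = b") auto

text \<open>\<open>Qinv\<close> is a definite description, so both existence and uniqueness are due:
  the first by continuity between two tail bounds, the second by strict monotonicity.\<close>

lemma Qfun_Qinv:
  assumes "0 < \<epsilon>" "\<epsilon> < 1"
  shows "Qfun (Qinv \<epsilon>) = \<epsilon>"
proof -
  have cont: "isCont Qfun x" for x
  proof -
    have le: "\<bar>Qfun y - Qfun x\<bar> \<le> \<bar>y - x\<bar>" for y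
    proof (cases "x \<le> y")
      case True
      then show ?thesis using Qfun_diff_bounds(2)[of x y "max \<bar>x\<bar> \<bar>y\<bar>"] Qfun_antimono[of x y] by auto
    next
      case False
      then show ?thesis using Qfun_diff_bounds(2)[of y x "max \<bar>x\<bar> \<bar>y\<bar>"] Qfun_antimono[of y x] by auto
    qed
    have "((\<lambda>y. \<bar>y - x\<bar>) \<longlongrightarrow> \<bar>x - x\<bar>) (at x)" by (intro tendsto_intros)
    then have lim: "((\<lambda>y. \<bar>y - x\<bar>) \<longlongrightarrow> 0) (at x)" by simp
    have "((\<lambda>y. Qfun y - Qfun x) \<longlongrightarrow> 0) (at x)"
      by (rule Lim_null_comparison[OF _ lim]) (simp add: le)
    then show ?thesis unfolding isCont_def by (simp add: LIM_zero_iff)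
  qed
  \<comment> \<open>\<open>u\<close> solves \<open>exp (- u\<^sup>2 / 2) = d\<close>. Since
    \<open>d\<close> is at most both \<open>\<epsilon>\<close> and \<open>1 - \<epsilon>\<close>,
    the tail bounds place \<open>\<epsilon>\<close> between \<open>Qfun u\<close> and
    \<open>Qfun (- u)\<close>.\<close>
  define d where "d = min \<epsilon> (1 - \<epsilon>)"
  define u where "u = sqrt (2 * ln (1 / d))"
  have d: "0 < d" "d < 1" using assms by (auto simp: d_def)
  then have "ln (1 / d) > 0" by simp
  then have u: "u \<ge> 0" "u\<^sup>2 = 2 * ln (1 / d)" by (auto simp: u_def)
  have "exp (- u\<^sup>2 / 2) = d" unfolding u(2) using d by (simp add: ln_div)
  then have "Qfun u \<le> d" "1 - d \<le> Qfun (- u)" using Qfun_le[OF u(1)] by auto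
  then have "Qfun u \<le> \<epsilon>" "\<epsilon> \<le> Qfun (- u)" by (auto simp: d_def min_def split: if_splits)
  then obtain x where x: "Qfun x = \<epsilon>"
    using IVT2[of Qfun u \<epsilon> "- u"] cont u by auto
  have "\<And>y. Qfun y = \<epsilon> \<Longrightarrow> y = x"
    using Qfun_strict_antimono x by (metis linorder_neqE_linordered_idom less_irrefl)
  then show ?thesis unfolding Qinv_def using x by (metis (mono_tags) theI)
qed

text \<open>Within distance 1 of \<open>q\<close> the normal density is at least its value at
  \<open>|q| + 1\<close>. Later \<open>t\<close> is of order \<open>ln n / sqrt n\<close>, and
  \<open>m * t\<close> has to absorb all probability errors of order
  \<open>1 / sqrt n\<close>.\<close>

lemma Qfun_local_slope:
  obtains m where "m > 0"
    "\<And>t. 0 \<le> t \<Longrightarrow> t \<le> 1 \<Longrightarrow> Qfun q + m * t \<le> Qfun (q - t)"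
    "\<And>t. 0 \<le> t \<Longrightarrow> t \<le> 1 \<Longrightarrow> Qfun (q + t) \<le> Qfun q - m * t"
proof (rule that[of "std_normal_density (\<bar>q\<bar> + 1)"])
  show "std_normal_density (\<bar>q\<bar> + 1) > 0" by (simp add: normal_density_pos)
  show "Qfun q + std_normal_density (\<bar>q\<bar> + 1) * t \<le> Qfun (q - t)" if "0 \<le> t" "t \<le> 1" for t
    using Qfun_diff_bounds(1)[of "q - t" q "\<bar>q\<bar> + 1"] that by (simp add: abs_le_iff) linarith
  show "Qfun (q + t) \<le> Qfun q - std_normal_density (\<bar>q\<bar> + 1) * t" if "0 \<le> t" "t \<le> 1" for t
    using Qfun_diff_bounds(1)[of q "q + t" "\<bar>q\<bar> + 1"] that by (simp add: abs_le_iff) linarith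
qed

text \<open>A crude Stirling bound. From the functional equation, \<open>g\<close> increases and
  \<open>g x - ln x\<close> decreases when \<open>x\<close> grows by 1, since
  \<open>x * ln (1 + 1 / x)\<close> is at most 1 and \<open>(x + 1) * ln (1 + 1 / x)\<close> is at
  least 1. So the half integers reduce, in steps of 2 in \<open>n\<close>, to the values at
  \<open>1 / 2\<close> and 1.\<close>

lemma ln_Gamma_half_bounds:
  fixes n :: nat
  defines "g \<equiv> \<lambda>x::real. ln (Gamma (x + 1)) - x * ln x + x"
  assumes n: "n \<ge> 1"
  shows "min (g (1/2)) (g 1) \<le> g (n / 2)" "g (n / 2) \<le> max (g (1/2) - ln (1/2)) (g 1) + ln (n / 2)"
proof -
  have step: "g x \<le> g (x + 1)" "g (x + 1) - ln (x + 1) \<le> g x - ln x" if x: "x > 0" for x :: real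
  proof -
    have "Gamma (x + 1 + 1) = (x + 1) * Gamma (x + 1)"
      using x by (intro Gamma_plus1) (auto elim!: nonpos_Ints_cases)
    moreover have "Gamma (x + 1) > 0" using x by (intro Gamma_real_pos) auto
    ultimately have "ln (Gamma (x + 1 + 1)) = ln (x + 1) + ln (Gamma (x + 1))"
      using x by (simp only: ln_mult_pos add_pos_pos zero_less_one)
    then have d: "g (x + 1) = g x + 1 - x * (ln (x + 1) - ln x)" by (simp add: g_def algebra_simps)
    have l: "ln (x + 1) - ln x = ln (1 + 1 / x)" using x ln_div[of "x + 1" x] by (simp add: add_divide_distrib)
    have "x * ln (1 + 1 / x) \<le> x * (1 / x)"
      using x by (intro mult_left_mono ln_add_one_self_le_self) auto
    then show "g x \<le> g (x + 1)" using d l x by simp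
    have "- ln (1 + 1 / x) = ln (x / (x + 1))" using x by (simp add: l[symmetric] ln_div)
    also have "\<dots> \<le> x / (x + 1) - 1" using x by (intro ln_le_minus_one) auto
    finally have "(x + 1) * (1 / (x + 1)) \<le> (x + 1) * ln (1 + 1 / x)"
      using x by (intro mult_left_mono) (auto simp: field_simps)
    then have "1 \<le> (x + 1) * ln (1 + 1 / x)" using x by simp
    then show "g (x + 1) - ln (x + 1) \<le> g x - ln x" using d l by (simp add: algebra_simps)
  qed
  have "min (g (1/2)) (g 1) \<le> g (n / 2) \<and> g (n / 2) - ln (n / 2) \<le> max (g (1/2) - ln (1/2)) (g 1)"
    using n
  proof (induction n rule: less_induct)
    case (less n)
    consider "n = 1" | "n = 2" | "n \<ge> 3" using less.prems by linarith
    then show ?case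
    proof cases
      case 3
      then have IH: "min (g (1/2)) (g 1) \<le> g ((real n - 2) / 2) \<and> g ((real n - 2) / 2) - ln ((real n - 2) / 2) \<le> max (g (1/2) - ln (1/2)) (g 1)"
        using less.IH[of "n - 2"] by (simp add: of_nat_diff)
      have e: "(real n - 2) / 2 + 1 = n / 2" by (simp add: field_simps)
      have "g ((real n - 2) / 2) \<le> g (n / 2)" "g (n / 2) - ln (n / 2) \<le> g ((real n - 2) / 2) - ln ((real n - 2) / 2)"
        using step[of "(real n - 2) / 2", unfolded e] 3 by simp_all
      then show ?thesis using IH 3 by linarith
    qed auto
  qed
  then show "min (g (1/2)) (g 1) \<le> g (n / 2)" "g (n / 2) \<le> max (g (1/2) - ln (1/2)) (g 1) + ln (n / 2)"
    by linarith+
qed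

lemma ln_ge_1:
  assumes "n \<ge> 3" shows "1 \<le> ln (real n)"
proof -
  have "exp 1 \<le> real n" using assms exp_le by linarith
  then show ?thesis using assms by (subst ln_ge_iff) auto
qed

text \<open>\<open>2 * pi * exp 1\<close> is the constant in the normalization of
  \<open>VNR\<close>: once it cancels, the effective squared radius is \<open>n * v\<close> times
  the volume-to-noise ratio and a fading term, up to O(ln n / n) in the logarithm.
  \<open>n \<ge> 3\<close> gives \<open>1 \<le> ln n\<close>, so constants are absorbed into
  multiples of \<open>ln n\<close>.\<close>

lemma unit_ball_vol_asymp:
  obtains C where "C \<ge> 0"
    "\<And>n::nat. n \<ge> 3 \<Longrightarrow> \<bar>2 / real n * ln (unit_ball_vol (real n)) - (ln (2 * pi * exp 1) - ln (real n))\<bar> \<le> C * (ln (real n) / real n)"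
proof -
  define g where "g x = ln (Gamma (x + 1)) - x * ln x + x" for x :: real
  define c where "c = \<bar>g (1/2)\<bar> + \<bar>g 1\<bar> + 1"
  show thesis
  proof (rule that[of "2 * (c + 1)"])
    show "0 \<le> 2 * (c + 1)" by (simp add: c_def)
    fix n :: nat assume n: "n \<ge> 3"
    have ln1: "ln (real n) \<ge> 1" by (rule ln_ge_1[OF n])
    have l2: "0 \<le> ln (2::real)" "ln (2::real) \<le> 1" using ln_le_minus_one[of "2::real"] by auto
    have "min (g (1/2)) (g 1) \<le> g (n / 2)" "g (n / 2) \<le> max (g (1/2) + ln 2) (g 1) + (ln n - ln 2)"
      using ln_Gamma_half_bounds[of n] n unfolding g_def[symmetric] by (auto simp: ln_div)
    then have "\<bar>g (n / 2)\<bar> \<le> c + ln n"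
      using l2 ln1 unfolding c_def by linarith
    also have "\<dots> \<le> (c + 1) * ln n" using ln1 mult_left_mono[of 1 "ln (real n)" c] by (simp add: c_def algebra_simps)
    finally have gb: "\<bar>g (n / 2)\<bar> \<le> (c + 1) * ln n" .
    have G: "Gamma (real n / 2 + 1) > 0" by (intro Gamma_real_pos) auto
    have "ln (unit_ball_vol n) = n / 2 * ln pi - ln (Gamma (n / 2 + 1))"
      unfolding unit_ball_vol_def using G less_imp_neq[OF G] by (subst ln_div) (auto simp: ln_powr)
    also have "\<dots> = n / 2 * ln pi - (g (n / 2) + n / 2 * ln (n / 2) - n / 2)" by (simp add: g_def)
    finally have "2 / n * ln (unit_ball_vol n) = ln pi - 2 / n * g (n / 2) - ln (n / 2) + 1"
      using n by (simp add: field_simps)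
    moreover have "ln (2 * pi * exp 1) = ln 2 + ln pi + 1" by (simp add: ln_mult)
    moreover have "ln (real n / 2) = ln n - ln 2" using n by (simp add: ln_div)
    ultimately have "\<bar>2 / n * ln (unit_ball_vol n) - (ln (2 * pi * exp 1) - ln n)\<bar> = 2 / n * \<bar>g (n / 2)\<bar>"
      by (simp add: abs_mult)
    also have "\<dots> \<le> 2 / n * ((c + 1) * ln n)" by (intro mult_left_mono gb) auto
    also have "\<dots> = 2 * (c + 1) * (ln n / n)" using n by (simp add: field_simps)
    finally show "\<bar>2 / real n * ln (unit_ball_vol (real n)) - (ln (2 * pi * exp 1) - ln (real n))\<bar> \<le> 2 * (c + 1) * (ln (real n) / real n)" .
  qed
qed

section \<open>Gaussian noise and Lebesgue measure on coordinate space\<close>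

abbreviation lebn :: "nat \<Rightarrow> (nat \<Rightarrow> real) measure" where
  "lebn n \<equiv> PiM {..<n} (\<lambda>_. lborel)"

lemma sets_lebn [measurable_cong]: "sets (lebn n) = sets (PiM {..<n} (\<lambda>_. borel))"
  by (intro sets_PiM_cong) simp_all

lemma space_lebn: "space (lebn n) = Rn n" "space (noiseM n v) = Rn n"
  by (simp_all add: space_PiM Rn_def noiseM_def)

interpretation lebn: product_sigma_finite "\<lambda>_::nat. lborel :: real measure" ..

lemma sigma_finite_lebn: "sigma_finite_measure (lebn n)"
  by (rule lebn.sigma_finite) simp

definition gauss :: "nat \<Rightarrow> real \<Rightarrow> (nat \<Rightarrow> real) \<Rightarrow> real" where
  "gauss n v z = (\<Prod>i<n. normal_density 0 (sqrt v) (z i))"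

definition gauss_radial :: "nat \<Rightarrow> real \<Rightarrow> real \<Rightarrow> real" where
  "gauss_radial n v t = (1 / sqrt (2 * pi * v)) ^ n * exp (- t / (2 * v))"

lemma gauss_eq:
  assumes "v > 0"
  shows "gauss n v z = gauss_radial n v (\<Sum>i<n. (z i)\<^sup>2)"
proof -
  have "gauss n v z = (\<Prod>i<n. 1 / sqrt (2 * pi * v) * exp (- (z i)\<^sup>2 / (2 * v)))"
    using assms by (simp add: gauss_def normal_density_def)
  also have "\<dots> = (1 / sqrt (2 * pi * v)) ^ n * exp (\<Sum>i<n. - (z i)\<^sup>2 / (2 * v))"
    by (simp only: prod.distrib exp_sum[OF finite_lessThan] prod_constant card_lessThan)
  also have "(\<Sum>i<n. - (z i)\<^sup>2 / (2 * v)) = - (\<Sum>i<n. (z i)\<^sup>2) / (2 * v)"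
    by (simp add: sum_negf sum_divide_distrib)
  finally show ?thesis by (simp add: gauss_radial_def)
qed

lemma gauss_nonneg [simp]: "0 \<le> gauss n v z" "v > 0 \<Longrightarrow> 0 \<le> gauss_radial n v t"
  by (auto simp: gauss_def gauss_radial_def intro!: prod_nonneg mult_nonneg_nonneg)

lemma gauss_radial_antimono: "v > 0 \<Longrightarrow> a \<le> b \<Longrightarrow> gauss_radial n v b \<le> gauss_radial n v a"
  by (auto simp: gauss_radial_def divide_right_mono intro!: mult_left_mono)

lemma measurable_gauss [measurable]: "gauss n v \<in> borel_measurable (lebn n)"
  unfolding gauss_def by measurable

lemma noiseM_eq_density:
  assumes v: "v > 0"
  shows "noiseM n v = density (lebn n) (\<lambda>z. ennreal (gauss n v z))"
proof -
  interpret N: prob_space "normalM v" by (rule prob_space_normalM[OF v])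
  interpret PN: product_sigma_finite "\<lambda>_::nat. normalM v" ..
  have "density (lebn n) (\<lambda>z. ennreal (gauss n v z)) = PiM {..<n} (\<lambda>_. normalM v)"
  proof (rule PN.PiM_eqI)
    show "sets (density (lebn n) (\<lambda>z. ennreal (gauss n v z))) = sets (PiM {..<n} (\<lambda>_. normalM v))"
      by (simp add: sets_lebn) (intro sets_PiM_cong, simp_all)
    fix A :: "nat \<Rightarrow> real set" assume A: "\<And>i. i \<in> {..<n} \<Longrightarrow> A i \<in> sets (normalM v)"
    have [measurable]: "Pi\<^sub>E {..<n} A \<in> sets (lebn n)" using A by (intro sets_PiM_I_finite) auto
    have "emeasure (density (lebn n) (\<lambda>z. ennreal (gauss n v z))) (Pi\<^sub>E {..<n} A) =
        (\<integral>\<^sup>+z. ennreal (gauss n v z) * indicator (Pi\<^sub>E {..<n} A) z \<partial>lebn n)"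
      by (subst emeasure_density) auto
    also have "\<dots> = (\<integral>\<^sup>+z. (\<Prod>i<n. ennreal (normal_density 0 (sqrt v) (z i)) * indicator (A i) (z i)) \<partial>lebn n)"
    proof (rule nn_integral_cong)
      fix z assume z: "z \<in> space (lebn n)"
      have "indicator (Pi\<^sub>E {..<n} A) z = (\<Prod>i<n. indicator (A i) (z i) :: ennreal)"
        using z by (auto simp: indicator_def PiE_iff space_PiM prod_zero_iff split: if_splits)
      then show "ennreal (gauss n v z) * indicator (Pi\<^sub>E {..<n} A) z =
        (\<Prod>i<n. ennreal (normal_density 0 (sqrt v) (z i)) * indicator (A i) (z i))"
        by (simp add: gauss_def prod.distrib prod_ennreal)
    qed
    also have "\<dots> = (\<Prod>i<n. (\<integral>\<^sup>+z. ennreal (normal_density 0 (sqrt v) z) * indicator (A i) z \<partial>lborel))"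
      by (rule lebn.product_nn_integral_prod) (use A in auto)
    also have "\<dots> = (\<Prod>i<n. emeasure (normalM v) (A i))"
      by (intro prod.cong refl) (subst emeasure_density, use A in auto)
    finally show "emeasure (density (lebn n) (\<lambda>z. ennreal (gauss n v z))) (Pi\<^sub>E {..<n} A) = (\<Prod>i<n. emeasure (normalM v) (A i))" .
  qed simp
  then show ?thesis by (simp add: noiseM_def)
qed

lemma emeasure_noiseM:
  assumes "v > 0" and B: "B \<in> sets (lebn n)"
  shows "emeasure (noiseM n v) B = (\<integral>\<^sup>+z. ennreal (gauss n v z) * indicator B z \<partial>lebn n)"
  unfolding noiseM_eq_density[OF assms(1)] using B by (subst emeasure_density) auto

definition ball0 :: "nat \<Rightarrow> real \<Rightarrow> (nat \<Rightarrow> real) set" where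
  "ball0 n r = {z \<in> Rn n. (\<Sum>i<n. (z i)\<^sup>2) \<le> r\<^sup>2}"

lemma sets_ball0 [measurable]: "ball0 n r \<in> sets (lebn n)"
  unfolding ball0_def space_lebn(1)[symmetric] by measurable

lemma emeasure_ball0: "r > 0 \<Longrightarrow> emeasure (lebn n) (ball0 n r) = ennreal (unit_ball_vol n * r ^ n)"
proof -
  assume r: "r > 0"
  have "ball0 n r = {f. sqrt (\<Sum>i<n. (f i)\<^sup>2) \<le> r} \<inter> space (lebn n)"
    using r by (auto simp: ball0_def space_lebn real_sqrt_le_iff[symmetric, of _ "r\<^sup>2"] simp del: real_sqrt_le_iff)
  then show ?thesis using emeasure_cball_aux[of "{..<n}" r] r by simp
qed

text \<open>The density exceeds its value on the sphere of radius \<^term>\<open>r\<close> exactly inside the ball, which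
  gives a bound that is linear in the volume and so can be averaged over Voronoi cells.\<close>
lemma noise_ball_optimal:
  assumes v: "v > 0" and B: "B \<in> sets (lebn n)"
  shows "emeasure (noiseM n v) B + ennreal (gauss_radial n v (r\<^sup>2)) * emeasure (lebn n) (ball0 n r)
    \<le> emeasure (noiseM n v) (ball0 n r) + ennreal (gauss_radial n v (r\<^sup>2)) * emeasure (lebn n) B"
proof -
  let ?\<phi> = "gauss_radial n v (r\<^sup>2)"
  note B[measurable]
  have "emeasure (noiseM n v) B + ennreal ?\<phi> * emeasure (lebn n) (ball0 n r)
    = (\<integral>\<^sup>+z. ennreal (gauss n v z) * indicator B z + ennreal ?\<phi> * indicator (ball0 n r) z \<partial>lebn n)"
    by (subst nn_integral_add) (auto simp: emeasure_noiseM[OF v] nn_integral_cmult)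
  also have "\<dots> \<le> (\<integral>\<^sup>+z. ennreal (gauss n v z) * indicator (ball0 n r) z + ennreal ?\<phi> * indicator B z \<partial>lebn n)"
  proof (rule nn_integral_mono)
    fix z assume z: "z \<in> space (lebn n)"
    show "ennreal (gauss n v z) * indicator B z + ennreal ?\<phi> * indicator (ball0 n r) z \<le>
        ennreal (gauss n v z) * indicator (ball0 n r) z + ennreal ?\<phi> * indicator B z"
    proof (cases "z \<in> ball0 n r")
      case True
      then have "?\<phi> \<le> gauss n v z" unfolding gauss_eq[OF v] by (intro gauss_radial_antimono v) (auto simp: ball0_def)
      then show ?thesis using True by (auto simp: indicator_def add.commute intro!: ennreal_leI)
    next
      case False
      then have "gauss n v z \<le> ?\<phi>" unfolding gauss_eq[OF v] using z by (intro gauss_radial_antimono v) (auto simp: ball0_def space_lebn)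
      then show ?thesis using False by (auto simp: indicator_def intro!: ennreal_leI)
    qed
  qed
  also have "\<dots> = emeasure (noiseM n v) (ball0 n r) + ennreal ?\<phi> * emeasure (lebn n) B"
    by (subst nn_integral_add) (auto simp: emeasure_noiseM[OF v] nn_integral_cmult)
  finally show ?thesis .
qed

definition affn :: "nat \<Rightarrow> (nat \<Rightarrow> real) \<Rightarrow> (nat \<Rightarrow> real) \<Rightarrow> (nat \<Rightarrow> real) \<Rightarrow> nat \<Rightarrow> real" where
  "affn n c h x = (\<lambda>i\<in>{..<n}. c i + h i * x i)"

lemma measurable_affn [measurable]: "affn n c h \<in> lebn n \<rightarrow>\<^sub>M lebn n"
  unfolding affn_def by measurable

lemma lebn_affine:
  assumes h: "\<And>i. i < n \<Longrightarrow> h i \<noteq> 0"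
  shows "density (distr (lebn n) (lebn n) (affn n c h)) (\<lambda>_. ennreal (\<Prod>i<n. \<bar>h i\<bar>)) = lebn n"
proof (rule lebn.PiM_eqI)
  fix A :: "nat \<Rightarrow> real set" assume A: "\<And>i. i \<in> {..<n} \<Longrightarrow> A i \<in> sets lborel"
  have [measurable]: "Pi\<^sub>E {..<n} A \<in> sets (lebn n)" using A by (intro sets_PiM_I_finite) auto
  have pre: "affn n c h -` Pi\<^sub>E {..<n} A \<inter> space (lebn n) = Pi\<^sub>E {..<n} (\<lambda>i. (\<lambda>x. c i + h i * x) -` A i)"
    by (auto simp: affn_def space_PiM PiE_iff)
  have m: "(\<lambda>x. c i + h i * x) -` A i \<in> sets borel" if "i < n" for i
    using measurable_sets[of "\<lambda>x. c i + h i * x" borel borel "A i"] A that by auto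
  have "emeasure (density (distr (lebn n) (lebn n) (affn n c h)) (\<lambda>_. ennreal (\<Prod>i<n. \<bar>h i\<bar>))) (Pi\<^sub>E {..<n} A)
    = ennreal (\<Prod>i<n. \<bar>h i\<bar>) * emeasure (lebn n) (Pi\<^sub>E {..<n} (\<lambda>i. (\<lambda>x. c i + h i * x) -` A i))"
    by (subst emeasure_density) (auto simp: nn_integral_cmult emeasure_distr pre[symmetric])
  also have "\<dots> = (\<Prod>i<n. ennreal \<bar>h i\<bar> * emeasure lborel ((\<lambda>x. c i + h i * x) -` A i))"
    using m by (subst lebn.emeasure_PiM) (auto simp: prod.distrib prod_ennreal)
  also have "\<dots> = (\<Prod>i<n. emeasure lborel (A i))"
  proof (rule prod.cong[OF refl])
    fix i assume i: "i \<in> {..<n}"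
    then have Ai: "A i \<in> sets borel" using A by auto
    have "emeasure lborel (A i) = emeasure (density (distr lborel borel (\<lambda>x. c i + h i * x)) (\<lambda>_. ennreal \<bar>h i\<bar>)) (A i)"
      using i h by (subst lborel_real_affine[of "h i" "c i"]) auto
    also have "\<dots> = ennreal \<bar>h i\<bar> * emeasure lborel ((\<lambda>x. c i + h i * x) -` A i)"
      using Ai by (subst emeasure_density) (auto simp: nn_integral_cmult emeasure_distr)
    finally show "ennreal \<bar>h i\<bar> * emeasure lborel ((\<lambda>x. c i + h i * x) -` A i) = emeasure lborel (A i)" ..
  qed
  finally show "emeasure (density (distr (lebn n) (lebn n) (affn n c h)) (\<lambda>_. ennreal (\<Prod>i<n. \<bar>h i\<bar>))) (Pi\<^sub>E {..<n} A)
    = (\<Prod>i\<in>{..<n}. emeasure lborel (A i))" .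
qed simp_all

lemma emeasure_lebn_affine:
  assumes h: "\<And>i. i < n \<Longrightarrow> h i \<noteq> 0" and B: "B \<in> sets (lebn n)"
  shows "ennreal (\<Prod>i<n. \<bar>h i\<bar>) * emeasure (lebn n) {x \<in> space (lebn n). affn n c h x \<in> B} = emeasure (lebn n) B"
proof -
  note B[measurable]
  have "emeasure (lebn n) B = emeasure (density (distr (lebn n) (lebn n) (affn n c h)) (\<lambda>_. ennreal (\<Prod>i<n. \<bar>h i\<bar>))) B"
    by (subst lebn_affine[OF h]) auto
  also have "\<dots> = ennreal (\<Prod>i<n. \<bar>h i\<bar>) * emeasure (lebn n) (affn n c h -` B \<inter> space (lebn n))"
    by (subst emeasure_density) (auto simp: nn_integral_cmult emeasure_distr)
  also have "affn n c h -` B \<inter> space (lebn n) = {x \<in> space (lebn n). affn n c h x \<in> B}" by auto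
  finally show ?thesis ..
qed

lemma emeasure_lebn_translate:
  assumes B: "B \<in> sets (lebn n)"
  shows "emeasure (lebn n) {z \<in> space (lebn n). vadd n c z \<in> B} = emeasure (lebn n) B"
  using emeasure_lebn_affine[of n "\<lambda>_. 1" B c, OF _ B] by (simp add: affn_def vadd_def)

lemma measurable_sqdist [measurable (raw)]:
  assumes "f \<in> M \<rightarrow>\<^sub>M PiM {..<n} (\<lambda>_. borel)" "g \<in> M \<rightarrow>\<^sub>M PiM {..<n} (\<lambda>_. borel)"
  shows "(\<lambda>x. sqdist_n n (f x) (g x)) \<in> borel_measurable M"
proof -
  note assms[measurable]
  show ?thesis unfolding sqdist_n_def by measurable
qed

text \<open>Choose a coordinate in which \<open>p\<close> and \<open>q\<close> differ and fix the
  others. The squares of the free coordinate cancel, so the equation is linear with the single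
  solution \<open>t0\<close>, and Fubini gives volume 0.\<close>

lemma bisector_null:
  assumes pq: "p \<in> Rn n" "q \<in> Rn n" "p \<noteq> q"
  shows "emeasure (lebn n) {y \<in> Rn n. sqdist_n n y p = sqdist_n n y q} = 0"
proof -
  obtain i where i: "i < n" "p i \<noteq> q i"
    using pq unfolding Rn_def by (metis PiE_ext lessThan_iff)
  define I where "I = {..<n} - {i}"
  have ins: "{..<n} = insert i I" "i \<notin> I" "finite I" using i by (auto simp: I_def)
  let ?H = "{y \<in> Rn n. sqdist_n n y p = sqdist_n n y q}"
  have pm: "p \<in> space (PiM {..<n} (\<lambda>_. borel))" "q \<in> space (PiM {..<n} (\<lambda>_. borel))" using pq by (auto simp: Rn_def space_PiM)
  have H[measurable]: "?H \<in> sets (lebn n)"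
    unfolding space_lebn(1)[symmetric] using pm by measurable
  have "emeasure (lebn n) ?H = (\<integral>\<^sup>+y. indicator ?H y \<partial>PiM (insert i I) (\<lambda>_. lborel))"
    using H by (simp add: ins(1))
  also have "\<dots> = (\<integral>\<^sup>+x. (\<integral>\<^sup>+t. indicator ?H (x(i := t)) \<partial>lborel) \<partial>PiM I (\<lambda>_. lborel))"
    using ins H by (intro lebn.product_nn_integral_insert) (auto simp: ins(1)[symmetric])
  also have "\<dots> = (\<integral>\<^sup>+x. 0 \<partial>PiM I (\<lambda>_. lborel :: real measure))"
  proof (rule nn_integral_cong)
    fix x :: "nat \<Rightarrow> real"
    define R where "R = (\<Sum>j\<in>I. (x j - p j)\<^sup>2) - (\<Sum>j\<in>I. (x j - q j)\<^sup>2)"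
    define t0 where "t0 = ((q i)\<^sup>2 - (p i)\<^sup>2 - R) / (2 * (q i - p i))"
    have "t = t0" if "x(i := t) \<in> ?H" for t
    proof -
      have s: "sqdist_n n (x(i := t)) c = (t - c i)\<^sup>2 + (\<Sum>j\<in>I. (x j - c j)\<^sup>2)" for c
        unfolding sqdist_n_def ins(1) using ins(2,3) by (subst sum.insert) (auto intro!: sum.cong arg_cong2[where f="(+)"])
      have "(t - p i)\<^sup>2 - (t - q i)\<^sup>2 + R = 0" using that s[of p] s[of q] by (simp add: R_def)
      then have "t * (2 * (q i - p i)) = (q i)\<^sup>2 - (p i)\<^sup>2 - R" by (simp add: power2_eq_square algebra_simps)
      then show ?thesis using i by (simp add: t0_def field_simps)
    qed
    then have "(\<integral>\<^sup>+t. indicator ?H (x(i := t)) \<partial>lborel) \<le> (\<integral>\<^sup>+t. indicator {t0} t \<partial>lborel)"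
      by (intro nn_integral_mono) (auto simp: indicator_def)
    also have "\<dots> = 0" by simp
    finally show "(\<integral>\<^sup>+t. indicator ?H (x(i := t)) \<partial>lborel) = 0" by simp
  qed
  finally show ?thesis by simp
qed

section \<open>The sphere bound\<close>

lemma sets_voronoi:
  assumes "countable T" "T \<subseteq> Rn n" "p \<in> Rn n"
  shows "voronoi n T p \<in> sets (lebn n)"
proof -
  have sp: "Rn n = space (PiM {..<n} (\<lambda>_. borel))" by (simp add: Rn_def space_PiM)
  have "{y \<in> space (lebn n). \<forall>q\<in>T. sqdist_n n y p \<le> sqdist_n n y q} \<in> sets (lebn n)"
  proof (rule sets.sets_Collect_countable_All'[OF _ assms(1)])
    fix q assume "q \<in> T"
    then have [measurable]: "q \<in> space (PiM {..<n} (\<lambda>_. borel))" "p \<in> space (PiM {..<n} (\<lambda>_. borel))"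
      using assms sp by auto
    show "{y \<in> space (lebn n). sqdist_n n y p \<le> sqdist_n n y q} \<in> sets (lebn n)"
      by measurable
  qed
  then show ?thesis by (simp add: voronoi_def space_lebn)
qed

lemma measurable_vadd: "p \<in> Rn n \<Longrightarrow> vadd n p \<in> lebn n \<rightarrow>\<^sub>M lebn n"
  unfolding vadd_def by measurable

lemma hmul_in_Rn [simp]: "hmul n h x \<in> Rn n" and vadd_in_Rn [simp]: "vadd n x y \<in> Rn n"
  by (auto simp: hmul_def vadd_def Rn_def)

lemma Rn_eqI: "x \<in> Rn n \<Longrightarrow> y \<in> Rn n \<Longrightarrow> (\<And>i. i < n \<Longrightarrow> x i = y i) \<Longrightarrow> x = y"
  unfolding Rn_def by (metis PiE_ext lessThan_iff)

lemma sets_noise_lebn: "sets (noiseM n v) = sets (lebn n)"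
  by (simp add: sets_noiseM sets_lebn)

lemma perr_eq:
  assumes v: "v > 0" and "countable T" "T \<subseteq> Rn n" "p \<in> Rn n"
  shows "perr n v T p = 1 - measure (noiseM n v) {z \<in> space (lebn n). vadd n p z \<in> voronoi n T p}"
proof -
  interpret N: prob_space "noiseM n v" by (rule prob_space_noiseM[OF v])
  have "{z \<in> space (lebn n). vadd n p z \<in> voronoi n T p} \<in> sets (lebn n)"
    using sets_voronoi[OF assms(2-4)] measurable_vadd[OF assms(4)] by measurable
  moreover have "{z \<in> space (noiseM n v). vadd n p z \<notin> voronoi n T p} = space (noiseM n v) - {z \<in> space (lebn n). vadd n p z \<in> voronoi n T p}"
    by (auto simp: space_lebn)
  ultimately show ?thesis unfolding perr_def by (simp only: N.prob_compl sets_noise_lebn)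
qed

lemma perr_bounds:
  assumes v: "v > 0" shows "0 \<le> perr n v T p" "perr n v T p \<le> 1"
proof -
  interpret N: prob_space "noiseM n v" by (rule prob_space_noiseM[OF v])
  show "0 \<le> perr n v T p" "perr n v T p \<le> 1" by (simp_all add: perr_def)
qed

text \<open>Cells include their boundaries and may overlap, but only where two distances agree, that
  is on finitely many bisectors of measure zero. Almost every point of \<open>Q\<close> lies in at
  most one of the cells.\<close>

lemma voronoi_volume_sum:
  assumes T: "countable T" "T \<subseteq> Rn n" and A: "finite A" "A \<subseteq> T" and Q: "Q \<in> sets (lebn n)"
  shows "(\<Sum>p\<in>A. emeasure (lebn n) (voronoi n T p \<inter> Q)) \<le> emeasure (lebn n) Q"
proof -
  have V: "voronoi n T p \<in> sets (lebn n)" if "p \<in> A" for p using that A T by (intro sets_voronoi) auto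
  have "AE y in lebn n. \<forall>p\<in>A. \<forall>q\<in>A. p \<noteq> q \<longrightarrow> sqdist_n n y p \<noteq> sqdist_n n y q"
  proof (intro AE_finite_allI A)
    fix p q assume pq: "p \<in> A" "q \<in> A"
    show "AE y in lebn n. p \<noteq> q \<longrightarrow> sqdist_n n y p \<noteq> sqdist_n n y q"
    proof (cases "p = q")
      case False
      have "{y \<in> Rn n. sqdist_n n y p = sqdist_n n y q} \<in> null_sets (lebn n)"
      proof (rule null_setsI)
        show "emeasure (lebn n) {y \<in> Rn n. sqdist_n n y p = sqdist_n n y q} = 0"
          using pq A T False by (intro bisector_null) auto
        have [measurable]: "p \<in> space (PiM {..<n} (\<lambda>_. borel))" "q \<in> space (PiM {..<n} (\<lambda>_. borel))"
          using pq A T by (auto simp: Rn_def space_PiM)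
        show "{y \<in> Rn n. sqdist_n n y p = sqdist_n n y q} \<in> sets (lebn n)"
          unfolding space_lebn(1)[symmetric] by measurable
      qed
      then show ?thesis by (rule AE_I') (auto simp: space_lebn)
    qed simp
  qed
  then have ae: "AE y in lebn n. (\<Sum>p\<in>A. indicator (voronoi n T p \<inter> Q) y) \<le> (indicator Q y :: ennreal)"
  proof eventually_elim
    case (elim y)
    have "(\<Sum>p\<in>A. indicator (voronoi n T p \<inter> Q) y) = (\<Sum>p\<in>A. if y \<in> voronoi n T p \<inter> Q then 1 else 0 :: ennreal)"
      by (intro sum.cong refl) (simp add: indicator_def)
    also have "\<dots> = (\<Sum>p\<in>{p\<in>A. y \<in> voronoi n T p \<inter> Q}. 1)"
      by (rule sum.inter_filter[OF A(1), symmetric])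
    also have "\<dots> \<le> indicator Q y"
    proof (cases "\<exists>p\<in>A. y \<in> voronoi n T p \<inter> Q")
      case True
      then obtain p where p: "p \<in> A" "y \<in> voronoi n T p \<inter> Q" by auto
      have "{p\<in>A. y \<in> voronoi n T p \<inter> Q} = {p}"
      proof -
        have "q = p" if "q \<in> A" "y \<in> voronoi n T q" for q
        proof (rule ccontr)
          assume "q \<noteq> p"
          moreover have "sqdist_n n y p \<le> sqdist_n n y q" "sqdist_n n y q \<le> sqdist_n n y p"
            using that p A unfolding voronoi_def by blast+
          ultimately show False using bspec[OF bspec[OF elim p(1)] that(1)] by simp
        qed
        then show ?thesis using p by blast
      qed
      then show ?thesis using p by simp
    next
      case False
      then have e: "{p\<in>A. y \<in> voronoi n T p \<inter> Q} = {}" by blast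
      show ?thesis unfolding e by simp
    qed
    finally show ?case .
  qed
  have "(\<Sum>p\<in>A. emeasure (lebn n) (voronoi n T p \<inter> Q)) = (\<integral>\<^sup>+y. (\<Sum>p\<in>A. indicator (voronoi n T p \<inter> Q) y) \<partial>lebn n)"
    using V Q by (subst nn_integral_sum) auto
  also have "\<dots> \<le> (\<integral>\<^sup>+y. indicator Q y \<partial>lebn n)" by (rule nn_integral_mono_AE[OF ae])
  also have "\<dots> = emeasure (lebn n) Q" using Q by simp
  finally show ?thesis .
qed

definition box :: "nat \<Rightarrow> (nat \<Rightarrow> real) \<Rightarrow> (nat \<Rightarrow> real) set" where
  "box n b = PiE {..<n} (\<lambda>i. {- b i<..<b i})"

lemma sets_box: "box n b \<in> sets (lebn n)"
  unfolding box_def by (intro sets_PiM_I_finite) auto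

lemma mem_box: "x \<in> box n b \<longleftrightarrow> x \<in> Rn n \<and> (\<forall>i<n. \<bar>x i\<bar> < b i)"
proof -
  have "x i \<in> {- b i<..<b i} \<longleftrightarrow> \<bar>x i\<bar> < b i" for i by auto
  then show ?thesis unfolding box_def Rn_def PiE_iff by (simp only: lessThan_iff UNIV_I) blast
qed

lemma emeasure_box:
  assumes "\<And>i. i < n \<Longrightarrow> 0 \<le> b i"
  shows "emeasure (lebn n) (box n b) = ennreal (\<Prod>i<n. 2 * b i)"
proof -
  have "emeasure (lebn n) (box n b) = (\<Prod>i<n. ennreal (2 * b i))"
    unfolding box_def using assms by (subst lebn.emeasure_PiM) (auto intro!: prod.cong)
  also have "\<dots> = ennreal (\<Prod>i<n. 2 * b i)"
    using assms by (intro prod_ennreal) auto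
  finally show ?thesis .
qed

lemma received_points:
  assumes h: "\<And>i. i < n \<Longrightarrow> 0 < h i" and S: "S \<subseteq> Rn n"
  shows "hmul n h ` S \<inter> hmul n h ` cube n a = hmul n h ` (S \<inter> cube n a)" "inj_on (hmul n h) S"
    "hmul n h ` cube n a \<subseteq> box n (\<lambda>i. h i * a / 2)"
proof -
  have inj: "inj_on (hmul n h) (Rn n)"
  proof (rule inj_onI)
    fix x y assume xy: "x \<in> Rn n" "y \<in> Rn n" and eq: "hmul n h x = hmul n h y"
    from xy show "x = y"
    proof (rule Rn_eqI)
      fix i assume "i < n"
      then show "x i = y i" using fun_cong[OF eq, of i] h[of i] by (simp add: hmul_def)
    qed
  qed
  show "inj_on (hmul n h) S" using inj S by (rule inj_on_subset)
  show "hmul n h ` S \<inter> hmul n h ` cube n a = hmul n h ` (S \<inter> cube n a)"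
    using inj_on_image_Int[OF inj S, of "cube n a"] by (auto simp: cube_def)
  show "hmul n h ` cube n a \<subseteq> box n (\<lambda>i. h i * a / 2)"
  proof
    fix y assume "y \<in> hmul n h ` cube n a"
    then obtain x where x: "x \<in> cube n a" "y = hmul n h x" by auto
    have "\<bar>h i * x i\<bar> < h i * a / 2" if "i < n" for i
      using x h[OF that] that by (simp add: abs_mult cube_def)
    then show "y \<in> box n (\<lambda>i. h i * a / 2)" using x by (auto simp: mem_box hmul_def Rn_def)
  qed
qed

text \<open>Bounds the probability that the noise carries a point of the faded cube of side
  \<open>a\<close> out of the faded cube of side \<open>a + b\<close>.\<close>

definition noise_tail :: "nat \<Rightarrow> real \<Rightarrow> (nat \<Rightarrow> real) \<Rightarrow> real \<Rightarrow> real" where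
  "noise_tail n v h b = measure (noiseM n v) {z \<in> space (lebn n). \<exists>i<n. h i * b / 2 \<le> \<bar>z i\<bar>}"

lemma noise_tail_tendsto:
  assumes v: "v > 0" and h: "\<And>i. i < n \<Longrightarrow> 0 < h i"
  shows "(\<lambda>k::nat. noise_tail n v h (real k)) \<longlonglongrightarrow> 0"
proof -
  interpret N: prob_space "noiseM n v" by (rule prob_space_noiseM[OF v])
  let ?D = "\<lambda>k::nat. {z \<in> space (lebn n). \<exists>i<n. h i * real k / 2 \<le> \<bar>z i\<bar>}"
  have m: "range ?D \<subseteq> sets (noiseM n v)"
  proof safe
    fix k
    show "?D k \<in> sets (noiseM n v)" unfolding sets_noise_lebn by measurable
  qed
  have dec: "decseq ?D"
  proof (rule decseq_SucI, safe)
    fix k z i assume "i < n" and *: "h i * real (Suc k) / 2 \<le> \<bar>z i\<bar>"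
    have "h i * real k / 2 \<le> h i * real (Suc k) / 2" using h[OF \<open>i < n\<close>] by simp
    then show "\<exists>i<n. h i * real k / 2 \<le> \<bar>z i\<bar>" using * \<open>i < n\<close> by (intro exI[of _ i]) linarith
  qed
  have "(\<Inter>k. ?D k) = {}"
  proof (safe, goal_cases)
    case (1 z)
    obtain k :: nat where k: "(\<Sum>i<n. 2 * \<bar>z i\<bar> / h i) < real k" using reals_Archimedean2 by blast
    from 1 have "z \<in> ?D k" by blast
    then obtain i where i: "i < n" "h i * real k / 2 \<le> \<bar>z i\<bar>" by auto
    have "2 * \<bar>z i\<bar> / h i \<le> (\<Sum>i<n. 2 * \<bar>z i\<bar> / h i)"
      using i h by (intro member_le_sum) (auto intro!: divide_nonneg_pos)
    with k have "2 * \<bar>z i\<bar> / h i < real k" by linarith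
    then have False using i h[of i] by (simp add: field_simps)
    then show ?case ..
  qed
  then show ?thesis using N.finite_Lim_measure_decseq[OF m dec] by (simp add: noise_tail_def)
qed

text \<open>\<open>noise_ball_optimal\<close> is applied to each cell cut to the box
  \<open>Q\<close> and summed: being linear in the volume, it needs only the total volume of the cut
  cells, which is at most that of \<open>Q\<close>. The cut is made because a cell may be unbounded;
  the noise that leaves \<open>Q\<close> is charged to \<open>noise_tail\<close>.\<close>

lemma correct_sum_le:
  assumes v: "v > 0" and S: "countable S" "S \<subseteq> Rn n" and h: "\<And>i. i < n \<Longrightarrow> 0 < h i"
    and fin: "finite (S \<inter> cube n a)" and ab: "a > 0" "b > 0" and r: "r > 0"
  shows "(\<Sum>p\<in>hmul n h ` (S \<inter> cube n a). 1 - perr n v (hmul n h ` S) p)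
    \<le> card (S \<inter> cube n a) * (measure (noiseM n v) (ball0 n r) - gauss_radial n v (r\<^sup>2) * (unit_ball_vol n * r ^ n) + noise_tail n v h b)
     + gauss_radial n v (r\<^sup>2) * ((\<Prod>i<n. h i) * (a + b) ^ n)"
proof -
  interpret N: prob_space "noiseM n v" by (rule prob_space_noiseM[OF v])
  let ?T = "hmul n h ` S" and ?A = "hmul n h ` (S \<inter> cube n a)" and ?\<phi> = "gauss_radial n v (r\<^sup>2)"
  let ?Q = "box n (\<lambda>i. h i * (a + b) / 2)"
  have T: "countable ?T" "?T \<subseteq> Rn n" using S by auto
  have A: "finite ?A" "?A \<subseteq> ?T" using fin by auto
  have card: "card ?A = card (S \<inter> cube n a)"
    using received_points(2)[OF h S(2)] by (intro card_image) (auto simp: inj_on_def)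
  have Qm: "?Q \<in> sets (lebn n)" by (rule sets_box)
  have Qv: "emeasure (lebn n) ?Q = ennreal ((\<Prod>i<n. h i) * (a + b) ^ n)"
  proof -
    have "emeasure (lebn n) ?Q = ennreal (\<Prod>i<n. 2 * (h i * (a + b) / 2))"
      using h ab by (intro emeasure_box) (simp add: less_imp_le)
    then show ?thesis by (simp add: prod.distrib)
  qed
  define w where "w p = measure (lebn n) (voronoi n ?T p \<inter> ?Q)" for p
  have wfin: "emeasure (lebn n) (voronoi n ?T p \<inter> ?Q) = ennreal (w p)" for p
  proof -
    have "emeasure (lebn n) (voronoi n ?T p \<inter> ?Q) \<le> emeasure (lebn n) ?Q"
      using Qm by (intro emeasure_mono) auto
    then show ?thesis unfolding w_def using Qv by (intro emeasure_eq_ennreal_measure) (auto simp: top_unique)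
  qed
  have wsum: "(\<Sum>p\<in>?A. w p) \<le> (\<Prod>i<n. h i) * (a + b) ^ n"
  proof -
    have "ennreal (\<Sum>p\<in>?A. w p) = (\<Sum>p\<in>?A. emeasure (lebn n) (voronoi n ?T p \<inter> ?Q))"
      unfolding wfin by (intro sum_ennreal[symmetric]) (simp add: w_def)
    also have "\<dots> \<le> ennreal ((\<Prod>i<n. h i) * (a + b) ^ n)"
      using voronoi_volume_sum[OF T A Qm] unfolding Qv .
    finally show ?thesis
      by (rule ennreal_le_iff[THEN iffD1, rotated]) (use h ab in \<open>auto intro!: mult_nonneg_nonneg prod_nonneg simp: less_imp_le\<close>)
  qed
  have one: "1 - perr n v ?T p \<le> measure (noiseM n v) (ball0 n r) - ?\<phi> * (unit_ball_vol n * r ^ n) + noise_tail n v h b + ?\<phi> * w p"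
    if p: "p \<in> ?A" for p
  proof -
    have pR: "p \<in> Rn n" using p by auto
    have Vm: "voronoi n ?T p \<in> sets (lebn n)" by (rule sets_voronoi[OF T pR])
    let ?C = "{z \<in> space (lebn n). vadd n p z \<in> voronoi n ?T p}"
    let ?B = "{z \<in> space (lebn n). vadd n p z \<in> voronoi n ?T p \<inter> ?Q}"
    let ?D = "{z \<in> space (lebn n). \<exists>i<n. h i * b / 2 \<le> \<bar>z i\<bar>}"
    have Bm: "?B \<in> sets (lebn n)" "?D \<in> sets (lebn n)"
      using Vm Qm measurable_vadd[OF pR] by measurable
    have sub: "?C \<subseteq> ?B \<union> ?D"
    proof
      fix z assume z: "z \<in> ?C"
      have pb: "p \<in> box n (\<lambda>i. h i * a / 2)" using p received_points(3)[of n h S a, OF h S(2)] by blast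
      show "z \<in> ?B \<union> ?D"
      proof (cases "z \<in> ?D")
        case False
        have "vadd n p z \<in> ?Q" unfolding mem_box
        proof (intro conjI allI impI)
          fix i assume i: "i < n"
          then have "\<bar>z i\<bar> < h i * b / 2" using False z by auto
          moreover have "\<bar>p i\<bar> < h i * a / 2" using pb i by (auto simp: mem_box)
          moreover have "h i * (a + b) / 2 = h i * a / 2 + h i * b / 2" by (simp add: field_simps)
          ultimately show "\<bar>vadd n p z i\<bar> < h i * (a + b) / 2" using i abs_triangle_ineq[of "p i" "z i"] by (simp add: vadd_def)
        qed simp
        then show ?thesis using z by auto
      qed simp
    qed
    have "1 - perr n v ?T p = measure (noiseM n v) ?C" using perr_eq[OF v T pR] by simp
    also have "\<dots> \<le> measure (noiseM n v) (?B \<union> ?D)"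
      using sub Bm by (intro N.finite_measure_mono) (auto simp: sets_noise_lebn)
    also have "\<dots> \<le> measure (noiseM n v) ?B + noise_tail n v h b"
      unfolding noise_tail_def using Bm by (intro measure_Un_le) (auto simp: sets_noise_lebn)
    also have "measure (noiseM n v) ?B \<le> measure (noiseM n v) (ball0 n r) - ?\<phi> * (unit_ball_vol n * r ^ n) + ?\<phi> * w p"
    proof -
      have "emeasure (lebn n) ?B = ennreal (w p)"
        unfolding wfin[symmetric] using Vm Qm by (intro emeasure_lebn_translate) auto
      then have "ennreal (measure (noiseM n v) ?B) + ennreal ?\<phi> * ennreal (unit_ball_vol n * r ^ n)
         \<le> ennreal (measure (noiseM n v) (ball0 n r)) + ennreal ?\<phi> * ennreal (w p)"
        using noise_ball_optimal[OF v Bm(1), of r] emeasure_ball0[OF r] by (simp add: N.emeasure_eq_measure)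
      then have "ennreal (measure (noiseM n v) ?B + ?\<phi> * (unit_ball_vol n * r ^ n)) \<le> ennreal (measure (noiseM n v) (ball0 n r) + ?\<phi> * w p)"
        using v r by (simp add: ennreal_mult w_def)
      then have "measure (noiseM n v) ?B + ?\<phi> * (unit_ball_vol n * r ^ n) \<le> measure (noiseM n v) (ball0 n r) + ?\<phi> * w p"
        using v by (subst (asm) ennreal_le_iff) (auto simp: w_def)
      then show ?thesis by simp
    qed
    finally show ?thesis by simp
  qed
  have "(\<Sum>p\<in>?A. 1 - perr n v ?T p) \<le> (\<Sum>p\<in>?A. measure (noiseM n v) (ball0 n r) - ?\<phi> * (unit_ball_vol n * r ^ n) + noise_tail n v h b + ?\<phi> * w p)"
    by (intro sum_mono one)
  also have "\<dots> = card ?A * (measure (noiseM n v) (ball0 n r) - ?\<phi> * (unit_ball_vol n * r ^ n) + noise_tail n v h b) + ?\<phi> * (\<Sum>p\<in>?A. w p)"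
    by (simp add: sum.distrib sum_distrib_left)
  also have "\<dots> \<le> card ?A * (measure (noiseM n v) (ball0 n r) - ?\<phi> * (unit_ball_vol n * r ^ n) + noise_tail n v h b) + ?\<phi> * ((\<Prod>i<n. h i) * (a + b) ^ n)"
    using v by (intro add_left_mono mult_left_mono wsum) auto
  finally show ?thesis unfolding card .
qed

lemma cube_mono: "a \<le> b \<Longrightarrow> cube n a \<subseteq> cube n b"
  by (force simp: cube_def)

text \<open>One cube with infinitely many points makes the count infinite in every larger cube,
  hence the density infinite.\<close>

lemma finite_cube:
  assumes "dens n S < \<infinity>"
  shows "finite (S \<inter> cube n a)"
proof (rule ccontr)
  assume inf: "infinite (S \<inter> cube n a)"
  have "eventually (\<lambda>b. npts (S \<inter> cube n b) / ereal (b ^ n) = \<infinity>) at_top"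
    using eventually_ge_at_top[of "max a 1"]
  proof eventually_elim
    case (elim b)
    then have "S \<inter> cube n a \<subseteq> S \<inter> cube n b" using cube_mono[of a b n] by auto
    then have "infinite (S \<inter> cube n b)" using inf finite_subset by blast
    moreover have "b ^ n > 0" using elim by simp
    ultimately show ?case by (simp add: npts_def divide_ereal_def)
  qed
  then have "dens n S = Limsup at_top (\<lambda>b::real. \<infinity>)"
    unfolding dens_def by (intro Limsup_eq)
  then show False using assms by (simp add: Limsup_const)
qed

lemma frequently_dens:
  assumes "dens n S = ereal \<gamma>" "g < \<gamma>"
  shows "frequently (\<lambda>a. g < real (card (S \<inter> cube n a)) / a ^ n) at_top"
proof (rule ccontr)
  assume "\<not> ?thesis"
  then have "eventually (\<lambda>a. \<not> g < real (card (S \<inter> cube n a)) / a ^ n) at_top"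
    by (simp add: frequently_def)
  then have "eventually (\<lambda>a. npts (S \<inter> cube n a) / ereal (a ^ n) \<le> ereal g) at_top"
    using eventually_gt_at_top[of 0]
  proof eventually_elim
    case (elim a)
    have "finite (S \<inter> cube n a)" by (rule finite_cube) (simp add: assms)
    then show ?case using elim by (simp add: npts_def not_less)
  qed
  then have "dens n S \<le> ereal g" unfolding dens_def by (rule Limsup_bounded)
  then show False using assms by simp
qed

lemma avg_err_eq:
  assumes h: "\<And>i. i < n \<Longrightarrow> 0 < h i" and S: "S \<subseteq> Rn n"
  shows "avg_err n v S h a = (\<Sum>p\<in>hmul n h ` (S \<inter> cube n a). perr n v (hmul n h ` S) p) / card (S \<inter> cube n a)"
proof -
  have "card (hmul n h ` (S \<inter> cube n a)) = card (S \<inter> cube n a)"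
    using received_points(2)[of n h S, OF h S] by (intro card_image) (auto simp: inj_on_def)
  moreover have "hmul n h ` S \<inter> hmul n h ` cube n a = hmul n h ` (S \<inter> cube n a)"
    by (rule received_points(1)) (use h S in auto)
  ultimately show ?thesis by (simp add: avg_err_def)
qed

lemma avg_err_bounds: "v > 0 \<Longrightarrow> 0 \<le> avg_err n v S h a" "v > 0 \<Longrightarrow> avg_err n v S h a \<le> 1"
proof -
  assume v: "v > 0"
  show "0 \<le> avg_err n v S h a" unfolding avg_err_def Let_def
    by (intro divide_nonneg_nonneg sum_nonneg perr_bounds v) auto
  have "(\<Sum>p\<in>A. perr n v T p) \<le> card A" for A T
    using sum_bounded_above[of A "perr n v T" 1] perr_bounds(2)[OF v] by auto
  then show "avg_err n v S h a \<le> 1" unfolding avg_err_def Let_def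
    by (auto simp: divide_le_eq_1)
qed

text \<open>\<open>r\<close> is the effective radius: its ball has the faded volume per point. With
  this choice the two volume terms of \<open>correct_sum_le\<close> cancel in the limit, and the
  mass of the ball bounds the mean probability of correct decoding. A smaller limsup is refuted at a
  single large cube size.\<close>

lemma sphere_bound:
  assumes v: "v > 0" and S: "countable S" "S \<subseteq> Rn n" and h: "\<And>i. i < n \<Longrightarrow> 0 < h i"
    and d: "dens n S = ereal \<gamma>" "\<gamma> > 0" and r: "r > 0" "unit_ball_vol n * r ^ n = (\<Prod>i<n. h i) / \<gamma>"
  shows "ereal (1 - measure (noiseM n v) (ball0 n r)) \<le> Limsup at_top (\<lambda>a. ereal (avg_err n v S h a))"
proof (rule ccontr)
  define P where "P = (\<Prod>i<n. h i)"
  define \<phi> where "\<phi> = gauss_radial n v (r\<^sup>2)"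
  define tgt where "tgt = 1 - measure (noiseM n v) (ball0 n r)"
  have P: "P > 0" unfolding P_def using h by (intro prod_pos) auto
  have ph: "\<phi> \<ge> 0" unfolding \<phi>_def using v by simp
  assume "\<not> ?thesis"
  then have "Limsup at_top (\<lambda>a. ereal (avg_err n v S h a)) < ereal tgt" by (simp add: tgt_def)
  then obtain c where c: "Limsup at_top (\<lambda>a. ereal (avg_err n v S h a)) < ereal c" "c < tgt"
    by (metis ereal_dense2 less_ereal.simps(1))
  have ev1: "eventually (\<lambda>a. avg_err n v S h a < c) at_top"
    using Limsup_lessD[OF c(1)] by simp
  \<comment> \<open>A quarter of the gap: \<open>noise_tail\<close> and the volume mismatch each
    cost less than one \<open>\<eta>\<close>, so half of the gap remains for the
    contradiction.\<close>
  define \<eta> where "\<eta> = (tgt - c) / 4"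
  have eta: "\<eta> > 0" using c by (simp add: \<eta>_def)
  have "eventually (\<lambda>k::nat. noise_tail n v h (real k) < \<eta>) sequentially"
    using noise_tail_tendsto[OF v h] eta by (rule order_tendstoD)
  then have "eventually (\<lambda>k::nat. noise_tail n v h (real k) < \<eta> \<and> k > 0) sequentially"
    using eventually_gt_at_top[of 0] by (rule eventually_conj)
  then obtain k :: nat where k: "noise_tail n v h (real k) < \<eta>" "k > 0"
    using eventually_happens trivial_limit_sequentially by blast
  define b where "b = real k"
  have b: "b > 0" "noise_tail n v h b < \<eta>" using k by (auto simp: b_def)
  have "((\<lambda>x. \<phi> * P * ((1 + x) / (\<gamma> - x) - 1 / \<gamma>)) \<longlongrightarrow> \<phi> * P * ((1 + 0) / (\<gamma> - 0) - 1 / \<gamma>)) (at_right 0)"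
    using d by (intro tendsto_intros) auto
  then have "eventually (\<lambda>x. \<phi> * P * ((1 + x) / (\<gamma> - x) - 1 / \<gamma>) < \<eta>) (at_right 0)"
    by (rule order_tendstoD) (use eta in simp)
  then have "eventually (\<lambda>x. \<phi> * P * ((1 + x) / (\<gamma> - x) - 1 / \<gamma>) < \<eta> \<and> 0 < x \<and> x < \<gamma>) (at_right 0)"
    using eventually_at_right_less[of 0] eventually_at_right_real[OF d(2)] by eventually_elim auto
  then obtain x where x: "\<phi> * P * ((1 + x) / (\<gamma> - x) - 1 / \<gamma>) < \<eta>" "0 < x" "x < \<gamma>"
    using eventually_happens trivial_limit_at_right_real by blast
  have "((\<lambda>a. ((a + b) / a) ^ n) \<longlongrightarrow> 1 ^ n) at_top"
  proof (intro tendsto_power)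
    show "((\<lambda>a. (a + b) / a) \<longlongrightarrow> 1) at_top" by real_asymp
  qed
  then have ev2: "eventually (\<lambda>a. ((a + b) / a) ^ n < 1 + x) at_top"
    by (rule order_tendstoD) (use x in simp)
  \<comment> \<open>The density is a limsup and is approached only along some arbitrarily large
    \<open>a\<close>. The assumed bound on the averaged error holds for all large \<open>a\<close>,
    so one \<open>a\<close> serves both.\<close>
  have fr: "frequently (\<lambda>a. \<gamma> - x < real (card (S \<inter> cube n a)) / a ^ n) at_top"
    by (rule frequently_dens[OF d(1)]) (use x in simp)
  have "eventually (\<lambda>a. avg_err n v S h a < c \<and> ((a + b) / a) ^ n < 1 + x \<and> 0 < a) at_top"
    using ev1 ev2 eventually_gt_at_top[of 0] by eventually_elim auto
  then obtain a where a: "\<gamma> - x < real (card (S \<inter> cube n a)) / a ^ n" "avg_err n v S h a < c"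
     "((a + b) / a) ^ n < 1 + x" "0 < a"
    using frequently_ex[OF frequently_eventually_frequently[OF fr]] by blast
  define K where "K = real (card (S \<inter> cube n a))"
  have an: "a ^ n > 0" using a by simp
  have "0 < K / a ^ n" using a x unfolding K_def by linarith
  then have K: "K > 0" using pos_less_divide_eq[OF an, of 0 K] by simp
  have fin: "finite (S \<inter> cube n a)" by (rule finite_cube) (simp add: d)
  let ?A = "hmul n h ` (S \<inter> cube n a)"
  have cardA: "real (card ?A) = K" unfolding K_def
    using received_points(2)[of n h S, OF h S(2)] by (subst card_image) (auto simp: inj_on_def)
  have sum1: "(\<Sum>p\<in>?A. 1 - perr n v (hmul n h ` S) p) = K - (\<Sum>p\<in>?A. perr n v (hmul n h ` S) p)"
    using cardA by (simp add: sum_subtractf)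
  have C: "K - (\<Sum>p\<in>?A. perr n v (hmul n h ` S) p) \<le> K * (1 - tgt - \<phi> * (P / \<gamma>) + noise_tail n v h b) + \<phi> * (P * (a + b) ^ n)"
  proof -
    have "(\<Sum>p\<in>?A. 1 - perr n v (hmul n h ` S) p) \<le> K * (measure (noiseM n v) (ball0 n r) - \<phi> * (unit_ball_vol n * r ^ n) + noise_tail n v h b) + \<phi> * (P * (a + b) ^ n)"
      unfolding K_def \<phi>_def P_def by (rule correct_sum_le[OF v S h fin a(4) b(1) r(1)])
    then show ?thesis unfolding sum1 r(2) by (simp add: tgt_def P_def)
  qed
  have "avg_err n v S h a = (\<Sum>p\<in>?A. perr n v (hmul n h ` S) p) / K"
    unfolding K_def by (rule avg_err_eq[OF h S(2)])
  then have "1 - avg_err n v S h a = (K - (\<Sum>p\<in>?A. perr n v (hmul n h ` S) p)) / K"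
    using K by (simp add: diff_divide_distrib)
  also have "\<dots> \<le> (K * (1 - tgt - \<phi> * (P / \<gamma>) + noise_tail n v h b) + \<phi> * (P * (a + b) ^ n)) / K"
    using K by (intro divide_right_mono C) auto
  also have "\<dots> = 1 - tgt - \<phi> * (P / \<gamma>) + noise_tail n v h b + \<phi> * P * ((a + b) ^ n / K)"
    using K by (simp add: add_divide_distrib)
  also have "(a + b) ^ n / K = ((a + b) / a) ^ n / (K / a ^ n)"
    using a(4) by (simp add: power_divide)
  also have "\<phi> * P * (((a + b) / a) ^ n / (K / a ^ n)) \<le> \<phi> * P * ((1 + x) / (\<gamma> - x))"
    using a b x ph P unfolding K_def by (intro mult_left_mono frac_le) auto
  finally have "1 - avg_err n v S h a \<le> 1 - tgt + noise_tail n v h b + \<phi> * P * ((1 + x) / (\<gamma> - x) - 1 / \<gamma>)"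
    by (simp add: algebra_simps)
  then have "tgt - 2 * \<eta> \<le> avg_err n v S h a" using x b by linarith
  moreover have "tgt = c + 4 * \<eta>" by (simp add: \<eta>_def field_simps)
  ultimately show False using a(2) eta by linarith
qed

section \<open>Measurability and continuity of the error probability\<close>

lemma measurable_hmul_left: "s \<in> Rn n \<Longrightarrow> (\<lambda>h. hmul n h s) \<in> PiM {..<n} (\<lambda>_. borel) \<rightarrow>\<^sub>M PiM {..<n} (\<lambda>_. borel)"
  unfolding hmul_def by measurable

lemma measurable_perr:
  assumes v: "v > 0" and S: "countable S" "S \<subseteq> Rn n" and s: "s \<in> Rn n"
  shows "(\<lambda>h. perr n v (hmul n h ` S) (hmul n h s)) \<in> borel_measurable (PiM {..<n} (\<lambda>_. borel))"
proof -
  interpret N: prob_space "noiseM n v" by (rule prob_space_noiseM[OF v])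
  let ?H = "PiM {..<n} (\<lambda>_. borel :: real measure)"
  let ?E = "{w \<in> space (?H \<Otimes>\<^sub>M noiseM n v). \<not> (\<forall>q\<in>S. sqdist_n n (vadd n (hmul n (fst w) s) (snd w)) (hmul n (fst w) s)
     \<le> sqdist_n n (vadd n (hmul n (fst w) s) (snd w)) (hmul n (fst w) q))}"
  have E: "?E \<in> sets (?H \<Otimes>\<^sub>M noiseM n v)"
  proof (intro sets.sets_Collect_neg sets.sets_Collect_countable_All' S(1))
    fix q assume q: "q \<in> S"
    have [measurable]: "(\<lambda>h. hmul n h s) \<in> ?H \<rightarrow>\<^sub>M ?H" "(\<lambda>h. hmul n h q) \<in> ?H \<rightarrow>\<^sub>M ?H"
      using S q s by (auto intro!: measurable_hmul_left)
    have [measurable]: "(\<lambda>w. vadd n (hmul n (fst w) s) (snd w)) \<in> ?H \<Otimes>\<^sub>M noiseM n v \<rightarrow>\<^sub>M ?H"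
      unfolding vadd_def by measurable
    show "{w \<in> space (?H \<Otimes>\<^sub>M noiseM n v). sqdist_n n (vadd n (hmul n (fst w) s) (snd w)) (hmul n (fst w) s)
     \<le> sqdist_n n (vadd n (hmul n (fst w) s) (snd w)) (hmul n (fst w) q)} \<in> sets (?H \<Otimes>\<^sub>M noiseM n v)"
      by measurable
  qed
  have "(\<lambda>h. emeasure (noiseM n v) (Pair h -` ?E)) \<in> borel_measurable ?H"
    by (rule N.measurable_emeasure_Pair[OF E])
  then have "(\<lambda>h. enn2real (emeasure (noiseM n v) (Pair h -` ?E))) \<in> borel_measurable ?H" by measurable
  moreover have "perr n v (hmul n h ` S) (hmul n h s) = enn2real (emeasure (noiseM n v) (Pair h -` ?E))" if "h \<in> space ?H" for h
  proof -
    have "Pair h -` ?E = {z \<in> space (noiseM n v). vadd n (hmul n h s) z \<notin> voronoi n (hmul n h ` S) (hmul n h s)}"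
      using that by (auto simp: voronoi_def space_pair_measure)
    then show ?thesis by (simp add: perr_def measure_def)
  qed
  ultimately show ?thesis by (subst measurable_cong) auto
qed

text \<open>If some fading coefficients vanish, \<open>hmul n h\<close> merges points. Clearing the
  coordinates outside the support \<open>J\<close> of \<open>h\<close> selects one preimage of each
  received point, which makes the averaged error a sum over a set that depends on \<open>h\<close>
  through \<open>J\<close> only.\<close>

definition zero_off :: "nat \<Rightarrow> nat set \<Rightarrow> (nat \<Rightarrow> real) \<Rightarrow> nat \<Rightarrow> real" where
  "zero_off n J s = (\<lambda>i\<in>{..<n}. if i \<in> J then s i else 0)"

lemma zero_off_Rn [simp]: "zero_off n J s \<in> Rn n"
  by (auto simp: zero_off_def Rn_def)

lemma avg_err_zero_off:
  fixes S :: "(nat \<Rightarrow> real) set"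
  assumes J: "J = {i \<in> {..<n}. h i \<noteq> 0}" and a: "a > 0"
  defines "B \<equiv> zero_off n J ` S \<inter> cube n a"
  shows "avg_err n v S h a = (\<Sum>s\<in>B. perr n v (hmul n h ` S) (hmul n h s)) / card B"
proof -
  have eq: "hmul n h (zero_off n J s) = hmul n h s" for s
    by (auto simp: hmul_def zero_off_def J intro!: restrict_ext)
  have inj: "inj_on (hmul n h) B"
  proof (rule inj_onI)
    fix x y assume xy: "x \<in> B" "y \<in> B" and e: "hmul n h x = hmul n h y"
    then obtain s t where st: "x = zero_off n J s" "y = zero_off n J t" by (auto simp: B_def)
    show "x = y"
    proof (rule Rn_eqI[where n=n])
      fix i assume i: "i < n"
      show "x i = y i" using fun_cong[OF e, of i] i by (auto simp: hmul_def st zero_off_def J)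
    qed (simp_all add: st)
  qed
  have "hmul n h ` S \<inter> hmul n h ` cube n a = hmul n h ` B"
  proof (intro equalityI subsetI)
    fix p assume "p \<in> hmul n h ` S \<inter> hmul n h ` cube n a"
    then obtain s c where sc: "s \<in> S" "p = hmul n h s" "c \<in> cube n a" "p = hmul n h c" by blast
    have e: "s i = c i" if "i \<in> J" for i
      using fun_cong[OF sc(4)[unfolded sc(2)], of i] that by (auto simp: hmul_def J)
    have "zero_off n J s \<in> cube n a"
      using sc(3) a e by (auto simp: cube_def zero_off_def Rn_def)
    then have "zero_off n J s \<in> B" using sc(1) by (auto simp: B_def)
    then show "p \<in> hmul n h ` B" using eq[of s] sc(2) by (metis imageI)
  next
    fix p assume "p \<in> hmul n h ` B"
    then obtain s where "s \<in> S" "zero_off n J s \<in> cube n a" "p = hmul n h (zero_off n J s)" by (auto simp: B_def)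
    then show "p \<in> hmul n h ` S \<inter> hmul n h ` cube n a" using eq[of s] by (metis IntI imageI)
  qed
  then show ?thesis
    using inj by (simp add: avg_err_def sum.reindex card_image)
qed

text \<open>The cubes are open, so the finitely many points inside one stay inside all slightly
  smaller ones; \<open>a0\<close> is twice the largest coordinate modulus that occurs.\<close>

lemma cube_left_constant:
  assumes fin: "finite (B \<inter> cube n a)" and a: "a > 0"
  obtains a0 where "0 \<le> a0" "a0 < a" "\<And>b. a0 < b \<Longrightarrow> b \<le> a \<Longrightarrow> B \<inter> cube n b = B \<inter> cube n a"
proof -
  let ?X = "insert 0 ((\<lambda>(x, i). 2 * \<bar>x i\<bar>) ` ((B \<inter> cube n a) \<times> {..<n}))"
  have fX: "finite ?X" using fin by auto
  have lt: "Max ?X < a" using fX a by (subst Max_less_iff) (auto simp: cube_def)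
  have ge: "0 \<le> Max ?X" using fX by (intro Max_ge) auto
  have "B \<inter> cube n b = B \<inter> cube n a" if b: "Max ?X < b" "b \<le> a" for b
  proof
    show "B \<inter> cube n b \<subseteq> B \<inter> cube n a" using cube_mono[OF b(2)] by auto
    show "B \<inter> cube n a \<subseteq> B \<inter> cube n b"
    proof
      fix x assume x: "x \<in> B \<inter> cube n a"
      have "\<bar>x i\<bar> < b / 2" if "i < n" for i
      proof -
        have "2 * \<bar>x i\<bar> \<le> Max ?X" using x that by (intro Max_ge[OF fX]) force
        then show ?thesis using b by simp
      qed
      then show "x \<in> B \<inter> cube n b" using x by (auto simp: cube_def)
    qed
  qed
  then show thesis by (rule that[OF ge lt])
qed

text \<open>A function that is constant just to the left of every \<open>a\<close> takes the value
  at \<open>a\<close> also at a rational below \<open>a\<close>. The limsup becomes a countable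
  infimum of countable suprema, which preserves measurability in a parameter.\<close>

lemma Limsup_at_top_rational:
  fixes g :: "real \<Rightarrow> ereal"
  assumes "\<And>a. a > 0 \<Longrightarrow> \<exists>a0. 0 \<le> a0 \<and> a0 < a \<and> (\<forall>b. a0 < b \<longrightarrow> b \<le> a \<longrightarrow> g b = g a)"
  shows "Limsup at_top g = (INF N::nat. SUP q\<in>\<rat> \<inter> {real N<..}. g q)"
proof (rule antisym)
  show "Limsup at_top g \<le> (INF N::nat. SUP q\<in>\<rat> \<inter> {real N<..}. g q)"
  proof (rule INF_greatest)
    fix N :: nat
    have "eventually (\<lambda>a. g a \<le> (SUP q\<in>\<rat> \<inter> {real N<..}. g q)) at_top"
      using eventually_gt_at_top[of "real N"]
    proof eventually_elim
      case (elim a)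
      then have "a > 0" by (meson le_less_trans of_nat_0_le_iff)
      then obtain a0 where a0: "a0 < a" "\<And>b. a0 < b \<Longrightarrow> b \<le> a \<Longrightarrow> g b = g a" using assms[of a] by blast
      obtain q where q: "q \<in> \<rat>" "max a0 (real N) < q" "q < a"
        using Rats_dense_in_real[of "max a0 (real N)" a] a0 elim by auto
      then have "g a = g q" using a0(2)[of q] by simp
      also have "\<dots> \<le> (SUP q\<in>\<rat> \<inter> {real N<..}. g q)" using q by (intro SUP_upper) auto
      finally show ?case .
    qed
    then show "Limsup at_top g \<le> (SUP q\<in>\<rat> \<inter> {real N<..}. g q)" by (rule Limsup_bounded)
  qed
  show "(INF N::nat. SUP q\<in>\<rat> \<inter> {real N<..}. g q) \<le> Limsup at_top g"
    unfolding Limsup_def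
  proof (rule INF_greatest)
    fix P :: "real \<Rightarrow> bool" assume "P \<in> {P. eventually P at_top}"
    then obtain x where x: "\<And>y. x \<le> y \<Longrightarrow> P y" unfolding mem_Collect_eq eventually_at_top_linorder by blast
    obtain N :: nat where N: "x < real N" using reals_Archimedean2 by blast
    have "(INF N::nat. SUP q\<in>\<rat> \<inter> {real N<..}. g q) \<le> (SUP q\<in>\<rat> \<inter> {real N<..}. g q)" by (rule INF_lower) simp
    also have "\<dots> \<le> (SUP x\<in>{x. P x}. g x)" using N by (intro SUP_subset_mono) (auto intro!: x)
    finally show "(INF N::nat. SUP q\<in>\<rat> \<inter> {real N<..}. g q) \<le> (SUP x\<in>{x. P x}. g x)" .
  qed
qed

definition limsup_err :: "nat \<Rightarrow> real \<Rightarrow> (nat \<Rightarrow> real) set \<Rightarrow> (nat \<Rightarrow> real) \<Rightarrow> real" where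
  "limsup_err n v S h = real_of_ereal (Limsup at_top (\<lambda>a::real. ereal (avg_err n v S h a)))"

lemma limsup_err_ereal:
  assumes v: "v > 0"
  shows "Limsup at_top (\<lambda>a::real. ereal (avg_err n v S h a)) = ereal (limsup_err n v S h)"
    "0 \<le> limsup_err n v S h" "limsup_err n v S h \<le> 1"
proof -
  let ?L = "Limsup at_top (\<lambda>a::real. ereal (avg_err n v S h a))"
  have 1: "?L \<le> 1" by (rule Limsup_bounded) (simp add: avg_err_bounds[OF v] one_ereal_def)
  have "0 \<le> Liminf at_top (\<lambda>a::real. ereal (avg_err n v S h a))"
    by (rule Liminf_bounded) (simp add: avg_err_bounds[OF v])
  also have "\<dots> \<le> ?L" by (rule Liminf_le_Limsup) simp
  finally have 0: "0 \<le> ?L" .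
  show "?L = ereal (limsup_err n v S h)" "0 \<le> limsup_err n v S h" "limsup_err n v S h \<le> 1"
    unfolding limsup_err_def using 0 1 by (cases ?L; auto simp: one_ereal_def)+
qed

text \<open>Split by the support of \<open>h\<close>, which has finitely many possible values. On
  each part the averaged error runs over a set of points that does not depend on \<open>h\<close>,
  so it is measurable for each \<open>a\<close>, and the limsup reduces to rational
  \<open>a\<close>.\<close>

lemma measurable_limsup_err:
  assumes v: "v > 0" and S: "countable S" "S \<subseteq> Rn n"
  shows "limsup_err n v S \<in> borel_measurable (PiM {..<n} (\<lambda>_. borel))"
proof -
  let ?H = "PiM {..<n} (\<lambda>_. borel :: real measure)"
  define F where "F J h a = (\<Sum>s\<in>zero_off n J ` S \<inter> cube n a. perr n v (hmul n h ` S) (hmul n h s)) / card (zero_off n J ` S \<inter> cube n a)" for J h a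
  define L where "L J h = real_of_ereal (Limsup at_top (\<lambda>a::real. ereal (F J h a)))" for J h
  have Fm: "(\<lambda>h. F J h a) \<in> borel_measurable ?H" for J a
    unfolding F_def by (intro borel_measurable_divide borel_measurable_sum measurable_perr v S) auto
  have Lm: "L J \<in> borel_measurable ?H" for J
  proof (cases "\<forall>a. finite (zero_off n J ` S \<inter> cube n a)")
    case True
    have "L J h = real_of_ereal (INF N::nat. SUP q\<in>\<rat> \<inter> {real N<..}. ereal (F J h q))" for h
    proof -
      have "Limsup at_top (\<lambda>a::real. ereal (F J h a)) = (INF N::nat. SUP q\<in>\<rat> \<inter> {real N<..}. ereal (F J h q))"
      proof (rule Limsup_at_top_rational)
        fix a :: real assume a: "a > 0"
        obtain a0 where "0 \<le> a0" "a0 < a" "\<And>b. a0 < b \<Longrightarrow> b \<le> a \<Longrightarrow> zero_off n J ` S \<inter> cube n b = zero_off n J ` S \<inter> cube n a"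
          using cube_left_constant[OF True[rule_format] a] by blast
        then show "\<exists>a0. 0 \<le> a0 \<and> a0 < a \<and> (\<forall>b. a0 < b \<longrightarrow> b \<le> a \<longrightarrow> ereal (F J h b) = ereal (F J h a))"
          unfolding F_def by metis
      qed
      then show ?thesis by (simp add: L_def)
    qed
    moreover have "(\<lambda>h. real_of_ereal (INF N::nat. SUP q\<in>\<rat> \<inter> {real N<..}. ereal (F J h q))) \<in> borel_measurable ?H"
    proof -
      have "(\<lambda>h. INF N::nat. SUP q\<in>\<rat> \<inter> {real N<..}. ereal (F J h q)) \<in> borel_measurable ?H"
        by (intro borel_measurable_INF borel_measurable_SUP borel_measurable_ereal Fm countable_Int1 countable_rat) auto
      then show ?thesis by measurable
    qed
    ultimately show ?thesis by (simp add: fun_eq_iff cong: measurable_cong)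
  next
    case False
    then obtain a0 where a0: "infinite (zero_off n J ` S \<inter> cube n a0)" by auto
    \<comment> \<open>From \<open>a0\<close> on the index set is infinite, so both the sum and the
      cardinality take their default value 0.\<close>
    have "L J h = 0" for h
    proof -
      have "eventually (\<lambda>a. ereal (F J h a) = 0) at_top"
        using eventually_ge_at_top[of a0]
      proof eventually_elim
        case (elim a)
        then have "zero_off n J ` S \<inter> cube n a0 \<subseteq> zero_off n J ` S \<inter> cube n a" using cube_mono by blast
        then have "infinite (zero_off n J ` S \<inter> cube n a)" using a0 finite_subset by blast
        then show ?case by (simp add: F_def)
      qed
      then have "Limsup at_top (\<lambda>a::real. ereal (F J h a)) = Limsup at_top (\<lambda>a::real. 0)" by (rule Limsup_eq)
      then show ?thesis by (simp add: L_def Limsup_const)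
    qed
    then show ?thesis by (simp add: fun_eq_iff cong: measurable_cong)
  qed
  \<comment> \<open>Exactly one \<open>J\<close> is the support of \<open>h\<close>, so a single
    term of this finite sum is active.\<close>
  have "limsup_err n v S h = (\<Sum>J\<in>Pow {..<n}. if {i \<in> {..<n}. h i \<noteq> 0} = J then L J h else 0)" for h
  proof -
    define J where "J = {i \<in> {..<n}. h i \<noteq> 0}"
    have "eventually (\<lambda>a. ereal (avg_err n v S h a) = ereal (F J h a)) at_top"
      using eventually_gt_at_top[of 0] by eventually_elim (simp add: F_def avg_err_zero_off[OF J_def])
    then have "limsup_err n v S h = L J h" unfolding limsup_err_def L_def by (subst Limsup_eq) auto
    also have "\<dots> = (\<Sum>J'\<in>Pow {..<n}. if J = J' then L J' h else 0)"
      by (subst sum.delta') (auto simp: J_def)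
    finally show ?thesis unfolding J_def .
  qed
  moreover have "(\<lambda>h. \<Sum>J\<in>Pow {..<n}. if {i \<in> {..<n}. h i \<noteq> 0} = J then L J h else 0) \<in> borel_measurable ?H"
  proof (intro borel_measurable_sum measurable_If Lm)
    fix J assume J: "J \<in> Pow {..<n}"
    have "{h \<in> space ?H. {i \<in> {..<n}. h i \<noteq> 0} = J} = {h \<in> space ?H. \<forall>i\<in>{..<n}. (h i \<noteq> 0) = (i \<in> J)}"
      using J by blast
    also have "\<dots> \<in> sets ?H" by measurable
    finally show "{h \<in> space ?H. {i \<in> {..<n}. h i \<noteq> 0} = J} \<in> sets ?H" .
  qed simp
  ultimately show ?thesis by (simp cong: measurable_cong add: fun_eq_iff[symmetric])
qed

text \<open>From the larger variance \<open>w\<close> to \<open>v\<close> the prefactor of the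
  density grows by \<open>c = (sqrt (w / v)) ^ n\<close> while the exponential only decreases, so
  the measure at \<open>v\<close> is at most \<open>c\<close> times that at \<open>w\<close>. Using
  this for a set and for its complement bounds the difference in both directions.\<close>

lemma noise_variance_ratio:
  assumes v: "0 < v" "v \<le> w"
  shows "\<bar>measure (noiseM n v) B - measure (noiseM n w) B\<bar> \<le> (sqrt (w / v)) ^ n - 1"
proof -
  interpret V: prob_space "noiseM n v" using v by (intro prob_space_noiseM) auto
  interpret W: prob_space "noiseM n w" using v by (intro prob_space_noiseM) auto
  define c where "c = (sqrt (w / v)) ^ n"
  have c: "c \<ge> 1" unfolding c_def using v by (intro one_le_power) simp
  have le: "measure (noiseM n v) B - measure (noiseM n w) B \<le> c - 1" if B: "B \<in> sets (lebn n)" for B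
  proof -
    have g: "gauss n v z \<le> c * gauss n w z" for z
    proof -
      define t where "t = (\<Sum>i<n. (z i)\<^sup>2)"
      have t: "t \<ge> 0" unfolding t_def by (intro sum_nonneg) auto
      have "(1 / sqrt (2 * pi * v)) ^ n = c * (1 / sqrt (2 * pi * w)) ^ n"
        using v by (simp add: c_def power_mult_distrib[symmetric] real_sqrt_divide real_sqrt_mult mult_ac)
      moreover have "exp (- t / (2 * v)) \<le> exp (- t / (2 * w))"
        using v t by (simp add: divide_left_mono frac_le)
      ultimately show ?thesis
        using v c by (simp add: gauss_eq gauss_radial_def t_def[symmetric] mult.assoc mult_left_mono)
    qed
    have "ennreal (measure (noiseM n v) B) \<le> ennreal (c * measure (noiseM n w) B)"
    proof -
      have "emeasure (noiseM n v) B \<le> (\<integral>\<^sup>+z. ennreal c * (ennreal (gauss n w z) * indicator B z) \<partial>lebn n)"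
        unfolding emeasure_noiseM[OF v(1) B]
      proof (intro nn_integral_mono)
        fix z
        show "ennreal (gauss n v z) * indicator B z \<le> ennreal c * (ennreal (gauss n w z) * indicator B z)"
          using g[of z] c by (auto simp: indicator_def ennreal_mult[symmetric] intro!: ennreal_leI)
      qed
      also have "\<dots> = ennreal c * emeasure (noiseM n w) B"
        using v B by (subst nn_integral_cmult) (auto simp: emeasure_noiseM)
      finally show ?thesis using c by (simp add: V.emeasure_eq_measure W.emeasure_eq_measure ennreal_mult)
    qed
    then have "measure (noiseM n v) B \<le> c * measure (noiseM n w) B"
      using c by (subst (asm) ennreal_le_iff) auto
    also have "c * measure (noiseM n w) B \<le> measure (noiseM n w) B + (c - 1)"
      using c mult_left_mono[OF W.prob_le_1[of B], of "c - 1"] by (simp add: algebra_simps)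
    finally show ?thesis by simp
  qed
  show ?thesis
  proof (cases "B \<in> sets (lebn n)")
    case True
    have "measure (noiseM n v) (space (noiseM n v) - B) - measure (noiseM n w) (space (noiseM n w) - B) \<le> c - 1"
      using le[of "Rn n - B"] True sets.compl_sets[OF True] by (simp add: space_lebn)
    then have "measure (noiseM n w) B - measure (noiseM n v) B \<le> c - 1"
      using True by (subst (asm) V.prob_compl, simp add: sets_noise_lebn, subst (asm) W.prob_compl) (auto simp: sets_noise_lebn)
    with le[OF True] show ?thesis by (simp add: c_def)
  next
    case False
    then show ?thesis using c by (simp add: measure_notin_sets sets_noise_lebn c_def)
  qed
qed

text \<open>The variance bound is the same for all points and all fading vectors, so it survives the
  averaging and the limsup here, and the expectation in \<open>Pe_continuous\<close>.\<close>

lemma limsup_err_variance: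
  assumes v: "0 < v" "v \<le> w"
  shows "\<bar>limsup_err n v S h - limsup_err n w S h\<bar> \<le> (sqrt (w / v)) ^ n - 1"
proof -
  define \<kappa> where "\<kappa> = (sqrt (w / v)) ^ n - 1"
  have p: "\<bar>perr n v T p - perr n w T p\<bar> \<le> \<kappa>" for T p
    using noise_variance_ratio[OF v] unfolding perr_def space_lebn \<kappa>_def by blast
  have k0: "\<kappa> \<ge> 0" using order_trans[OF abs_ge_zero p] .
  have a: "\<bar>avg_err n v S h a - avg_err n w S h a\<bar> \<le> \<kappa>" for a
  proof -
    define T where "T = hmul n h ` S"
    define A where "A = T \<inter> hmul n h ` cube n a"
    have "\<bar>(\<Sum>p\<in>A. perr n v T p) - (\<Sum>p\<in>A. perr n w T p)\<bar> \<le> (\<Sum>p\<in>A. \<bar>perr n v T p - perr n w T p\<bar>)"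
      unfolding sum_subtractf[symmetric] by (rule sum_abs)
    also have "\<dots> \<le> card A * \<kappa>" using p by (intro sum_bounded_above) auto
    finally have "\<bar>(\<Sum>p\<in>A. perr n v T p) - (\<Sum>p\<in>A. perr n w T p)\<bar> \<le> card A * \<kappa>" .
    then have "\<bar>((\<Sum>p\<in>A. perr n v T p) - (\<Sum>p\<in>A. perr n w T p)) / card A\<bar> \<le> \<kappa>"
      using k0 by (cases "card A = 0") (auto simp: field_simps abs_divide)
    then show ?thesis unfolding avg_err_def Let_def T_def[symmetric] A_def[symmetric] by (simp add: diff_divide_distrib)
  qed
  have gen: "limsup_err n x S h \<le> limsup_err n y S h + \<kappa>" if x: "x > 0" and y: "y > 0"
    and le: "\<And>a. avg_err n x S h a \<le> avg_err n y S h a + \<kappa>" for x y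
  proof -
    have "ereal (limsup_err n x S h) \<le> Limsup at_top (\<lambda>a::real. ereal (avg_err n y S h a) + ereal \<kappa>)"
      unfolding limsup_err_ereal(1)[OF x, symmetric] by (intro Limsup_mono always_eventually allI) (simp add: le)
    also have "\<dots> = ereal (limsup_err n y S h) + ereal \<kappa>"
      by (subst Limsup_add_ereal_right) (auto simp: limsup_err_ereal(1)[OF y])
    finally show ?thesis by simp
  qed
  have le1: "avg_err n v S h a \<le> avg_err n w S h a + \<kappa>" and le2: "avg_err n w S h a \<le> avg_err n v S h a + \<kappa>" for a
    using a[of a] by linarith+
  have "limsup_err n v S h \<le> limsup_err n w S h + \<kappa>" by (rule gen[OF _ _ le1]) (use v in auto)
  moreover have "limsup_err n w S h \<le> limsup_err n v S h + \<kappa>" by (rule gen[OF _ _ le2]) (use v in auto)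
  ultimately show ?thesis unfolding \<kappa>_def by linarith
qed

lemma Pe_eq: "Pe f n S v = (\<integral>h. limsup_err n v S h \<partial>fadingVecM f n)"
  by (simp add: Pe_def limsup_err_def)

context
  fixes f :: "real \<Rightarrow> real"
  assumes f: "regular_fading f"
begin

lemma integrable_limsup_err:
  assumes v: "v > 0" and S: "IC n S"
  shows "integrable (fadingVecM f n) (limsup_err n v S)"
proof -
  interpret F: prob_space "fadingVecM f n" by (rule prob_space_fadingVecM[OF f])
  have "limsup_err n v S \<in> borel_measurable (fadingVecM f n)"
    unfolding measurable_cong_sets[OF sets_fadingVecM[OF f] refl]
    by (rule measurable_limsup_err[OF v]) (use S in \<open>auto simp: IC_def\<close>)
  then show ?thesis
    by (intro F.integrable_const_bound[of _ 1]) (auto simp: limsup_err_ereal[OF v])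
qed

lemma Pe_continuous:
  assumes S: "IC n S"
  shows "continuous_on {0<..} (Pe f n S)"
proof -
  interpret F: prob_space "fadingVecM f n" by (rule prob_space_fadingVecM[OF f])
  have bound: "\<bar>Pe f n S v - Pe f n S w\<bar> \<le> (sqrt (w / v)) ^ n - 1" if v: "0 < v" "v \<le> w" for v w
  proof -
    note i = integrable_limsup_err[OF _ S]
    have "\<bar>Pe f n S v - Pe f n S w\<bar> = \<bar>\<integral>h. limsup_err n v S h - limsup_err n w S h \<partial>fadingVecM f n\<bar>"
      using i[of v] i[of w] v by (simp add: Pe_eq)
    also have "\<dots> \<le> (\<integral>h. \<bar>limsup_err n v S h - limsup_err n w S h\<bar> \<partial>fadingVecM f n)"
      by (rule integral_abs_bound)
    also have "\<dots> \<le> (\<integral>h. (sqrt (w / v)) ^ n - 1 \<partial>fadingVecM f n)"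
      using i[of v] i[of w] v by (intro integral_mono limsup_err_variance) auto
    also have "\<dots> = (sqrt (w / v)) ^ n - 1" by (simp add: F.prob_space)
    finally show ?thesis .
  qed
  show ?thesis
  proof (subst continuous_on_eq_continuous_at[OF open_greaterThan], intro ballI)
    fix v :: real assume "v \<in> {0<..}"
    then have v: "v > 0" by simp
    have "((\<lambda>w. (sqrt (max w v / min w v)) ^ n - 1) \<longlongrightarrow> (sqrt (max v v / min v v)) ^ n - 1) (at v)"
      using v by (intro tendsto_intros) auto
    then have lim: "((\<lambda>w. (sqrt (max w v / min w v)) ^ n - 1) \<longlongrightarrow> 0) (at v)" using v by simp
    have "((\<lambda>w. Pe f n S w - Pe f n S v) \<longlongrightarrow> 0) (at v)"
    proof (rule Lim_null_comparison[OF _ lim])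
      have "eventually (\<lambda>w. 0 < w) (at v)"
        using v by (intro order_tendstoD(1)[OF tendsto_ident_at])
      then show "eventually (\<lambda>w. norm (Pe f n S w - Pe f n S v) \<le> (sqrt (max w v / min w v)) ^ n - 1) (at v)"
      proof eventually_elim
        case (elim w)
        then show ?case using bound[of v w] bound[of w v] v
          by (cases "v \<le> w") (auto simp: abs_minus_commute max_def min_def)
      qed
    qed
    then show "isCont (Pe f n S) v" unfolding isCont_def by (simp add: LIM_zero_iff)
  qed
qed

lemma AE_fadingVecM_pos: "AE h in fadingVecM f n. \<forall>i<n. 0 < h i"
proof -
  have "AE h in fadingVecM f n. \<forall>i\<in>{..<n}. 0 < h i"
  proof (intro AE_finite_allI finite_lessThan)
    fix i assume i: "i \<in> {..<n}"
    show "AE h in fadingVecM f n. 0 < h i"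
      unfolding fadingVecM_def
      by (rule AE_PiM_component[OF prob_space_fadingM[OF f] i AE_fadingM_pos[OF f]])
  qed
  then show ?thesis by eventually_elim auto
qed

section \<open>Lower bound on the averaged error through the log ratio\<close>

lemma measure_channel_section_le:
  assumes v: "v > 0" and E: "E \<in> sets (channel f n v)" and g: "integrable (fadingVecM f n) g" "\<And>h. 0 \<le> g h"
    and le: "\<And>h. h \<in> space (fadingVecM f n) \<Longrightarrow> \<forall>i<n. 0 < h i \<Longrightarrow> measure (noiseM n v) (Pair h -` E) \<le> g h"
  shows "measure (channel f n v) E \<le> (\<integral>h. g h \<partial>fadingVecM f n)"
proof -
  interpret C: prob_space "channel f n v" by (rule prob_space_channel[OF f v])
  interpret N: prob_space "noiseM n v" by (rule prob_space_noiseM[OF v])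
  have "ennreal (measure (channel f n v) E) = (\<integral>\<^sup>+h. emeasure (noiseM n v) (Pair h -` E) \<partial>fadingVecM f n)"
    unfolding C.emeasure_eq_measure[symmetric] using E unfolding channel_def by (rule N.emeasure_pair_measure_alt)
  also have "\<dots> \<le> (\<integral>\<^sup>+h. ennreal (g h) \<partial>fadingVecM f n)"
  proof (rule nn_integral_mono_AE)
    show "AE h in fadingVecM f n. emeasure (noiseM n v) (Pair h -` E) \<le> ennreal (g h)"
      using AE_fadingVecM_pos AE_space
      by eventually_elim (simp add: N.emeasure_eq_measure le ennreal_leI)
  qed
  also have "\<dots> = ennreal (\<integral>h. g h \<partial>fadingVecM f n)" using g by (intro nn_integral_eq_integral) auto
  finally show ?thesis using g by (subst (asm) ennreal_le_iff) (auto intro!: Bochner_Integration.integral_nonneg)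
qed

text \<open>For positive fading a \<open>log_ratio\<close> above this threshold forces the noise out
  of the ball of effective radius. The sphere bound then applies to each fading section and is
  integrated. The threshold is the logarithm of the volume-to-noise ratio, corrected by the
  deviation of the ball volume from its asymptotic form.\<close>

lemma Pe_ge_exceed:
  assumes v: "v > 0" and S: "IC n S" and d: "0 < dens n S" "dens n S < \<infinity>" and n: "n > 0"
  shows "measure (channel f n v) (exceed f n v
     (ln (VNR f n S v) - (2 / real n * ln (unit_ball_vol (real n)) - (ln (2 * pi * exp 1) - ln (real n))))) \<le> Pe f n S v"
proof -
  interpret N: prob_space "noiseM n v" by (rule prob_space_noiseM[OF v])
  define \<gamma> where "\<gamma> = real_of_ereal (dens n S)"
  have gam: "dens n S = ereal \<gamma>" "\<gamma> > 0" using d unfolding \<gamma>_def by (cases "dens n S"; simp)+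
  define V where "V = unit_ball_vol (real n)"
  have V: "V > 0" by (simp add: V_def)
  define y where "y = ln (VNR f n S v) - (2 / real n * ln V - (ln (2 * pi * exp 1) - ln (real n)))"
  have lnV: "ln (VNR f n S v) = - 2 * ln \<gamma> / n + E_lnH2 f - ln (2 * pi * exp 1) - ln v"
  proof -
    have "ln (VNR f n S v) = ln (exp (- 2 * NLD n S + E_lnH2 f)) - ln (2 * pi * exp 1 * v)"
      unfolding VNR_def using v by (subst ln_div) auto
    also have "ln (2 * pi * exp 1 * v) = ln (2 * pi * exp 1) + ln v" using v by (intro ln_mult_pos) auto
    finally show ?thesis by (simp add: NLD_def \<gamma>_def)
  qed
  have "measure (channel f n v) (exceed f n v y) \<le> (\<integral>h. limsup_err n v S h \<partial>fadingVecM f n)"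
  proof (rule measure_channel_section_le[OF v measurable_exceed[OF f] integrable_limsup_err[OF v S] limsup_err_ereal(2)[OF v]])
    fix h assume hs: "h \<in> space (fadingVecM f n)" and h: "\<forall>i<n. 0 < h i"
    define P where "P = (\<Prod>i<n. h i)"
    have P: "P > 0" unfolding P_def using h by (intro prod_pos) auto
    define r where "r = (P / (\<gamma> * V)) powr (1 / n)"
    have r: "r > 0" unfolding r_def using P V gam by simp
    have rn: "V * r ^ n = P / \<gamma>" unfolding r_def using P V gam n by (simp add: powr_power)
    have lnP: "ln P = (\<Sum>i<n. ln (h i))" unfolding P_def using h by (intro ln_prod) auto
    have "ln (P / (\<gamma> * V)) = ln P - ln (\<gamma> * V)" using P V gam by (subst ln_div) auto
    also have "ln (\<gamma> * V) = ln \<gamma> + ln V" using V gam by (intro ln_mult_pos) auto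
    finally have lnq: "ln (P / (\<gamma> * V)) = (\<Sum>i<n. ln (h i)) - ln \<gamma> - ln V" by (simp add: lnP)
    have lnr: "2 * ln r = 2 / n * ((\<Sum>i<n. ln (h i)) - ln \<gamma> - ln V)"
      unfolding r_def using P V gam by (subst ln_powr) (auto simp: lnq)
    have "Pair h -` exceed f n v y \<subseteq> Rn n - ball0 n r"
    proof
      fix z assume "z \<in> Pair h -` exceed f n v y"
      then have z: "(h, z) \<in> space (channel f n v)" "0 < (\<Sum>i<n. (z i)\<^sup>2)" "y < log_ratio f n v (h, z)" by (auto simp: exceed_def)
      have zR: "z \<in> Rn n" using z(1) by (simp add: channel_def space_pair_measure space_lebn)
      have "(\<Sum>i<n. ln ((h i)\<^sup>2) - E_lnH2 f) = (\<Sum>i<n. 2 * ln (h i)) - n * E_lnH2 f"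
        unfolding sum_subtractf using h by (simp add: ln_realpow)
      then have "y < ln (\<Sum>i<n. (z i)\<^sup>2) - ln n - ln v - 2 / n * (\<Sum>i<n. ln (h i)) + E_lnH2 f"
        using z v n by (simp add: log_ratio_def ln_div ln_mult sum_distrib_left[symmetric] field_simps)
      then have "2 * ln r < ln (\<Sum>i<n. (z i)\<^sup>2)"
        unfolding y_def lnV lnr by (simp add: right_diff_distrib)
      then have "ln (r\<^sup>2) < ln (\<Sum>i<n. (z i)\<^sup>2)" using r by (simp add: ln_realpow)
      then have "r\<^sup>2 < (\<Sum>i<n. (z i)\<^sup>2)" using r z(2) by (subst (asm) ln_less_cancel_iff) auto
      then show "z \<in> Rn n - ball0 n r" using zR by (simp add: ball0_def)
    qed
    then have "measure (noiseM n v) (Pair h -` exceed f n v y) \<le> measure (noiseM n v) (Rn n - ball0 n r)"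
      using sets_ball0[of n r] by (intro N.finite_measure_mono) (auto simp: sets_noise_lebn space_lebn[symmetric])
    also have "\<dots> = 1 - measure (noiseM n v) (ball0 n r)"
      using N.prob_compl[of "ball0 n r"] sets_ball0[of n r] by (simp add: space_lebn sets_noise_lebn)
    also have "\<dots> \<le> limsup_err n v S h"
      using sphere_bound[OF v, of S n h \<gamma> r] S h gam r rn
      by (simp add: IC_def limsup_err_ereal(1)[OF v] V_def P_def)
    finally show "measure (noiseM n v) (Pair h -` exceed f n v y) \<le> limsup_err n v S h" .
  qed
  then show ?thesis unfolding y_def V_def Pe_eq .
qed

end

section \<open>Lattice periodic codes\<close>

definition lat :: "nat \<Rightarrow> real \<Rightarrow> (nat \<Rightarrow> real) set" where
  "lat n L = PiE {..<n} (\<lambda>_. range (\<lambda>k::int. L * real_of_int k))"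

definition cell :: "nat \<Rightarrow> real \<Rightarrow> (nat \<Rightarrow> real) set" where
  "cell n L = PiE {..<n} (\<lambda>_. {0..<L})"

lemma lat_Rn: "l \<in> lat n L \<Longrightarrow> l \<in> Rn n" and cell_Rn: "x \<in> cell n L \<Longrightarrow> x \<in> Rn n"
  by (auto simp: lat_def cell_def Rn_def)

lemma countable_lat: "countable (lat n L)"
  unfolding lat_def by (intro countable_PiE) auto

lemma sets_cell [measurable]: "cell n L \<in> sets (lebn n)"
  unfolding cell_def by (intro sets_PiM_I_finite) auto

lemma emeasure_cell: "L \<ge> 0 \<Longrightarrow> emeasure (lebn n) (cell n L) = ennreal (L ^ n)"
  unfolding cell_def by (subst lebn.emeasure_PiM) (auto simp: ennreal_power)

lemma infinite_lat:
  assumes n: "n > 0" and L: "L > 0"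
  shows "infinite (lat n L)"
proof -
  let ?f = "\<lambda>k::nat. \<lambda>i\<in>{..<n}. L * real_of_int (int k)"
  have "inj ?f"
  proof (rule injI)
    fix j k :: nat assume "?f j = ?f k"
    from fun_cong[OF this, of 0] show "j = k" using n L by simp
  qed
  moreover have "?f k \<in> lat n L" for k
    unfolding lat_def restrict_PiE_iff by (intro ballI rangeI)
  then have "range ?f \<subseteq> lat n L" by blast
  ultimately show ?thesis by (meson finite_subset infinite_UNIV_nat range_inj_infinite)
qed

lemma int_multiple_unique:
  fixes j k :: int and L y :: real
  assumes "L > 0" "0 \<le> y - L * j" "y - L * j < L" "0 \<le> y - L * k" "y - L * k < L"
  shows "j = k"
proof -
  have "L * (j - k) < L * 1" "L * (k - j) < L * 1" using assms by (auto simp: algebra_simps)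
  then have "real_of_int (j - k) < 1" "real_of_int (k - j) < 1" using assms(1) by (simp_all add: mult_less_cancel_left_pos)
  then show ?thesis by linarith
qed

lemma cell_translates_disjoint:
  assumes L: "L > 0" and l: "l \<in> lat n L" "m \<in> lat n L"
    and x: "x \<in> cell n L" "y \<in> cell n L" and eq: "vadd n x l = vadd n y m"
  shows "l = m" "x = y"
proof -
  have i: "l i = m i \<and> x i = y i" if i: "i < n" for i
  proof -
    have "l i \<in> range (\<lambda>k::int. L * real_of_int k)" "m i \<in> range (\<lambda>k::int. L * real_of_int k)"
      using l i unfolding lat_def by (auto simp: PiE_iff)
    then obtain j k :: int where jk: "l i = L * j" "m i = L * k" by blast
    have e: "x i + l i = y i + m i" using fun_cong[OF eq, of i] i by (simp add: vadd_def)
    have "0 \<le> x i" "x i < L" "0 \<le> y i" "y i < L" using x i by (auto simp: cell_def PiE_iff)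
    then have "j = k" using e jk by (intro int_multiple_unique[OF L, of "x i + l i"]) auto
    then show ?thesis using jk e by simp
  qed
  show "l = m" by (rule Rn_eqI[of _ n]) (use i lat_Rn l in auto)
  show "x = y" by (rule Rn_eqI[of _ n]) (use i cell_Rn x in auto)
qed

text \<open>Cut \<open>B\<close> along the translates of \<open>cell\<close> and move every piece
  back. The moved pieces cover the points in question, and the original pieces are disjoint because
  a point determines its lattice vector; translation preserves their volumes.\<close>

lemma torus_le:
  assumes n: "n > 0" and L: "L > 0" and B: "B \<in> sets (lebn n)"
  shows "emeasure (lebn n) {x \<in> cell n L. \<exists>l\<in>lat n L. vadd n x l \<in> B} \<le> emeasure (lebn n) B"
proof -
  define e where "e = from_nat_into (lat n L)"
  have bij: "bij_betw e UNIV (lat n L)"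
    unfolding e_def by (rule bij_betw_from_nat_into[OF countable_lat infinite_lat[OF n L]])
  then have e: "e k \<in> lat n L" for k by (auto simp: bij_betw_def)
  let ?Y = "\<lambda>k. {y \<in> B. vadd n y (\<lambda>i. - e k i) \<in> cell n L}"
  let ?X = "\<lambda>k. {x \<in> space (lebn n). vadd n (e k) x \<in> ?Y k}"
  have BR: "B \<subseteq> Rn n" using sets.sets_into_space[OF B] by (simp add: space_lebn)
  have Ym: "?Y k \<in> sets (lebn n)" for k
  proof -
    have "(\<lambda>y. vadd n y (\<lambda>i. - e k i)) \<in> lebn n \<rightarrow>\<^sub>M lebn n" unfolding vadd_def by measurable
    then have "{y \<in> space (lebn n). vadd n y (\<lambda>i. - e k i) \<in> cell n L} \<in> sets (lebn n)" by measurable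
    then have "{y \<in> space (lebn n). vadd n y (\<lambda>i. - e k i) \<in> cell n L} \<inter> B \<in> sets (lebn n)" using B by auto
    moreover have "{y \<in> space (lebn n). vadd n y (\<lambda>i. - e k i) \<in> cell n L} \<inter> B = ?Y k" using BR by (auto simp: space_lebn)
    ultimately show ?thesis by simp
  qed
  have Xm: "?X k \<in> sets (lebn n)" for k
    using Ym[of k] measurable_vadd[OF lat_Rn[OF e[of k]]] by measurable
  have sub_add: "vadd n (vadd n l x) (\<lambda>i. - l i) = x" if "x \<in> Rn n" for l x
    by (intro Rn_eqI[of _ n] vadd_in_Rn that) (simp add: vadd_def)
  have comm: "vadd n x l = vadd n l x" for x l by (auto simp: vadd_def add.commute intro!: restrict_ext)
  have "{x \<in> cell n L. \<exists>l\<in>lat n L. vadd n x l \<in> B} \<subseteq> (\<Union>k. ?X k)"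
  proof
    fix x assume x: "x \<in> {x \<in> cell n L. \<exists>l\<in>lat n L. vadd n x l \<in> B}"
    then obtain l where l: "l \<in> lat n L" "vadd n x l \<in> B" by auto
    obtain k where k: "l = e k" using bij l(1) by (metis bij_betw_def imageE)
    have xR: "x \<in> Rn n" using x cell_Rn by auto
    have "x \<in> ?X k" using x l xR sub_add[OF xR, of l] comm[of x l] by (simp add: k space_lebn)
    then show "x \<in> (\<Union>k. ?X k)" by blast
  qed
  then have "emeasure (lebn n) {x \<in> cell n L. \<exists>l\<in>lat n L. vadd n x l \<in> B} \<le> emeasure (lebn n) (\<Union>k. ?X k)"
    using Xm by (intro emeasure_mono sets.countable_UN) auto
  also have "\<dots> \<le> (\<Sum>k. emeasure (lebn n) (?X k))"
    using Xm by (intro emeasure_subadditive_countably) auto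
  also have "\<dots> = (\<Sum>k. emeasure (lebn n) (?Y k))"
    by (intro suminf_cong emeasure_lebn_translate Ym)
  also have "\<dots> = emeasure (lebn n) (\<Union>k. ?Y k)"
  proof (rule suminf_emeasure)
    show "range ?Y \<subseteq> sets (lebn n)" using Ym by auto
    show "disjoint_family ?Y"
      unfolding disjoint_family_on_def
    proof (intro ballI impI)
      fix j k :: nat assume jk: "j \<noteq> k"
      have False if y: "y \<in> ?Y j" "y \<in> ?Y k" for y
      proof -
        have yR: "y \<in> Rn n" using y BR by auto
        have "vadd n (vadd n y (\<lambda>i. - e i' i)) (e i') = y" for i'
          by (intro Rn_eqI[of _ n] vadd_in_Rn yR) (simp add: vadd_def)
        then have "e j = e k"
          using y by (intro cell_translates_disjoint(1)[OF L e e, of "vadd n y (\<lambda>i. - e j i)" "vadd n y (\<lambda>i. - e k i)"]) auto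
        then show False using jk bij by (auto simp: bij_betw_def inj_on_def)
      qed
      then show "?Y j \<inter> ?Y k = {}" by blast
    qed
  qed
  also have "\<dots> \<le> emeasure (lebn n) B" using B by (intro emeasure_mono) auto
  finally show ?thesis .
qed

text \<open>Radius of the ball of volume \<open>\<theta> * (\<Prod>i<n. h i)\<close>, the fraction
  \<open>\<theta>\<close> of the faded volume per point at density 1. It scales with the fading so
  that the bound on the mean number of competitors does not.\<close>

definition rad :: "nat \<Rightarrow> real \<Rightarrow> (nat \<Rightarrow> real) \<Rightarrow> real" where
  "rad n \<theta> h = (\<theta> * (\<Prod>i<n. h i) / unit_ball_vol n) powr (1 / n)"

lemma rad_pos:
  assumes "n > 0" "\<theta> > 0" "\<And>i. i < n \<Longrightarrow> 0 < h i"
  shows "rad n \<theta> h > 0" "unit_ball_vol n * rad n \<theta> h ^ n = \<theta> * (\<Prod>i<n. h i)"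
    "2 * ln (rad n \<theta> h) = 2 / n * (ln \<theta> + (\<Sum>i<n. ln (h i)) - ln (unit_ball_vol n))"
proof -
  have P: "(\<Prod>i<n. h i) > 0" using assms by (intro prod_pos) auto
  have V: "unit_ball_vol n > 0" by simp
  show "rad n \<theta> h > 0"
    using less_imp_neq[OF divide_pos_pos[OF mult_pos_pos[OF assms(2) P] V]] unfolding rad_def powr_gt_zero
    by (rule not_sym)
  show "unit_ball_vol n * rad n \<theta> h ^ n = \<theta> * (\<Prod>i<n. h i)"
  proof -
    have "rad n \<theta> h ^ n = \<theta> * (\<Prod>i<n. h i) / unit_ball_vol n"
    proof -
      define q where "q = \<theta> * (\<Prod>i<n. h i) / unit_ball_vol n"
      have "q > 0" unfolding q_def by (intro divide_pos_pos mult_pos_pos assms P V)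
      then show ?thesis unfolding rad_def q_def[symmetric] using assms(1) by (simp add: powr_power)
    qed
    then show ?thesis using less_imp_neq[OF V] by simp
  qed
  have "ln (\<theta> * (\<Prod>i<n. h i) / unit_ball_vol n) = ln \<theta> + ln (\<Prod>i<n. h i) - ln (unit_ball_vol n)"
  proof -
    have "ln (\<theta> * (\<Prod>i<n. h i) / unit_ball_vol n) = ln (\<theta> * (\<Prod>i<n. h i)) - ln (unit_ball_vol n)"
      using P V less_imp_neq[OF V] assms(2) by (intro ln_divide_pos) auto
    also have "ln (\<theta> * (\<Prod>i<n. h i)) = ln \<theta> + ln (\<Prod>i<n. h i)" using P assms(2) by (intro ln_mult_pos) auto
    finally show ?thesis .
  qed
  also have "ln (\<Prod>i<n. h i) = (\<Sum>i<n. ln (h i))"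
    by (intro ln_prod) (use assms(3) less_imp_neq[THEN not_sym] in blast)+
  finally show "2 * ln (rad n \<theta> h) = 2 / n * (ln \<theta> + (\<Sum>i<n. ln (h i)) - ln (unit_ball_vol n))"
    unfolding rad_def using P V assms(2) by (subst ln_powr) auto
qed

text \<open>\<open>p\<close> stands for a competitor minus the sent codeword: seen from the sent
  point, some periodic copy of the competitor lies within \<open>rad\<close> of the noise.\<close>

definition hit :: "(real \<Rightarrow> real) \<Rightarrow> nat \<Rightarrow> real \<Rightarrow> real \<Rightarrow> real \<Rightarrow> (nat \<Rightarrow> real) \<Rightarrow> ((nat \<Rightarrow> real) \<times> (nat \<Rightarrow> real)) set" where
  "hit f n v \<theta> L p = {w \<in> space (channel f n v). \<exists>l\<in>lat n L.
     sqdist_n n (snd w) (hmul n (fst w) (vadd n p l)) \<le> (rad n \<theta> (fst w))\<^sup>2}"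

lemma measurable_hmul [measurable (raw)]:
  assumes "g \<in> M \<rightarrow>\<^sub>M PiM {..<n} (\<lambda>_. borel)" "k \<in> M \<rightarrow>\<^sub>M PiM {..<n} (\<lambda>_. borel)"
  shows "(\<lambda>x. hmul n (g x) (k x)) \<in> M \<rightarrow>\<^sub>M PiM {..<n} (\<lambda>_. borel)"
proof -
  note assms[measurable]
  show ?thesis unfolding hmul_def by measurable
qed

lemma measurable_vadd_raw [measurable (raw)]:
  assumes "g \<in> M \<rightarrow>\<^sub>M PiM {..<n} (\<lambda>_. borel)" "k \<in> M \<rightarrow>\<^sub>M PiM {..<n} (\<lambda>_. borel)"
  shows "(\<lambda>x. vadd n (g x) (k x)) \<in> M \<rightarrow>\<^sub>M PiM {..<n} (\<lambda>_. borel)"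
proof -
  note assms[measurable]
  show ?thesis unfolding vadd_def by measurable
qed

lemma Rn_space: "x \<in> Rn n \<Longrightarrow> x \<in> space (PiM {..<n} (\<lambda>_. borel))"
  by (simp add: Rn_def space_PiM)

lemma measurable_rad [measurable]: "rad n \<theta> \<in> borel_measurable (PiM {..<n} (\<lambda>_. borel))"
  unfolding rad_def by measurable

context
  fixes f :: "real \<Rightarrow> real"
  assumes f: "regular_fading f"
begin

lemma sets_channel: "sets (channel f n v) = sets (PiM {..<n} (\<lambda>_. borel) \<Otimes>\<^sub>M PiM {..<n} (\<lambda>_. borel))"
  unfolding channel_def by (intro sets_pair_measure_cong sets_fadingVecM f sets_noiseM)

lemma measurable_fst_channel [measurable]: "fst \<in> channel f n v \<rightarrow>\<^sub>M PiM {..<n} (\<lambda>_. borel)"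
  and measurable_snd_channel [measurable]: "snd \<in> channel f n v \<rightarrow>\<^sub>M PiM {..<n} (\<lambda>_. borel)"
  unfolding measurable_cong_sets[OF sets_channel refl] by measurable

lemma sets_hit:
  assumes p: "p \<in> Rn n" shows "hit f n v \<theta> L p \<in> sets (channel f n v)"
  unfolding hit_def
proof (rule sets.sets_Collect_countable_Ex'[OF _ countable_lat])
  fix l assume "l \<in> lat n L"
  note [measurable] = Rn_space[OF p] Rn_space[OF lat_Rn[OF this]]
  show "{w \<in> space (channel f n v). sqdist_n n (snd w) (hmul n (fst w) (vadd n p l)) \<le> (rad n \<theta> (fst w))\<^sup>2} \<in> sets (channel f n v)"
    by measurable
qed

lemma AE_channel_pos:
  assumes v: "v > 0" shows "AE w in channel f n v. \<forall>i<n. 0 < fst w i"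
proof -
  interpret N: prob_space "noiseM n v" by (rule prob_space_noiseM[OF v])
  interpret F: prob_space "fadingVecM f n" by (rule prob_space_fadingVecM[OF f])
  interpret P: pair_prob_space "fadingVecM f n" "noiseM n v" ..
  have "AE w in distr (fadingVecM f n \<Otimes>\<^sub>M noiseM n v) (fadingVecM f n) fst. \<forall>i<n. 0 < w i"
    unfolding N.distr_pair_fst by (rule AE_fadingVecM_pos[OF f])
  then show ?thesis unfolding channel_def by (rule AE_distrD[OF measurable_fst])
qed

lemma sets_hit_joint:
  "{q \<in> space (lebn n \<Otimes>\<^sub>M channel f n v). \<exists>l\<in>lat n L.
     sqdist_n n (snd (snd q)) (hmul n (fst (snd q)) (vadd n (affn n c (\<lambda>_. \<sigma>) (fst q)) l)) \<le> (rad n \<theta> (fst (snd q)))\<^sup>2}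
   \<in> sets (lebn n \<Otimes>\<^sub>M channel f n v)"
proof (rule sets.sets_Collect_countable_Ex'[OF _ countable_lat])
  fix l assume "l \<in> lat n L"
  have pm: "affn n c (\<lambda>_. \<sigma>) \<in> lebn n \<rightarrow>\<^sub>M PiM {..<n} (\<lambda>_. borel)"
    using measurable_affn[of n c "\<lambda>_. \<sigma>"] unfolding measurable_cong_sets[OF refl sets_lebn] .
  note [measurable] = Rn_space[OF lat_Rn[OF \<open>l \<in> lat n L\<close>]] pm
  show "{q \<in> space (lebn n \<Otimes>\<^sub>M channel f n v). sqdist_n n (snd (snd q)) (hmul n (fst (snd q)) (vadd n (affn n c (\<lambda>_. \<sigma>) (fst q)) l)) \<le> (rad n \<theta> (fst (snd q)))\<^sup>2}
     \<in> sets (lebn n \<Otimes>\<^sub>M channel f n v)"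
    by measurable
qed

lemma measurable_emeasure_hit:
  assumes v: "v > 0"
  shows "(\<lambda>x. emeasure (channel f n v) (hit f n v \<theta> L (affn n c (\<lambda>_. \<sigma>) x))) \<in> borel_measurable (lebn n)"
proof -
  interpret C: prob_space "channel f n v" by (rule prob_space_channel[OF f v])
  have "emeasure (channel f n v) (hit f n v \<theta> L (affn n c (\<lambda>_. \<sigma>) x)) = emeasure (channel f n v) (Pair x -`
      {q \<in> space (lebn n \<Otimes>\<^sub>M channel f n v). \<exists>l\<in>lat n L.
     sqdist_n n (snd (snd q)) (hmul n (fst (snd q)) (vadd n (affn n c (\<lambda>_. \<sigma>) (fst q)) l)) \<le> (rad n \<theta> (fst (snd q)))\<^sup>2})"
    if "x \<in> space (lebn n)" for x
    using that by (intro arg_cong2[where f=emeasure] refl) (auto simp: hit_def space_pair_measure)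
  then show ?thesis
    using C.measurable_emeasure_Pair[OF sets_hit_joint] by (subst measurable_cong) auto
qed

text \<open>Exchange the integrals. For a fixed channel outcome the relevant \<open>x\<close> have a
  lattice translate in an ellipsoid of volume \<open>\<theta>\<close>, since the fading map undoes
  the product of the \<open>h i\<close> in the ball volume; \<open>torus_le\<close> then bounds
  their volume. Both signs are needed because a new point acts both as competitor and as sent
  codeword.\<close>

lemma average_hit:
  assumes n: "n > 0" and L: "L > 0" and v: "v > 0" and th: "\<theta> > 0"
    and c: "c \<in> Rn n" and \<sigma>: "\<sigma> = 1 \<or> \<sigma> = -1"
  shows "(\<integral>\<^sup>+x. emeasure (channel f n v) (hit f n v \<theta> L (affn n c (\<lambda>_. \<sigma>) x)) * indicator (cell n L) x \<partial>lebn n) \<le> ennreal \<theta>"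
proof -
  interpret C: prob_space "channel f n v" by (rule prob_space_channel[OF f v])
  interpret LB: sigma_finite_measure "lebn n" by (rule sigma_finite_lebn)
  interpret P: pair_sigma_finite "lebn n" "channel f n v" ..
  let ?p = "affn n c (\<lambda>_. \<sigma>)"
  define E where "E = {q \<in> space (lebn n \<Otimes>\<^sub>M channel f n v). \<exists>l\<in>lat n L.
     sqdist_n n (snd (snd q)) (hmul n (fst (snd q)) (vadd n (?p (fst q)) l)) \<le> (rad n \<theta> (fst (snd q)))\<^sup>2}"
  have Em: "E \<in> sets (lebn n \<Otimes>\<^sub>M channel f n v)"
    unfolding E_def by (rule sets_hit_joint)
  define E' where "E' = E \<inter> (cell n L \<times> space (channel f n v))"
  have Em': "E' \<in> sets (lebn n \<Otimes>\<^sub>M channel f n v)" unfolding E'_def using Em by (intro sets.Int pair_measureI) auto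
  have cR: "cell n L \<subseteq> space (lebn n)" using cell_Rn by (auto simp: space_lebn)
  have "(\<integral>\<^sup>+x. emeasure (channel f n v) (hit f n v \<theta> L (?p x)) * indicator (cell n L) x \<partial>lebn n)
     = (\<integral>\<^sup>+x. emeasure (channel f n v) (Pair x -` E') \<partial>lebn n)"
  proof (rule nn_integral_cong)
    fix x assume x: "x \<in> space (lebn n)"
    have "Pair x -` E' = (if x \<in> cell n L then hit f n v \<theta> L (?p x) else {})"
      using x cR by (auto simp: E'_def E_def hit_def space_pair_measure)
    then show "emeasure (channel f n v) (hit f n v \<theta> L (?p x)) * indicator (cell n L) x = emeasure (channel f n v) (Pair x -` E')"
      by auto
  qed
  also have "\<dots> = emeasure (lebn n \<Otimes>\<^sub>M channel f n v) E'"
    by (rule C.emeasure_pair_measure_alt[OF Em', symmetric])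
  also have "\<dots> = (\<integral>\<^sup>+w. emeasure (lebn n) ((\<lambda>x. (x, w)) -` E') \<partial>channel f n v)"
    by (rule P.emeasure_pair_measure_alt2[OF Em'])
  also have "\<dots> \<le> (\<integral>\<^sup>+w. ennreal \<theta> \<partial>channel f n v)"
  proof (rule nn_integral_mono_AE)
    show "AE w in channel f n v. emeasure (lebn n) ((\<lambda>x. (x, w)) -` E') \<le> ennreal \<theta>"
      using AE_channel_pos[OF v, of n] AE_space
    proof eventually_elim
      case (elim w)
      define h z where "h = fst w" and "z = snd w"
      have h: "\<And>i. i < n \<Longrightarrow> 0 < h i" using elim by (simp add: h_def)
      note rd = rad_pos[OF n th h]
      define P where "P = (\<Prod>i<n. h i)"
      have Ppos: "P > 0" unfolding P_def using h by (intro prod_pos) auto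
      define B where "B = {y \<in> space (lebn n). affn n (\<lambda>i. h i * c i - z i) (\<lambda>i. h i * \<sigma>) y \<in> ball0 n (rad n \<theta> h)}"
      have Bm: "B \<in> sets (lebn n)" unfolding B_def by measurable
      have "ennreal (\<Prod>i<n. \<bar>h i * \<sigma>\<bar>) * emeasure (lebn n) B = emeasure (lebn n) (ball0 n (rad n \<theta> h))"
        unfolding B_def using h \<sigma> by (intro emeasure_lebn_affine sets_ball0) force
      also have "(\<Prod>i<n. \<bar>h i * \<sigma>\<bar>) = P"
        unfolding P_def using h \<sigma> by (intro prod.cong) (auto simp: abs_mult less_imp_le)
      also have "emeasure (lebn n) (ball0 n (rad n \<theta> h)) = ennreal (\<theta> * P)"
        using rd by (simp add: emeasure_ball0 P_def)
      finally have Bv: "ennreal P * emeasure (lebn n) B = ennreal P * ennreal \<theta>"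
        using Ppos th by (simp add: ennreal_mult mult.commute)
      have "emeasure (lebn n) B = ennreal \<theta>"
        using Bv Ppos by (subst (asm) ennreal_mult_cancel_left) auto
      have "(\<lambda>x. (x, w)) -` E' \<subseteq> {x \<in> cell n L. \<exists>l\<in>lat n L. vadd n x l \<in> B}"
      proof
        fix x assume "x \<in> (\<lambda>x. (x, w)) -` E'"
        then obtain l where x: "x \<in> cell n L" and l: "l \<in> lat n L"
          and d: "sqdist_n n z (hmul n h (vadd n (?p x) l)) \<le> (rad n \<theta> h)\<^sup>2"
          using elim(2) by (auto simp: E'_def E_def h_def z_def split: if_splits)
        \<comment> \<open>The lattice is symmetric, so the sign \<open>\<sigma>\<close> can be moved
          onto the lattice vector.\<close>
        define m where "m = (\<lambda>i\<in>{..<n}. \<sigma> * l i)"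
        have m: "m \<in> lat n L"
        proof -
          have "\<sigma> * l i \<in> range (\<lambda>k::int. L * real_of_int k)" if "i < n" for i
          proof -
            have "l i \<in> range (\<lambda>k::int. L * real_of_int k)" using l that by (auto simp: lat_def PiE_iff)
            then obtain k :: int where k: "l i = L * k" by blast
            from \<sigma> show ?thesis
            proof
              assume "\<sigma> = -1" then have "\<sigma> * l i = L * real_of_int (- k)" using k by simp
              then show ?thesis by blast
            qed (use k in auto)
          qed
          then show ?thesis by (auto simp: m_def lat_def)
        qed
        have "vadd n x m \<in> B"
        proof -
          have ss: "\<sigma> * (\<sigma> * t) = t" for t using \<sigma> by auto
          have "(\<Sum>i<n. (affn n (\<lambda>i. h i * c i - z i) (\<lambda>i. h i * \<sigma>) (vadd n x m) i)\<^sup>2) = sqdist_n n z (hmul n h (vadd n (?p x) l))"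
            unfolding sqdist_n_def
          proof (intro sum.cong refl)
            fix i assume i: "i \<in> {..<n}"
            have "affn n (\<lambda>i. h i * c i - z i) (\<lambda>i. h i * \<sigma>) (vadd n x m) i = hmul n h (vadd n (?p x) l) i - z i"
              using i by (simp add: affn_def vadd_def m_def hmul_def algebra_simps ss)
            then show "(affn n (\<lambda>i. h i * c i - z i) (\<lambda>i. h i * \<sigma>) (vadd n x m) i)\<^sup>2 = (z i - hmul n h (vadd n (?p x) l) i)\<^sup>2"
              by (simp add: power2_commute)
          qed
          then have "affn n (\<lambda>i. h i * c i - z i) (\<lambda>i. h i * \<sigma>) (vadd n x m) \<in> ball0 n (rad n \<theta> h)"
            using d unfolding ball0_def by (auto simp: affn_def Rn_def)
          then show ?thesis by (simp add: B_def space_lebn)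
        qed
        then show "x \<in> {x \<in> cell n L. \<exists>l\<in>lat n L. vadd n x l \<in> B}" using x m by blast
      qed
      then have "emeasure (lebn n) ((\<lambda>x. (x, w)) -` E') \<le> emeasure (lebn n) {x \<in> cell n L. \<exists>l\<in>lat n L. vadd n x l \<in> B}"
      proof (rule emeasure_mono)
        show "{x \<in> cell n L. \<exists>l\<in>lat n L. vadd n x l \<in> B} \<in> sets (lebn n)"
        proof -
          have "{x \<in> space (lebn n). \<exists>l\<in>lat n L. vadd n x l \<in> B} \<in> sets (lebn n)"
          proof (rule sets.sets_Collect_countable_Ex'[OF _ countable_lat])
            fix l assume l: "l \<in> lat n L"
            have "(\<lambda>x. vadd n x l) \<in> lebn n \<rightarrow>\<^sub>M lebn n" unfolding vadd_def by measurable
            then show "{x \<in> space (lebn n). vadd n x l \<in> B} \<in> sets (lebn n)" using Bm by measurable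
          qed
          then have "cell n L \<inter> {x \<in> space (lebn n). \<exists>l\<in>lat n L. vadd n x l \<in> B} \<in> sets (lebn n)" by auto
          moreover have "cell n L \<inter> {x \<in> space (lebn n). \<exists>l\<in>lat n L. vadd n x l \<in> B} = {x \<in> cell n L. \<exists>l\<in>lat n L. vadd n x l \<in> B}"
            using cR by auto
          ultimately show ?thesis by simp
        qed
      qed
      also have "\<dots> \<le> emeasure (lebn n) B" by (rule torus_le[OF n L Bm])
      finally show ?case using \<open>emeasure (lebn n) B = ennreal \<theta>\<close> by simp
    qed
  qed
  also have "\<dots> = ennreal \<theta>" by (simp add: C.emeasure_space_1)
  finally show ?thesis .
qed

end

section \<open>Greedy choice of points on the torus\<close>

definition vdiff :: "nat \<Rightarrow> (nat \<Rightarrow> real) \<Rightarrow> (nat \<Rightarrow> real) \<Rightarrow> nat \<Rightarrow> real" where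
  "vdiff n x y = (\<lambda>i\<in>{..<n}. x i - y i)"

lemma vdiff_Rn [simp]: "vdiff n x y \<in> Rn n"
  by (auto simp: vdiff_def Rn_def)

lemma affn_vdiff:
  "affn n (\<lambda>i\<in>{..<n}. - s i) (\<lambda>_. 1) x = vdiff n x s" "affn n s (\<lambda>_. -1) x = vdiff n s x"
  by (auto simp: affn_def vdiff_def intro!: restrict_ext)

lemma emeasure_lebn_singleton:
  assumes "n > 0" "x \<in> Rn n" shows "{x} \<in> null_sets (lebn n)"
proof -
  have e: "{x} = PiE {..<n} (\<lambda>i. {x i})" using assms(2) by (simp add: PiE_singleton Rn_def PiE_iff)
  have "emeasure (lebn n) {x} = 0" unfolding e
    using assms(1) by (subst lebn.emeasure_PiM) auto
  moreover have "{x} \<in> sets (lebn n)" unfolding e by (intro sets_PiM_I_finite) auto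
  ultimately show ?thesis by auto
qed

context
  fixes f :: "real \<Rightarrow> real"
  assumes f: "regular_fading f"
begin

text \<open>The cell has volume \<open>L ^ n\<close>, so the mean of the sum over the cell is at
  most \<open>2 * m * \<theta> / L ^ n\<close>, half of the allowance. The allowance is therefore
  met somewhere off the finitely many old points, which form a null set.\<close>

lemma greedy_point:
  assumes n: "n > 0" and L: "L > 0" and v: "v > 0" and th: "\<theta> > 0"
    and s: "\<And>j. j < m \<Longrightarrow> s j \<in> cell n L"
  defines "G \<equiv> \<lambda>p. measure (channel f n v) (hit f n v \<theta> L p)"
  obtains x where "x \<in> cell n L" "x \<notin> s ` {..<m}"
    "(\<Sum>j<m. G (vdiff n x (s j)) + G (vdiff n (s j) x)) \<le> 4 * real m * (\<theta> / L ^ n)"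
proof (rule ccontr)
  interpret C: prob_space "channel f n v" by (rule prob_space_channel[OF f v])
  note found = that
  define c where "c = 4 * real m * (\<theta> / L ^ n)"
  define F where "F x = (\<Sum>j<m. G (vdiff n x (s j)) + G (vdiff n (s j) x))" for x
  assume "\<not> thesis"
  then have no: "c < F x" if "x \<in> cell n L" "x \<notin> s ` {..<m}" for x
    using found[OF that] \<open>\<not> thesis\<close> unfolding c_def F_def by linarith
  show False
  proof (cases "m = 0")
    case True
    \<comment> \<open>For \<open>m = 0\<close> doubling the allowance leaves no gap, but the sum is
      empty and any point of the cell will do; the origin is one.\<close>
    have "(\<lambda>i\<in>{..<n}. 0) \<in> cell n L" using L by (auto simp: cell_def)
    from no[OF this] True show False by (simp add: c_def F_def)
  next
    case False
    have c: "c \<ge> 0" using L th by (simp add: c_def)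
    let ?g1 = "\<lambda>j x. emeasure (channel f n v) (hit f n v \<theta> L (vdiff n x (s j)))"
    let ?g2 = "\<lambda>j x. emeasure (channel f n v) (hit f n v \<theta> L (vdiff n (s j) x))"
    have m1: "?g1 j \<in> borel_measurable (lebn n)" for j
      using measurable_emeasure_hit[OF f v, of n \<theta> L "\<lambda>i\<in>{..<n}. - s j i" 1] unfolding affn_vdiff .
    have m2: "?g2 j \<in> borel_measurable (lebn n)" for j
      using measurable_emeasure_hit[OF f v, of n \<theta> L "s j" "-1"] unfolding affn_vdiff .
    note [measurable] = m1 m2
    have a1: "(\<integral>\<^sup>+x. ?g1 j x * indicator (cell n L) x \<partial>lebn n) \<le> ennreal \<theta>" for j
      using average_hit[OF f n L v th, of "\<lambda>i\<in>{..<n}. - s j i" 1] unfolding affn_vdiff by (simp add: Rn_def)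
    have a2: "(\<integral>\<^sup>+x. ?g2 j x * indicator (cell n L) x \<partial>lebn n) \<le> ennreal \<theta>" if "j < m" for j
      using average_hit[OF f n L v th cell_Rn[OF s[OF that]], of "-1"] unfolding affn_vdiff by simp
    have ae: "AE x in lebn n. \<forall>j\<in>{..<m}. x \<noteq> s j"
    proof (intro AE_finite_allI finite_lessThan)
      fix j assume "j \<in> {..<m}"
      then have "{s j} \<in> null_sets (lebn n)" using s cell_Rn by (intro emeasure_lebn_singleton n) auto
      then show "AE x in lebn n. x \<noteq> s j" by (rule AE_I') auto
    qed
    have "ennreal (4 * real m * \<theta>) = ennreal c * emeasure (lebn n) (cell n L)"
      using L c th by (simp add: emeasure_cell c_def ennreal_mult[symmetric])
    also have "\<dots> = (\<integral>\<^sup>+x. ennreal c * indicator (cell n L) x \<partial>lebn n)"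
      by (subst nn_integral_cmult_indicator) auto
    also have "\<dots> \<le> (\<integral>\<^sup>+x. (\<Sum>j<m. ?g1 j x * indicator (cell n L) x + ?g2 j x * indicator (cell n L) x) \<partial>lebn n)"
    proof (rule nn_integral_mono_AE)
      show "AE x in lebn n. ennreal c * indicator (cell n L) x \<le> (\<Sum>j<m. ?g1 j x * indicator (cell n L) x + ?g2 j x * indicator (cell n L) x)"
        using ae
      proof eventually_elim
        case (elim x)
        show ?case
        proof (cases "x \<in> cell n L")
          case True
          have "ennreal c \<le> ennreal (F x)" using no[OF True] elim by (intro ennreal_leI) force
          also have "\<dots> = (\<Sum>j<m. ?g1 j x + ?g2 j x)"
            unfolding F_def G_def by (simp add: sum_ennreal[symmetric] C.emeasure_eq_measure ennreal_plus)
          finally show ?thesis using True by simp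
        qed simp
      qed
    qed
    also have "\<dots> = (\<Sum>j<m. (\<integral>\<^sup>+x. ?g1 j x * indicator (cell n L) x \<partial>lebn n) + (\<integral>\<^sup>+x. ?g2 j x * indicator (cell n L) x \<partial>lebn n))"
      by (subst nn_integral_sum) (auto simp: nn_integral_add)
    also have "\<dots> \<le> (\<Sum>j<m. ennreal \<theta> + ennreal \<theta>)" by (intro sum_mono add_mono a1 a2) auto
    also have "\<dots> = ennreal (2 * real m * \<theta>)"
      using th by (simp add: ennreal_plus[symmetric] ennreal_of_nat_eq_real_of_nat ennreal_mult[symmetric])
    finally have "4 * real m * \<theta> \<le> 2 * real m * \<theta>" using th by (subst (asm) ennreal_le_iff) auto
    then show False using False th by simp
  qed
qed

text \<open>The sum runs over ordered pairs, so a new point adds both directions at once, at most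
  \<open>4 * m\<close> units of \<open>\<theta> / L ^ n\<close>. This fits because
  \<open>2 * m\<^sup>2 + 4 * m \<le> 2 * (m + 1)\<^sup>2\<close>.\<close>

lemma greedy_code:
  assumes n: "n > 0" and L: "L > 0" and v: "v > 0" and th: "\<theta> > 0"
  defines "G \<equiv> \<lambda>p. measure (channel f n v) (hit f n v \<theta> L p)"
  shows "\<exists>s. inj_on s {..<m} \<and> s ` {..<m} \<subseteq> cell n L \<and>
    (\<Sum>i<m. \<Sum>j\<in>{..<m} - {i}. G (vdiff n (s j) (s i))) \<le> 2 * (real m)\<^sup>2 * (\<theta> / L ^ n)"
proof (induction m)
  case 0
  show ?case by simp
next
  case (Suc m)
  then obtain s where s: "inj_on s {..<m}" "s ` {..<m} \<subseteq> cell n L"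
    and E: "(\<Sum>i<m. \<Sum>j\<in>{..<m} - {i}. G (vdiff n (s j) (s i))) \<le> 2 * (real m)\<^sup>2 * (\<theta> / L ^ n)" by blast
  obtain x where x: "x \<in> cell n L" "x \<notin> s ` {..<m}"
    and F: "(\<Sum>j<m. G (vdiff n x (s j)) + G (vdiff n (s j) x)) \<le> 4 * real m * (\<theta> / L ^ n)"
    using greedy_point[OF n L v th, of m s] s unfolding G_def by blast
  define t where "t = s(m := x)"
  have tj: "t j = s j" if "j < m" for j using that by (simp add: t_def)
  have tm: "t m = x" by (simp add: t_def)
  have tim: "t ` {..<m} = s ` {..<m}" using tj by (intro image_cong) auto
  have "inj_on t {..<m}" using s(1) tj by (simp add: inj_on_def)
  then have "inj_on t {..<Suc m}" unfolding lessThan_Suc using x tm tim by auto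
  moreover have "t ` {..<Suc m} \<subseteq> cell n L" unfolding lessThan_Suc image_insert tim tm using s x by auto
  moreover have "(\<Sum>i<Suc m. \<Sum>j\<in>{..<Suc m} - {i}. G (vdiff n (t j) (t i))) \<le> 2 * (real (Suc m))\<^sup>2 * (\<theta> / L ^ n)"
  proof -
    have "(\<Sum>j\<in>{..<Suc m} - {i}. G (vdiff n (t j) (t i))) = (\<Sum>j\<in>{..<m} - {i}. G (vdiff n (s j) (s i))) + G (vdiff n x (s i))"
      if i: "i < m" for i
    proof -
      have "{..<Suc m} - {i} = insert m ({..<m} - {i})" using i by auto
      then have "(\<Sum>j\<in>{..<Suc m} - {i}. G (vdiff n (t j) (t i))) = G (vdiff n (t m) (t i)) + (\<Sum>j\<in>{..<m} - {i}. G (vdiff n (t j) (t i)))"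
        by simp
      then show ?thesis using i by (simp add: tm tj)
    qed
    moreover have "{..<Suc m} - {m} = {..<m}" by auto
    ultimately have "(\<Sum>i<Suc m. \<Sum>j\<in>{..<Suc m} - {i}. G (vdiff n (t j) (t i)))
       = (\<Sum>i<m. \<Sum>j\<in>{..<m} - {i}. G (vdiff n (s j) (s i))) + (\<Sum>j<m. G (vdiff n x (s j)) + G (vdiff n (s j) x))"
      by (simp add: sum.distrib tm tj)
    also have "\<dots> \<le> 2 * (real m)\<^sup>2 * (\<theta> / L ^ n) + 4 * real m * (\<theta> / L ^ n)" by (intro add_mono E F)
    also have "\<dots> = (2 * (real m)\<^sup>2 + 4 * real m) * (\<theta> / L ^ n)" by (simp add: algebra_simps)
    also have "\<dots> \<le> (2 * (real (Suc m))\<^sup>2) * (\<theta> / L ^ n)"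
      using th L by (intro mult_right_mono) (auto simp: power2_eq_square algebra_simps)
    finally show ?thesis .
  qed
  ultimately show ?case by blast
qed

end

section \<open>Point counts and density of the tiled code\<close>

lemma card_int_interval:
  fixes L c a :: real
  assumes L: "L > 0" and a: "a > 0"
  defines "K \<equiv> {k::int. \<bar>c + L * k\<bar> < a / 2}"
  shows "finite K" "a / L - 1 \<le> card K" "card K \<le> a / L + 1"
proof -
  define \<alpha> \<beta> where "\<alpha> = (- a / 2 - c) / L" and "\<beta> = (a / 2 - c) / L"
  have ba: "\<beta> - \<alpha> = a / L" using L by (simp add: \<alpha>_def \<beta>_def field_simps)
  have "\<bar>c + L * k\<bar> < a / 2 \<longleftrightarrow> \<alpha> < k \<and> k < \<beta>" for k :: int
  proof -
    have "\<alpha> < k \<longleftrightarrow> - a / 2 < c + L * k"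
      unfolding \<alpha>_def pos_divide_less_eq[OF L] mult.commute[of _ L] by linarith
    moreover have "k < \<beta> \<longleftrightarrow> c + L * k < a / 2"
      unfolding \<beta>_def pos_less_divide_eq[OF L] mult.commute[of _ L] by linarith
    ultimately show ?thesis by linarith
  qed
  moreover have "\<alpha> < k \<and> k < \<beta> \<longleftrightarrow> \<lfloor>\<alpha>\<rfloor> + 1 \<le> k \<and> k \<le> \<lceil>\<beta>\<rceil> - 1" for k :: int
    using floor_less_iff[of \<alpha> k] less_ceiling_iff[of k \<beta>] by auto
  ultimately have K: "K = {\<lfloor>\<alpha>\<rfloor> + 1..\<lceil>\<beta>\<rceil> - 1}"
    unfolding K_def atLeastAtMost_def atLeast_def atMost_def by blast
  show "finite K" unfolding K by simp
  have "card K = nat (\<lceil>\<beta>\<rceil> - 1 - \<lfloor>\<alpha>\<rfloor>)" unfolding K by simp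
  then have cK: "real (card K) = max 0 (real_of_int (\<lceil>\<beta>\<rceil> - 1 - \<lfloor>\<alpha>\<rfloor>))" by simp
  have "a / L > 0" using a L by simp
  then show "a / L - 1 \<le> card K" "card K \<le> a / L + 1" unfolding cK using ba by linarith+
qed

lemma lattice_count:
  assumes L: "L > 0" and a: "a > L" and s: "s \<in> Rn n"
  defines "N \<equiv> {l \<in> lat n L. vadd n s l \<in> cube n a}"
  shows "finite N" "(a / L - 1) ^ n \<le> card N" "card N \<le> (a / L + 1) ^ n"
proof -
  define T where "T i = (\<lambda>k::int. L * k) ` {k. \<bar>s i + L * k\<bar> < a / 2}" for i
  have N: "N = PiE {..<n} T"
  proof (intro equalityI subsetI)
    fix l assume "l \<in> N"
    then have l: "l \<in> lat n L" "\<And>i. i < n \<Longrightarrow> \<bar>s i + l i\<bar> < a / 2" by (auto simp: N_def cube_def vadd_def)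
    show "l \<in> PiE {..<n} T" unfolding PiE_iff
    proof (intro conjI ballI)
      fix i assume i: "i \<in> {..<n}"
      then have "l i \<in> range (\<lambda>k::int. L * real_of_int k)" using l(1) by (auto simp: lat_def PiE_iff)
      then obtain k :: int where k: "l i = L * k" by blast
      then show "l i \<in> T i" using l(2)[of i] i unfolding T_def by auto
    qed (use l(1) in \<open>auto simp: lat_def PiE_iff\<close>)
  next
    fix l assume l: "l \<in> PiE {..<n} T"
    then have "l \<in> lat n L" unfolding lat_def T_def PiE_iff by blast
    moreover have "\<bar>s i + l i\<bar> < a / 2" if "i < n" for i
    proof -
      have "l i \<in> T i" using l that by (auto simp: PiE_iff)
      then show ?thesis by (auto simp: T_def)
    qed
    ultimately show "l \<in> N" by (auto simp: N_def cube_def vadd_def Rn_def)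
  qed
  have a0: "a > 0" using a L by simp
  have cT: "finite (T i)" "card (T i) = card {k::int. \<bar>s i + L * k\<bar> < a / 2}" for i
    using card_int_interval(1)[OF L a0, of "s i"] L unfolding T_def by (auto intro!: card_image simp: inj_on_def)
  have bd: "a / L - 1 \<le> card (T i)" "card (T i) \<le> a / L + 1" for i
    unfolding cT(2) using card_int_interval(2,3)[OF L a0, of "s i"] by auto
  show "finite N" unfolding N using cT by (intro finite_PiE) auto
  have cN: "real (card N) = (\<Prod>i<n. real (card (T i)))" unfolding N by (simp add: card_PiE)
  have a1: "0 \<le> a / L - 1" using a L by simp
  have "(\<Prod>i<n. a / L - 1) \<le> (\<Prod>i<n. real (card (T i)))" using a1 bd by (intro prod_mono) auto
  moreover have "(\<Prod>i<n. real (card (T i))) \<le> (\<Prod>i<n. a / L + 1)" using bd by (intro prod_mono) auto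
  ultimately show "(a / L - 1) ^ n \<le> card N" "card N \<le> (a / L + 1) ^ n" unfolding cN by simp_all
qed

definition tiled :: "nat \<Rightarrow> real \<Rightarrow> (nat \<Rightarrow> nat \<Rightarrow> real) \<Rightarrow> nat \<Rightarrow> (nat \<Rightarrow> real) set" where
  "tiled n L s M = (\<lambda>(j, l). vadd n (s j) l) ` ({..<M} \<times> lat n L)"

definition far :: "(real \<Rightarrow> real) \<Rightarrow> nat \<Rightarrow> real \<Rightarrow> real \<Rightarrow> ((nat \<Rightarrow> real) \<times> (nat \<Rightarrow> real)) set" where
  "far f n v \<theta> = {w \<in> space (channel f n v). (rad n \<theta> (fst w))\<^sup>2 < (\<Sum>i<n. (snd w i)\<^sup>2)}"

text \<open>A codeword also competes with its own lattice translates. The greedy average covers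
  distinct codewords only, so these form a separate event, made rare by a large period
  \<open>L\<close>.\<close>

definition own :: "(real \<Rightarrow> real) \<Rightarrow> nat \<Rightarrow> real \<Rightarrow> real \<Rightarrow> ((nat \<Rightarrow> real) \<times> (nat \<Rightarrow> real)) set" where
  "own f n v L = {w \<in> space (channel f n v). \<exists>m\<in>lat n L - {\<lambda>i\<in>{..<n}. 0}.
     sqdist_n n (snd w) (hmul n (fst w) m) < (\<Sum>i<n. (snd w i)\<^sup>2)}"

definition bad :: "(real \<Rightarrow> real) \<Rightarrow> nat \<Rightarrow> real \<Rightarrow> real \<Rightarrow> real \<Rightarrow> (nat \<Rightarrow> nat \<Rightarrow> real) \<Rightarrow> nat \<Rightarrow> nat \<Rightarrow> ((nat \<Rightarrow> real) \<times> (nat \<Rightarrow> real)) set" where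
  "bad f n v \<theta> L s M j = far f n v \<theta> \<union> own f n v L \<union> (\<Union>i\<in>{..<M} - {j}. hit f n v \<theta> L (vdiff n (s i) (s j)))"

lemma lat_diff: "l \<in> lat n L \<Longrightarrow> m \<in> lat n L \<Longrightarrow> vdiff n l m \<in> lat n L"
proof -
  assume lm: "l \<in> lat n L" "m \<in> lat n L"
  show ?thesis unfolding lat_def vdiff_def restrict_PiE_iff
  proof
    fix i assume i: "i \<in> {..<n}"
    have "l i \<in> range (\<lambda>k::int. L * real_of_int k)" "m i \<in> range (\<lambda>k::int. L * real_of_int k)"
      using lm i unfolding lat_def by (auto simp: PiE_iff)
    then obtain j k :: int where "l i = L * j" "m i = L * k" by blast
    then have "l i - m i = L * real_of_int (j - k)" by (simp add: algebra_simps)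
    then show "l i - m i \<in> range (\<lambda>k::int. L * real_of_int k)" by blast
  qed
qed

lemma tiled_IC: "IC n (tiled n L s M)"
  unfolding IC_def tiled_def using countable_lat by (auto intro!: countable_image countable_SIGMA)

context
  fixes n M :: nat and L :: real and s :: "nat \<Rightarrow> nat \<Rightarrow> real"
  assumes n: "n > 0" and L: "L > 0" and inj: "inj_on s {..<M}" and cell: "s ` {..<M} \<subseteq> cell n L" and M: "M > 0"
begin

lemma tiled_inj: "inj_on (\<lambda>(j, l). vadd n (s j) l) ({..<M} \<times> lat n L)"
proof (rule inj_onI)
  fix p q assume pq: "p \<in> {..<M} \<times> lat n L" "q \<in> {..<M} \<times> lat n L"
    and eq: "(\<lambda>(j, l). vadd n (s j) l) p = (\<lambda>(j, l). vadd n (s j) l) q"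
  obtain i l j m where p: "p = (i, l)" and q: "q = (j, m)" by (metis surj_pair)
  have "l = m" "s i = s j"
    using cell_translates_disjoint[OF L, of l n m "s i" "s j"] pq eq cell by (auto simp: p q)
  then show "p = q" using inj pq by (auto simp: p q inj_on_def)
qed

lemma tiled_cube:
  "tiled n L s M \<inter> cube n a = (\<lambda>(j, l). vadd n (s j) l) ` (SIGMA j:{..<M}. {l \<in> lat n L. vadd n (s j) l \<in> cube n a})"
  by (auto simp: tiled_def)

lemma tiled_sum:
  assumes a: "a > L"
  shows "finite (tiled n L s M \<inter> cube n a)"
    "(\<Sum>p\<in>tiled n L s M \<inter> cube n a. g p) = (\<Sum>j<M. \<Sum>l\<in>{l \<in> lat n L. vadd n (s j) l \<in> cube n a}. g (vadd n (s j) l) :: real)"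
proof -
  have sR: "s j \<in> Rn n" if "j < M" for j using cell cell_Rn that by blast
  have fin: "finite {l \<in> lat n L. vadd n (s j) l \<in> cube n a}" if "j < M" for j
    by (rule lattice_count(1)[OF L a sR[OF that]])
  show "finite (tiled n L s M \<inter> cube n a)" unfolding tiled_cube using fin by (intro finite_imageI finite_SigmaI) auto
  have "inj_on (\<lambda>(j, l). vadd n (s j) l) (SIGMA j:{..<M}. {l \<in> lat n L. vadd n (s j) l \<in> cube n a})"
    by (rule inj_on_subset[OF tiled_inj]) auto
  then have "(\<Sum>p\<in>tiled n L s M \<inter> cube n a. g p) = (\<Sum>(j, l)\<in>(SIGMA j:{..<M}. {l \<in> lat n L. vadd n (s j) l \<in> cube n a}). g (vadd n (s j) l))"
    unfolding tiled_cube by (subst sum.reindex) (auto simp: case_prod_unfold)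
  also have "\<dots> = (\<Sum>j<M. \<Sum>l\<in>{l \<in> lat n L. vadd n (s j) l \<in> cube n a}. g (vadd n (s j) l))"
    using fin by (subst sum.Sigma) auto
  finally show "(\<Sum>p\<in>tiled n L s M \<inter> cube n a. g p) = (\<Sum>j<M. \<Sum>l\<in>{l \<in> lat n L. vadd n (s j) l \<in> cube n a}. g (vadd n (s j) l))" .
qed

lemma tiled_card:
  assumes a: "a > L"
  shows "M * (a / L - 1) ^ n \<le> card (tiled n L s M \<inter> cube n a)" "card (tiled n L s M \<inter> cube n a) \<le> M * (a / L + 1) ^ n"
proof -
  have sR: "s j \<in> Rn n" if "j < M" for j using cell cell_Rn that by blast
  let ?N = "\<lambda>j. {l \<in> lat n L. vadd n (s j) l \<in> cube n a}"
  have c: "real (card (tiled n L s M \<inter> cube n a)) = (\<Sum>j<M. real (card (?N j)))"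
    using tiled_sum(2)[OF a, of "\<lambda>_. 1"] by simp
  have "(\<Sum>j<M. (a / L - 1) ^ n) \<le> (\<Sum>j<M. real (card (?N j)))"
    using lattice_count(2)[OF L a sR] by (intro sum_mono) auto
  moreover have "(\<Sum>j<M. real (card (?N j))) \<le> (\<Sum>j<M. (a / L + 1) ^ n)"
    using lattice_count(3)[OF L a sR] by (intro sum_mono) auto
  ultimately show "M * (a / L - 1) ^ n \<le> card (tiled n L s M \<inter> cube n a)" "card (tiled n L s M \<inter> cube n a) \<le> M * (a / L + 1) ^ n"
    unfolding c by simp_all
qed

lemma tiled_dens: "dens n (tiled n L s M) = ereal (M / L ^ n)"
proof -
  let ?K = "\<lambda>a. real (card (tiled n L s M \<inter> cube n a))"
  have lim1: "((\<lambda>a. M * ((a / L - 1) / a) ^ n) \<longlongrightarrow> M * (1 / L) ^ n) at_top"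
  proof (intro tendsto_mult_left tendsto_power)
    show "((\<lambda>a. (a / L - 1) / a) \<longlongrightarrow> 1 / L) at_top"
      unfolding inverse_eq_divide[symmetric] using L by real_asymp
  qed
  have lim2: "((\<lambda>a. M * ((a / L + 1) / a) ^ n) \<longlongrightarrow> M * (1 / L) ^ n) at_top"
  proof (intro tendsto_mult_left tendsto_power)
    show "((\<lambda>a. (a / L + 1) / a) \<longlongrightarrow> 1 / L) at_top"
      unfolding inverse_eq_divide[symmetric] using L by real_asymp
  qed
  have "((\<lambda>a. ?K a / a ^ n) \<longlongrightarrow> M * (1 / L) ^ n) at_top"
  proof (rule tendsto_sandwich[OF _ _ lim1 lim2])
    show "eventually (\<lambda>a. M * ((a / L - 1) / a) ^ n \<le> ?K a / a ^ n) at_top"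
      using eventually_gt_at_top[of L]
    proof eventually_elim
      case (elim a)
      then have "a > 0" using L by simp
      then show ?case using divide_right_mono[OF tiled_card(1)[OF elim], of "a ^ n"] by (simp add: power_divide)
    qed
    show "eventually (\<lambda>a. ?K a / a ^ n \<le> M * ((a / L + 1) / a) ^ n) at_top"
      using eventually_gt_at_top[of L]
    proof eventually_elim
      case (elim a)
      then have "a > 0" using L by simp
      then show ?case using divide_right_mono[OF tiled_card(2)[OF elim], of "a ^ n"] by (simp add: power_divide)
    qed
  qed
  then have "((\<lambda>a. ereal (?K a / a ^ n)) \<longlongrightarrow> ereal (M / L ^ n)) at_top"
    by (simp add: power_divide)
  moreover have "eventually (\<lambda>a. npts (tiled n L s M \<inter> cube n a) / ereal (a ^ n) = ereal (?K a / a ^ n)) at_top"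
    using eventually_gt_at_top[of L]
  proof eventually_elim
    case (elim a)
    then show ?case using tiled_sum(1)[OF elim] L by (simp add: npts_def)
  qed
  ultimately have "((\<lambda>a. npts (tiled n L s M \<inter> cube n a) / ereal (a ^ n)) \<longlongrightarrow> ereal (M / L ^ n)) at_top"
    by (subst tendsto_cong)
  then show ?thesis unfolding dens_def by (intro lim_imp_Limsup) simp_all
qed

section \<open>Error probability of the tiled code\<close>

context
  fixes f :: "real \<Rightarrow> real" and v \<theta> :: real
  assumes f: "regular_fading f" and v: "v > 0"
begin

lemma sets_far [measurable]: "far f n v \<theta> \<in> sets (channel f n v)"
proof -
  note [measurable] = measurable_fst_channel[OF f] measurable_snd_channel[OF f] measurable_rad[of n \<theta>]
  show ?thesis unfolding far_def by measurable
qed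

lemma sets_own [measurable]: "own f n v L \<in> sets (channel f n v)"
  unfolding own_def
proof (rule sets.sets_Collect_countable_Ex')
  show "countable (lat n L - {\<lambda>i\<in>{..<n}. 0})" using countable_lat by (rule countable_Diff)
  fix m assume "m \<in> lat n L - {\<lambda>i\<in>{..<n}. 0}"
  then have m: "m \<in> Rn n" using lat_Rn by auto
  note [measurable] = measurable_fst_channel[OF f] measurable_snd_channel[OF f] Rn_space[OF m] measurable_hmul
  show "{w \<in> space (channel f n v). sqdist_n n (snd w) (hmul n (fst w) m) < (\<Sum>i<n. (snd w i)\<^sup>2)} \<in> sets (channel f n v)"
    by measurable
qed

lemma sets_bad [measurable]: "bad f n v \<theta> L s M j \<in> sets (channel f n v)"
  unfolding bad_def by (intro sets.Un sets_far sets_own sets.finite_UN sets_hit f vdiff_Rn) auto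

text \<open>An error means a strictly closer competitor. A translate of the same codeword gives
  \<open>own\<close>; any other one lies within \<open>rad\<close> of the noise, which is a
  \<open>hit\<close>, unless the noise itself exceeds that radius, which is \<open>far\<close>. The
  bound is free of \<open>l\<close>: by periodicity all copies of a codeword share it.\<close>

lemma perr_le_bad:
  assumes j: "j < M" and l: "l \<in> lat n L" and h: "h \<in> space (fadingVecM f n)"
  shows "perr n v (hmul n h ` tiled n L s M) (hmul n h (vadd n (s j) l)) \<le> measure (noiseM n v) (Pair h -` bad f n v \<theta> L s M j)"
proof -
  interpret N: prob_space "noiseM n v" by (rule prob_space_noiseM[OF v])
  let ?p = "hmul n h (vadd n (s j) l)"
  have "{z \<in> space (noiseM n v). vadd n ?p z \<notin> voronoi n (hmul n h ` tiled n L s M) ?p} \<subseteq> Pair h -` bad f n v \<theta> L s M j"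
  proof
    fix z assume "z \<in> {z \<in> space (noiseM n v). vadd n ?p z \<notin> voronoi n (hmul n h ` tiled n L s M) ?p}"
    then have z: "z \<in> space (noiseM n v)" "vadd n ?p z \<notin> voronoi n (hmul n h ` tiled n L s M) ?p" by auto
    have hz: "(h, z) \<in> space (channel f n v)" using h z by (simp add: channel_def space_pair_measure)
    from z(2) obtain u where u: "u \<in> tiled n L s M"
      and less: "sqdist_n n (vadd n ?p z) (hmul n h u) < sqdist_n n (vadd n ?p z) ?p"
      by (auto simp: voronoi_def not_le)
    obtain i l' where i: "i < M" "l' \<in> lat n L" "u = vadd n (s i) l'" using u by (auto simp: tiled_def)
    define m where "m = vdiff n l' l"
    have m: "m \<in> lat n L" unfolding m_def by (intro lat_diff i l)
    have e1: "sqdist_n n (vadd n ?p z) ?p = (\<Sum>i<n. (z i)\<^sup>2)" by (simp add: sqdist_n_def vadd_def)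
    \<comment> \<open>Only the difference of competitor and sent point enters; its codeword part and
      its lattice part are separated to match \<open>hit\<close>.\<close>
    have e2: "sqdist_n n (vadd n ?p z) (hmul n h u) = sqdist_n n z (hmul n h (vadd n (vdiff n (s i) (s j)) m))"
      unfolding sqdist_n_def by (intro sum.cong refl arg_cong[where f="\<lambda>x. x\<^sup>2"])
        (simp add: vadd_def hmul_def vdiff_def m_def i algebra_simps)
    show "z \<in> Pair h -` bad f n v \<theta> L s M j"
    proof (cases "i = j")
      case True
      have e3: "vadd n (vdiff n (s i) (s j)) m = m"
        by (intro Rn_eqI[of _ n] vadd_in_Rn lat_Rn[OF m]) (simp add: vadd_def vdiff_def True)
      have "m \<noteq> (\<lambda>i\<in>{..<n}. 0)"
      proof
        assume "m = (\<lambda>i\<in>{..<n}. 0)"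
        then have "sqdist_n n z (hmul n h m) = (\<Sum>i<n. (z i)\<^sup>2)" by (simp add: sqdist_n_def hmul_def)
        then show False using less e1 e2 e3 by simp
      qed
      then have "(h, z) \<in> own f n v L" using less m hz unfolding own_def e1 e2 e3 by auto
      then show ?thesis by (simp add: bad_def)
    next
      case False
      show ?thesis
      proof (cases "(h, z) \<in> far f n v \<theta>")
        case nf: False
        then have "(\<Sum>i<n. (z i)\<^sup>2) \<le> (rad n \<theta> h)\<^sup>2" using hz by (simp add: far_def)
        then have "sqdist_n n z (hmul n h (vadd n (vdiff n (s i) (s j)) m)) \<le> (rad n \<theta> h)\<^sup>2"
          using less unfolding e1 e2 by simp
        then have "(h, z) \<in> hit f n v \<theta> L (vdiff n (s i) (s j))" using m hz by (auto simp: hit_def)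
        then show ?thesis using i False by (auto simp: bad_def)
      qed (simp add: bad_def)
    qed
  qed
  moreover have "Pair h -` bad f n v \<theta> L s M j \<in> sets (noiseM n v)"
    using sets_bad[of j] unfolding channel_def by (rule sets_Pair1)
  ultimately show ?thesis unfolding perr_def by (intro N.finite_measure_mono)
qed

text \<open>In a cube of side \<open>a\<close> every codeword has between
  \<open>(a / L - 1) ^ n\<close> and \<open>(a / L + 1) ^ n\<close> copies. The ratio of the two
  tends to 1, so boundary effects vanish and the plain mean over the \<open>M\<close> codewords
  remains.\<close>

lemma limsup_err_le_bad:
  assumes h: "h \<in> space (fadingVecM f n)" "\<forall>i<n. 0 < h i"
  shows "limsup_err n v (tiled n L s M) h \<le> (\<Sum>j<M. measure (noiseM n v) (Pair h -` bad f n v \<theta> L s M j)) / M"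
proof -
  let ?S = "tiled n L s M" and ?b = "\<lambda>j. measure (noiseM n v) (Pair h -` bad f n v \<theta> L s M j)"
  define B where "B = (\<Sum>j<M. ?b j)"
  have B0: "0 \<le> B" unfolding B_def by (intro sum_nonneg) auto
  have sR: "s j \<in> Rn n" if "j < M" for j using cell cell_Rn that by blast
  have SR: "?S \<subseteq> Rn n" using tiled_IC by (simp add: IC_def)
  have ev: "eventually (\<lambda>a. ereal (avg_err n v ?S h a) \<le> ereal (((a / L + 1) / (a / L - 1)) ^ n * (B / M))) at_top"
    using eventually_gt_at_top[of L]
  proof eventually_elim
    case (elim a)
    have aL: "a / L - 1 > 0" using elim L by simp
    let ?N = "\<lambda>j. {l \<in> lat n L. vadd n (s j) l \<in> cube n a}"
    have "(\<Sum>p\<in>hmul n h ` (?S \<inter> cube n a). perr n v (hmul n h ` ?S) p) = (\<Sum>p\<in>?S \<inter> cube n a. perr n v (hmul n h ` ?S) (hmul n h p))"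
    proof (rule sum.reindex_cong[OF _ refl refl])
      have "inj_on (hmul n h) ?S" by (rule received_points(2)) (use h SR in auto)
      then show "inj_on (hmul n h) (?S \<inter> cube n a)" by (rule inj_on_subset) auto
    qed
    also have "\<dots> = (\<Sum>j<M. \<Sum>l\<in>?N j. perr n v (hmul n h ` ?S) (hmul n h (vadd n (s j) l)))"
      by (rule tiled_sum(2)[OF elim])
    also have "\<dots> \<le> (\<Sum>j<M. \<Sum>l\<in>?N j. ?b j)"
      by (intro sum_mono perr_le_bad h) auto
    also have "\<dots> = (\<Sum>j<M. card (?N j) * ?b j)" by simp
    also have "\<dots> \<le> (\<Sum>j<M. (a / L + 1) ^ n * ?b j)"
      by (intro sum_mono mult_right_mono lattice_count(3)[OF L elim sR]) auto
    also have "\<dots> = (a / L + 1) ^ n * B" by (simp add: B_def sum_distrib_left)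
    finally have num: "(\<Sum>p\<in>hmul n h ` (?S \<inter> cube n a). perr n v (hmul n h ` ?S) p) \<le> (a / L + 1) ^ n * B" .
    have den: "M * (a / L - 1) ^ n \<le> card (?S \<inter> cube n a)" by (rule tiled_card(1)[OF elim])
    have "avg_err n v ?S h a = (\<Sum>p\<in>hmul n h ` (?S \<inter> cube n a). perr n v (hmul n h ` ?S) p) / card (?S \<inter> cube n a)"
      by (rule avg_err_eq) (use h SR in auto)
    also have "\<dots> \<le> ((a / L + 1) ^ n * B) / (M * (a / L - 1) ^ n)"
      using num den aL M B0 by (intro frac_le) (auto intro!: mult_nonneg_nonneg)
    also have "\<dots> = ((a / L + 1) / (a / L - 1)) ^ n * (B / M)" by (simp add: power_divide)
    finally show ?case by simp
  qed
  have "((\<lambda>a. ((a / L + 1) / (a / L - 1)) ^ n * (B / M)) \<longlongrightarrow> 1 ^ n * (B / M)) at_top"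
  proof (intro tendsto_mult_right tendsto_power)
    show "((\<lambda>a. (a / L + 1) / (a / L - 1)) \<longlongrightarrow> 1) at_top" using L by real_asymp
  qed
  then have lim: "((\<lambda>a. ereal (((a / L + 1) / (a / L - 1)) ^ n * (B / M))) \<longlongrightarrow> ereal (B / M)) at_top" by simp
  have "ereal (limsup_err n v ?S h) \<le> Limsup at_top (\<lambda>a. ereal (((a / L + 1) / (a / L - 1)) ^ n * (B / M)))"
    unfolding limsup_err_ereal(1)[OF v, symmetric] by (rule Limsup_mono[OF ev])
  also have "\<dots> = ereal (B / M)" using lim by (intro lim_imp_Limsup) simp_all
  finally show ?thesis by (simp add: B_def)
qed

lemma section_integral:
  assumes E: "E \<in> sets (channel f n v)"
  shows "integrable (fadingVecM f n) (\<lambda>h. measure (noiseM n v) (Pair h -` E))"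
    "(\<integral>h. measure (noiseM n v) (Pair h -` E) \<partial>fadingVecM f n) = measure (channel f n v) E"
proof -
  interpret C: prob_space "channel f n v" by (rule prob_space_channel[OF f v])
  interpret N: prob_space "noiseM n v" by (rule prob_space_noiseM[OF v])
  interpret F: prob_space "fadingVecM f n" by (rule prob_space_fadingVecM[OF f])
  have "(\<lambda>h. emeasure (noiseM n v) (Pair h -` E)) \<in> borel_measurable (fadingVecM f n)"
    using E unfolding channel_def by (rule N.measurable_emeasure_Pair)
  then have m: "(\<lambda>h. measure (noiseM n v) (Pair h -` E)) \<in> borel_measurable (fadingVecM f n)"
    unfolding measure_def by measurable
  then show i: "integrable (fadingVecM f n) (\<lambda>h. measure (noiseM n v) (Pair h -` E))"
    by (intro F.integrable_const_bound[of _ 1]) auto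
  have "ennreal (\<integral>h. measure (noiseM n v) (Pair h -` E) \<partial>fadingVecM f n) = (\<integral>\<^sup>+h. ennreal (measure (noiseM n v) (Pair h -` E)) \<partial>fadingVecM f n)"
    using i by (intro nn_integral_eq_integral[symmetric]) auto
  also have "\<dots> = emeasure (channel f n v) E"
    using N.emeasure_pair_measure_alt[OF E[unfolded channel_def]] unfolding channel_def by (simp add: N.emeasure_eq_measure)
  also have "\<dots> = ennreal (measure (channel f n v) E)" by (rule C.emeasure_eq_measure)
  finally show "(\<integral>h. measure (noiseM n v) (Pair h -` E) \<partial>fadingVecM f n) = measure (channel f n v) E"
    by (subst (asm) ennreal_inj) (auto intro!: Bochner_Integration.integral_nonneg)
qed

text \<open>Union bound over the three kinds of error after integrating over the fading. The double
  sum over distinct pairs is the quantity that the greedy choice controls.\<close>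

lemma Pe_tiled_le:
  "Pe f n (tiled n L s M) v \<le> measure (channel f n v) (far f n v \<theta>) + measure (channel f n v) (own f n v L)
     + (\<Sum>j<M. \<Sum>i\<in>{..<M} - {j}. measure (channel f n v) (hit f n v \<theta> L (vdiff n (s i) (s j)))) / M"
proof -
  interpret C: prob_space "channel f n v" by (rule prob_space_channel[OF f v])
  let ?\<mu> = "measure (channel f n v)"
  let ?b = "\<lambda>j h. measure (noiseM n v) (Pair h -` bad f n v \<theta> L s M j)"
  have "Pe f n (tiled n L s M) v \<le> (\<integral>h. (\<Sum>j<M. ?b j h) / M \<partial>fadingVecM f n)"
    unfolding Pe_eq
  proof (rule integral_mono_AE)
    show "integrable (fadingVecM f n) (limsup_err n v (tiled n L s M))"
      by (rule integrable_limsup_err[OF f v tiled_IC])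
    show "integrable (fadingVecM f n) (\<lambda>h. (\<Sum>j<M. ?b j h) / M)"
      using section_integral(1)[OF sets_bad] by (intro integrable_divide Bochner_Integration.integrable_sum) auto
    show "AE h in fadingVecM f n. limsup_err n v (tiled n L s M) h \<le> (\<Sum>j<M. ?b j h) / M"
      using AE_fadingVecM_pos[OF f] AE_space by eventually_elim (rule limsup_err_le_bad)
  qed
  also have "\<dots> = (\<Sum>j<M. ?\<mu> (bad f n v \<theta> L s M j)) / M"
    using section_integral[OF sets_bad] by (simp add: Bochner_Integration.integral_sum)
  also have "\<dots> \<le> (\<Sum>j<M. ?\<mu> (far f n v \<theta>) + ?\<mu> (own f n v L) + (\<Sum>i\<in>{..<M} - {j}. ?\<mu> (hit f n v \<theta> L (vdiff n (s i) (s j))))) / M"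
  proof (intro divide_right_mono sum_mono)
    fix j
    have hs: "hit f n v \<theta> L (vdiff n (s i) (s j)) \<in> sets (channel f n v)" for i by (rule sets_hit[OF f vdiff_Rn])
    have "?\<mu> (bad f n v \<theta> L s M j) \<le> ?\<mu> (far f n v \<theta> \<union> own f n v L) + ?\<mu> (\<Union>i\<in>{..<M} - {j}. hit f n v \<theta> L (vdiff n (s i) (s j)))"
      unfolding bad_def by (intro measure_Un_le sets.Un sets_far sets_own sets.finite_UN hs) auto
    also have "?\<mu> (far f n v \<theta> \<union> own f n v L) \<le> ?\<mu> (far f n v \<theta>) + ?\<mu> (own f n v L)"
      by (intro measure_Un_le sets_far sets_own)
    also have "?\<mu> (\<Union>i\<in>{..<M} - {j}. hit f n v \<theta> L (vdiff n (s i) (s j))) \<le> (\<Sum>i\<in>{..<M} - {j}. ?\<mu> (hit f n v \<theta> L (vdiff n (s i) (s j))))"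
      by (intro measure_UNION_le hs) auto
    finally show "?\<mu> (bad f n v \<theta> L s M j) \<le> ?\<mu> (far f n v \<theta>) + ?\<mu> (own f n v L) + (\<Sum>i\<in>{..<M} - {j}. ?\<mu> (hit f n v \<theta> L (vdiff n (s i) (s j))))"
      by simp
  qed simp
  also have "\<dots> = ?\<mu> (far f n v \<theta>) + ?\<mu> (own f n v L) + (\<Sum>j<M. \<Sum>i\<in>{..<M} - {j}. ?\<mu> (hit f n v \<theta> L (vdiff n (s i) (s j)))) / M"
    using M by (simp add: sum.distrib add_divide_distrib)
  finally show ?thesis .
qed

end
end

section \<open>Existence of good codes\<close>

context
  fixes f :: "real \<Rightarrow> real"
  assumes f: "regular_fading f"
begin

text \<open>A nonzero lattice vector has an entry of modulus at least \<open>k\<close>. If its faded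
  image is closer to the noise than the origin is, the triangle inequality in that coordinate gives
  \<open>k * h i \<le> 2 * R\<close>. These events decrease in \<open>k\<close>, and restricting
  them to positive coefficients makes their intersection empty.\<close>

lemma own_tendsto:
  assumes v: "v > 0" and n: "n > 0"
  shows "(\<lambda>k::nat. measure (channel f n v) (own f n v (real k))) \<longlonglongrightarrow> 0"
proof -
  interpret C: prob_space "channel f n v" by (rule prob_space_channel[OF f v])
  define R where "R w = sqrt (\<Sum>i<n. (snd w i)\<^sup>2)" for w :: "(nat \<Rightarrow> real) \<times> (nat \<Rightarrow> real)"
  let ?D = "\<lambda>k::nat. {w \<in> space (channel f n v). \<exists>i<n. 0 < fst w i \<and> real k * fst w i \<le> 2 * R w}"
  note [measurable] = measurable_fst_channel[OF f] measurable_snd_channel[OF f]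
  have m: "range ?D \<subseteq> sets (channel f n v)"
  proof safe
    fix k
    show "?D k \<in> sets (channel f n v)" unfolding R_def by measurable
  qed
  have dec: "decseq ?D"
  proof (rule decseq_SucI, safe)
    fix k w i assume "i < n" "0 < fst w i" and *: "real (Suc k) * fst w i \<le> 2 * R w"
    then show "\<exists>i<n. 0 < fst w i \<and> real k * fst w i \<le> 2 * R w"
      by (intro exI[of _ i]) (auto simp: algebra_simps)
  qed
  have "(\<Inter>k. ?D k) = {}"
  proof (safe, goal_cases)
    case (1 h z)
    let ?w = "(h, z)"
    obtain k :: nat where k: "(\<Sum>i<n. \<bar>2 * R ?w / h i\<bar>) < real k" using reals_Archimedean2 by blast
    from 1 have "?w \<in> ?D k" by blast
    then obtain i where i: "i < n" "0 < h i" "real k * h i \<le> 2 * R ?w" by auto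
    have "\<bar>2 * R ?w / h i\<bar> \<le> (\<Sum>i<n. \<bar>2 * R ?w / h i\<bar>)"
      using i by (intro member_le_sum[of i _ "\<lambda>i. \<bar>2 * R ?w / h i\<bar>"]) auto
    then have "2 * R ?w / h i < real k" using k by linarith
    then have False using i by (simp add: field_simps)
    then show ?case ..
  qed
  then have lim: "(\<lambda>k. measure (channel f n v) (?D k)) \<longlonglongrightarrow> 0"
    using C.finite_Lim_measure_decseq[OF m dec] by simp
  have le: "measure (channel f n v) (own f n v (real k)) \<le> measure (channel f n v) (?D k)" for k
  proof (rule C.finite_measure_mono_AE)
    show "?D k \<in> sets (channel f n v)" using m by auto
    show "AE w in channel f n v. w \<in> own f n v (real k) \<longrightarrow> w \<in> ?D k"
      using AE_channel_pos[OF f v, of n] AE_space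
    proof eventually_elim
      case (elim w)
      show ?case
      proof
        assume "w \<in> own f n v (real k)"
        then obtain l where l: "l \<in> lat n (real k)" "l \<noteq> (\<lambda>i\<in>{..<n}. 0)"
          and less: "sqdist_n n (snd w) (hmul n (fst w) l) < (\<Sum>i<n. (snd w i)\<^sup>2)" by (auto simp: own_def)
        have "\<exists>i<n. l i \<noteq> 0"
        proof (rule ccontr)
          assume "\<not> (\<exists>i<n. l i \<noteq> 0)"
          then have "l = (\<lambda>i\<in>{..<n}. 0)" using lat_Rn[OF l(1)] by (intro Rn_eqI[of _ n]) (auto simp: Rn_def)
          then show False using l(2) by simp
        qed
        then obtain i where i: "i < n" "l i \<noteq> 0" by blast
        have "l i \<in> range (\<lambda>k'::int. real k * real_of_int k')" using l(1) i by (auto simp: lat_def PiE_iff)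
        then obtain k' :: int where k': "l i = real k * k'" by blast
        then have "\<bar>real_of_int k'\<bar> \<ge> 1" using i by auto
        then have li: "real k \<le> \<bar>l i\<bar>" unfolding k' abs_mult using mult_left_mono[of 1 "\<bar>real_of_int k'\<bar>" "real k"] by simp
        have R0: "(R w)\<^sup>2 = (\<Sum>i<n. (snd w i)\<^sup>2)" "R w \<ge> 0" unfolding R_def by (simp_all add: sum_nonneg)
        have "(snd w i - fst w i * l i)\<^sup>2 \<le> sqdist_n n (snd w) (hmul n (fst w) l)"
          unfolding sqdist_n_def using i member_le_sum[of i "{..<n}" "\<lambda>i. (snd w i - hmul n (fst w) l i)\<^sup>2"]
          by (simp add: hmul_def)
        then have "(snd w i - fst w i * l i)\<^sup>2 \<le> (R w)\<^sup>2" using less R0 by simp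
        then have a: "\<bar>snd w i - fst w i * l i\<bar> \<le> R w" using R0(2) by (metis abs_le_square_iff abs_of_nonneg)
        have "(snd w i)\<^sup>2 \<le> (R w)\<^sup>2" unfolding R0 using i by (intro member_le_sum[of i _ "\<lambda>i. (snd w i)\<^sup>2"]) auto
        then have b: "\<bar>snd w i\<bar> \<le> R w" using R0(2) by (metis abs_le_square_iff abs_of_nonneg)
        have h: "0 < fst w i" using elim i by simp
        have "real k * fst w i \<le> \<bar>l i\<bar> * fst w i" using li h by (intro mult_right_mono) auto
        also have "\<dots> = \<bar>fst w i * l i\<bar>" using h by (simp add: abs_mult)
        also have "\<dots> \<le> 2 * R w" using a b by linarith
        finally show "w \<in> ?D k" using i h elim by auto
      qed
    qed
  qed
  show ?thesis by (rule tendsto_sandwich[OF _ _ tendsto_const lim]) (auto simp: le)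
qed

text \<open>The counterpart of the computation in \<open>Pe_ge_exceed\<close>, with
  \<open>rad\<close> in place of the effective radius at density 1: shrinking the volume by
  \<open>\<theta>\<close> shifts the threshold by \<open>2 / n * ln \<theta>\<close>.\<close>

lemma far_le_exceed:
  assumes v: "v > 0" and n: "n > 0" and th: "\<theta> > 0"
  shows "measure (channel f n v) (far f n v \<theta>) \<le> measure (channel f n v) (exceed f n v
    (E_lnH2 f - ln v - 2 / real n * ln (unit_ball_vol (real n)) - ln (real n) + 2 / real n * ln \<theta>))"
proof -
  interpret C: prob_space "channel f n v" by (rule prob_space_channel[OF f v])
  define y where "y = E_lnH2 f - ln v - 2 / real n * ln (unit_ball_vol (real n)) - ln (real n) + 2 / real n * ln \<theta>"
  have "measure (channel f n v) (far f n v \<theta>) \<le> measure (channel f n v) (exceed f n v y)"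
  proof (rule C.finite_measure_mono_AE[OF _ measurable_exceed[OF f]])
    show "AE w in channel f n v. w \<in> far f n v \<theta> \<longrightarrow> w \<in> exceed f n v y"
      using AE_channel_pos[OF f v, of n]
    proof eventually_elim
      case (elim w)
      show ?case
      proof
        assume w: "w \<in> far f n v \<theta>"
        define Z where "Z = (\<Sum>i<n. (snd w i)\<^sup>2)"
        have h: "\<And>i. i < n \<Longrightarrow> 0 < fst w i" using elim by simp
        have rd1: "rad n \<theta> (fst w) > 0" by (rule rad_pos(1)[OF n th h])
        have rd3: "2 * ln (rad n \<theta> (fst w)) = 2 / n * (ln \<theta> + (\<Sum>i<n. ln (fst w i)) - ln (unit_ball_vol n))"
          by (rule rad_pos(3)[OF n th h])
        have r: "(rad n \<theta> (fst w))\<^sup>2 < Z" using w by (simp add: far_def Z_def)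
        then have Z: "Z > 0" by (meson le_less_trans zero_le_power2)
        have "ln ((rad n \<theta> (fst w))\<^sup>2) < ln Z" using r rd1 Z by (subst ln_less_cancel_iff) auto
        then have "2 / n * (ln \<theta> + (\<Sum>i<n. ln (fst w i)) - ln (unit_ball_vol n)) < ln Z"
          unfolding rd3[symmetric] using rd1 by (simp add: ln_realpow)
        moreover have "(\<Sum>i<n. ln ((fst w i)\<^sup>2) - E_lnH2 f) / n = 2 / n * (\<Sum>i<n. ln (fst w i)) - E_lnH2 f"
        proof -
          have "(\<Sum>i<n. ln ((fst w i)\<^sup>2) - E_lnH2 f) = 2 * (\<Sum>i<n. ln (fst w i)) - n * E_lnH2 f"
            unfolding sum_subtractf by (simp add: ln_realpow sum_distrib_left)
          then show ?thesis using n by (simp add: diff_divide_distrib)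
        qed
        moreover have "ln (Z / (n * v)) = ln Z - ln n - ln v"
          using Z n v by (simp add: ln_divide_pos ln_mult_pos)
        ultimately have "y < log_ratio f n v w"
          unfolding y_def log_ratio_def Z_def[symmetric] by (simp add: right_diff_distrib distrib_left)
        then show "w \<in> exceed f n v y" using w Z by (simp add: exceed_def far_def Z_def)
      qed
    qed
  qed
  then show ?thesis unfolding y_def .
qed

text \<open>Density 1 makes \<open>NLD\<close> vanish, so the volume-to-noise ratio is determined by
  \<open>v\<close> alone.\<close>

lemma good_code:
  assumes n: "n > 0" and v: "v > 0" and th: "\<theta> > 0" and eta: "\<eta> > 0"
  obtains S where "IC n S" "dens n S = 1"
    "Pe f n S v \<le> measure (channel f n v) (exceed f n v
       (E_lnH2 f - ln v - 2 / real n * ln (unit_ball_vol (real n)) - ln (real n) + 2 / real n * ln \<theta>)) + \<eta> + 2 * \<theta>"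
proof -
  have "eventually (\<lambda>k::nat. measure (channel f n v) (own f n v (real k)) < \<eta> \<and> k > 0) sequentially"
    using order_tendstoD(2)[OF own_tendsto[OF v n] eta] eventually_gt_at_top[of 0] by (rule eventually_conj)
  then obtain k :: nat where k: "measure (channel f n v) (own f n v (real k)) < \<eta>" "k > 0"
    using eventually_happens trivial_limit_sequentially by blast
  define L where "L = real k"
  \<comment> \<open>With an integer period \<open>k\<close>, taking \<open>k ^ n\<close> points per
    cell gives density exactly 1. The greedy bound \<open>2 * M\<^sup>2 * \<theta> / L ^ n\<close>,
    divided by \<open>M\<close>, is then \<open>2 * \<theta>\<close>.\<close>
  define M where "M = k ^ n"
  have L: "L > 0" and M: "M > 0" "real M = L ^ n" using k by (auto simp: L_def M_def)
  obtain s where s: "inj_on s {..<M}" "s ` {..<M} \<subseteq> cell n L"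
    and E: "(\<Sum>i<M. \<Sum>j\<in>{..<M} - {i}. measure (channel f n v) (hit f n v \<theta> L (vdiff n (s j) (s i)))) \<le> 2 * (real M)\<^sup>2 * (\<theta> / L ^ n)"
    using greedy_code[OF f n L v th, of M] by blast
  note ctx = n L s M(1)
  have "(\<Sum>i<M. \<Sum>j\<in>{..<M} - {i}. measure (channel f n v) (hit f n v \<theta> L (vdiff n (s j) (s i)))) / M \<le> 2 * (real M)\<^sup>2 * (\<theta> / L ^ n) / M"
    by (rule divide_right_mono[OF E]) simp
  also have "\<dots> = 2 * \<theta>" using M by (simp add: M(2)[symmetric] power2_eq_square)
  finally have E': "(\<Sum>i<M. \<Sum>j\<in>{..<M} - {i}. measure (channel f n v) (hit f n v \<theta> L (vdiff n (s j) (s i)))) / M \<le> 2 * \<theta>" .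
  show thesis
  proof (rule that[of "tiled n L s M"])
    show "IC n (tiled n L s M)" by (rule tiled_IC)
    show "dens n (tiled n L s M) = 1" unfolding tiled_dens[OF ctx] using M L by (simp add: one_ereal_def)
    show "Pe f n (tiled n L s M) v \<le> measure (channel f n v) (exceed f n v
       (E_lnH2 f - ln v - 2 / real n * ln (unit_ball_vol (real n)) - ln (real n) + 2 / real n * ln \<theta>)) + \<eta> + 2 * \<theta>"
      using Pe_tiled_le[OF ctx f v, of \<theta>] far_le_exceed[OF v n th] k(1) E' unfolding L_def[symmetric] by linarith
  qed
qed

end

section \<open>The dispersion expansion\<close>

lemma exp_le_second_order:
  fixes x :: real assumes "\<bar>x\<bar> \<le> 1"
  shows "exp x \<le> 1 + x + x\<^sup>2"
proof (cases "x \<ge> 0")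
  case True
  then show ?thesis using exp_bound[of x] assms by simp
next
  case False
  then have "exp x \<le> 1 + x + x\<^sup>2 / 2" using exp_minus_second_order[of "- x"] by simp
  also have "\<dots> \<le> 1 + x + x\<^sup>2" by simp
  finally show ?thesis .
qed

lemma rate_times_sqrt:
  assumes "n > 0"
  shows "ln (real n) / real n * sqrt (real n) = ln (real n) / sqrt (real n)"
proof -
  have "ln (real n) / real n * sqrt (real n) = ln (real n) / (real n / sqrt (real n))" using assms by simp
  then show ?thesis by (simp add: real_div_sqrt)
qed

lemma VNR_pos: "v > 0 \<Longrightarrow> VNR f n S v > 0"
  by (simp add: VNR_def)

lemma VNR_antimono: "0 < v \<Longrightarrow> v \<le> w \<Longrightarrow> VNR f n S w \<le> VNR f n S v"
  unfolding VNR_def by (intro divide_left_mono) auto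

context
  fixes f :: "real \<Rightarrow> real" and \<epsilon> s q :: real
  assumes f: "regular_fading f" and eps: "0 < \<epsilon>" "\<epsilon> < 1"
  defines "s \<equiv> sqrt (2 + Var_lnH2 f)" and "q \<equiv> Qinv \<epsilon>"
begin

lemma dispersion_pos: "s > 0"
proof -
  have "Var_lnH2 f \<ge> 0" unfolding Var_lnH2_def by (intro Bochner_Integration.integral_nonneg) auto
  then show ?thesis by (simp add: s_def)
qed

lemma eventually_rate_le:
  obtains N where "\<And>n::nat. n \<ge> N \<Longrightarrow> c * (ln (real n) / real n) * sqrt (real n) \<le> 1"
proof -
  have "(\<lambda>n::nat. c * (ln (real n) / real n) * sqrt (real n)) \<longlonglongrightarrow> 0" by real_asymp
  then have "eventually (\<lambda>n::nat. c * (ln (real n) / real n) * sqrt (real n) < 1) sequentially"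
    by (rule order_tendstoD) simp
  then show thesis using that by (force simp: eventually_sequentially)
qed

text \<open>Below this ratio the argument of the Gaussian tail lies under \<open>q\<close> by at
  least \<open>t\<close>, of order \<open>ln n / sqrt n\<close>, and the slope of
  \<open>Qfun\<close> turns that into a gain over \<open>\<epsilon>\<close> larger than the
  Berry-Esseen error. Strictness excludes codes whose error is exactly
  \<open>\<epsilon>\<close>.\<close>

lemma converse:
  obtains K N where "\<And>n S v. n \<ge> N \<Longrightarrow> IC n S \<Longrightarrow> 0 < dens n S \<Longrightarrow> dens n S < \<infinity> \<Longrightarrow> v > 0 \<Longrightarrow>
    ln (VNR f n S v) \<le> s * q / sqrt (real n) - K * (ln (real n) / real n) \<Longrightarrow> \<epsilon> < Pe f n S v"
proof -
  note s = dispersion_pos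
  obtain C1 N1 where C1: "C1 \<ge> 0" "\<And>n v y. n \<ge> N1 \<Longrightarrow> v > 0 \<Longrightarrow>
      Qfun ((y + 4 * ln (real n) / real n) * sqrt (real n) / s) - C1 / sqrt (real n) \<le> measure (channel f n v) (exceed f n v y)"
    using exceed_tail[OF f] unfolding s_def by metis
  obtain C2 where C2: "C2 \<ge> 0" "\<And>n::nat. n \<ge> 3 \<Longrightarrow> \<bar>2 / real n * ln (unit_ball_vol (real n)) - (ln (2 * pi * exp 1) - ln (real n))\<bar> \<le> C2 * (ln (real n) / real n)"
    by (rule unit_ball_vol_asymp) (rule that; blast)
  obtain m where m: "m > 0" "\<And>t. 0 \<le> t \<Longrightarrow> t \<le> 1 \<Longrightarrow> Qfun q + m * t \<le> Qfun (q - t)"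
    "\<And>t. 0 \<le> t \<Longrightarrow> t \<le> 1 \<Longrightarrow> Qfun (q + t) \<le> Qfun q - m * t"
    by (rule Qfun_local_slope[of q]) (rule that; blast)
  \<comment> \<open>Chosen to give \<open>m * t = (C1 + 1) * ln n / sqrt n\<close>, which exceeds
    \<open>C1 / sqrt n\<close> once \<open>ln n \<ge> 1\<close>.\<close>
  define K' where "K' = s * (C1 + 1) / m"
  have K': "K' > 0" using s C1 m by (simp add: K'_def)
  obtain N2 where N2: "\<And>n::nat. n \<ge> N2 \<Longrightarrow> K' / s * (ln (real n) / real n) * sqrt (real n) \<le> 1"
    by (rule eventually_rate_le) (rule that; blast)
  show thesis
  \<comment> \<open>\<open>C2\<close> pays for the ball volume and 4 for the shift
    \<open>4 * ln n / n\<close> in the lower tail bound.\<close>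
  proof (rule that[of "max (max N1 N2) 3" "K' + C2 + 4"])
    fix n :: nat and S v
    assume n: "n \<ge> max (max N1 N2) 3" and S: "IC n S" "0 < dens n S" "dens n S < \<infinity>" and v: "v > 0"
      and le: "ln (VNR f n S v) \<le> s * q / sqrt (real n) - (K' + C2 + 4) * (ln (real n) / real n)"
    have n3: "n \<ge> 3" and n0: "n > 0" using n by auto
    define l where "l = ln (real n) / real n"
    define y where "y = ln (VNR f n S v) - (2 / real n * ln (unit_ball_vol (real n)) - (ln (2 * pi * exp 1) - ln (real n)))"
    define t where "t = K' / s * l * sqrt (real n)"
    have ln1: "1 \<le> ln (real n)" by (rule ln_ge_1[OF n3])
    have l0: "l \<ge> 0" using ln1 by (simp add: l_def)
    have t: "0 \<le> t" "t \<le> 1" using N2[of n] n K' s l0 by (auto simp: t_def l_def)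
    have "(y + 4 * ln (real n) / real n) \<le> s * q / sqrt (real n) - K' * l"
    proof -
      have "4 * ln (real n) / real n = 4 * l" by (simp add: l_def)
      moreover have "(K' + C2 + 4) * l = K' * l + C2 * l + 4 * l" by (simp add: distrib_right)
      ultimately show ?thesis using abs_le_D2[OF C2(2)[OF n3]] le unfolding y_def l_def[symmetric] by linarith
    qed
    then have "(y + 4 * ln (real n) / real n) * sqrt (real n) / s \<le> (s * q / sqrt (real n) - K' * l) * sqrt (real n) / s"
      using s by (intro divide_right_mono mult_right_mono) auto
    also have "\<dots> = q - t" using s n0 by (simp add: t_def left_diff_distrib diff_divide_distrib)
    finally have "Qfun (q - t) \<le> Qfun ((y + 4 * ln (real n) / real n) * sqrt (real n) / s)" by (rule Qfun_antimono)
    moreover have "Qfun q + m * t \<le> Qfun (q - t)" by (rule m(2)[OF t])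
    moreover have "Qfun q = \<epsilon>" unfolding q_def by (rule Qfun_Qinv[OF eps])
    moreover have "Qfun ((y + 4 * ln (real n) / real n) * sqrt (real n) / s) - C1 / sqrt (real n) \<le> Pe f n S v"
      using C1(2)[of n v y] Pe_ge_exceed[OF f v S n0] n v unfolding y_def by simp
    moreover have "C1 / sqrt (real n) < m * t"
    proof -
      have lq: "l * sqrt (real n) = ln (real n) / sqrt (real n)" unfolding l_def by (rule rate_times_sqrt[OF n0])
      have "m * t = (C1 + 1) * (l * sqrt (real n))"
        using m s by (simp add: t_def K'_def)
      then have "m * t = (C1 + 1) * ln (real n) / sqrt (real n)" unfolding lq by simp
      moreover have "C1 < (C1 + 1) * ln (real n)"
      proof -
        have "C1 < (C1 + 1) * 1" by simp
        also have "\<dots> \<le> (C1 + 1) * ln (real n)" using ln1 C1(1) by (intro mult_left_mono) auto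
        finally show ?thesis .
      qed
      ultimately show ?thesis using n0 by (simp add: divide_strict_right_mono)
    qed
    ultimately show "\<epsilon> < Pe f n S v" by linarith
  qed
qed

lemma achievability:
  obtains K N where "\<And>n. n \<ge> N \<Longrightarrow> \<exists>S v. IC n S \<and> dens n S = 1 \<and> v > 0 \<and>
    ln (VNR f n S v) = s * q / sqrt (real n) + K * (ln (real n) / real n) \<and> Pe f n S v \<le> \<epsilon>"
proof -
  note s = dispersion_pos
  obtain C1 N1 where C1: "C1 \<ge> 0" "\<And>n v y. n \<ge> N1 \<Longrightarrow> v > 0 \<Longrightarrow>
      measure (channel f n v) (exceed f n v y) \<le> Qfun (y * sqrt (real n) / s) + C1 / sqrt (real n)"
    using exceed_tail[OF f] unfolding s_def by metis
  obtain C2 where C2: "C2 \<ge> 0" "\<And>n::nat. n \<ge> 3 \<Longrightarrow> \<bar>2 / real n * ln (unit_ball_vol (real n)) - (ln (2 * pi * exp 1) - ln (real n))\<bar> \<le> C2 * (ln (real n) / real n)"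
    by (rule unit_ball_vol_asymp) (rule that; blast)
  obtain m where m: "m > 0" "\<And>t. 0 \<le> t \<Longrightarrow> t \<le> 1 \<Longrightarrow> Qfun q + m * t \<le> Qfun (q - t)"
    "\<And>t. 0 \<le> t \<Longrightarrow> t \<le> 1 \<Longrightarrow> Qfun (q + t) \<le> Qfun q - m * t"
    by (rule Qfun_local_slope[of q]) (rule that; blast)
  \<comment> \<open>\<open>C1 + 3\<close> covers the Berry-Esseen error, one \<open>\<theta>\<close>
    for a codeword's own translates and \<open>2 * \<theta>\<close> for the other codewords, where
    \<open>\<theta> = 1 / sqrt n\<close>.\<close>
  define K' where "K' = s * (C1 + 3) / m"
  have K': "K' > 0" using s C1 m by (simp add: K'_def)
  \<comment> \<open>\<open>C2\<close> pays for the ball volume and 1 for the shrunken radius, since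
    \<open>2 / n * ln \<theta> = - ln n / n\<close>.\<close>
  define K where "K = K' + C2 + 1"
  obtain N2 where N2: "\<And>n::nat. n \<ge> N2 \<Longrightarrow> K' / s * (ln (real n) / real n) * sqrt (real n) \<le> 1"
    by (rule eventually_rate_le) (rule that; blast)
  show thesis
  proof (rule that[of "max (max N1 N2) 3" K])
    fix n :: nat
    assume n: "n \<ge> max (max N1 N2) 3"
    have n3: "n \<ge> 3" and n0: "n > 0" using n by auto
    define l where "l = ln (real n) / real n"
    define x where "x = s * q / sqrt (real n) + K * l"
    \<comment> \<open>This variance gives \<open>ln (VNR f n S v) = x\<close> for every
      \<open>S\<close> of density 1, so it can be fixed before the code is chosen.\<close>
    define v where "v = exp (E_lnH2 f - x) / (2 * pi * exp 1)"
    define \<theta> where "\<theta> = 1 / sqrt (real n)"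
    have v: "v > 0" by (simp add: v_def)
    have th: "\<theta> > 0" using n0 by (simp add: \<theta>_def)
    define y where "y = E_lnH2 f - ln v - 2 / real n * ln (unit_ball_vol (real n)) - ln (real n) + 2 / real n * ln \<theta>"
    obtain S where S: "IC n S" "dens n S = 1" and Pe: "Pe f n S v \<le> measure (channel f n v) (exceed f n v y) + \<theta> + 2 * \<theta>"
      using good_code[OF f n0 v th th] unfolding y_def by blast
    have lnv: "ln v = E_lnH2 f - x - ln (2 * pi * exp 1)" unfolding v_def by (subst ln_divide_pos) auto
    have V: "VNR f n S v = exp x"
    proof -
      have "2 * pi * exp 1 * v = exp (E_lnH2 f - x)" by (simp add: v_def)
      then have "VNR f n S v = exp (E_lnH2 f) / exp (E_lnH2 f - x)" unfolding VNR_def NLD_def S(2) by simp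
      then show ?thesis by (simp add: exp_diff)
    qed
    define t where "t = K' / s * l * sqrt (real n)"
    have ln1: "1 \<le> ln (real n)" by (rule ln_ge_1[OF n3])
    have l0: "l \<ge> 0" using ln1 by (simp add: l_def)
    have t: "0 \<le> t" "t \<le> 1" using N2[of n] n K' s l0 by (auto simp: t_def l_def)
    have ln_th: "2 / real n * ln \<theta> = - l" unfolding \<theta>_def l_def using n0 by (simp add: ln_div ln_sqrt)
    have "s * q / sqrt (real n) + K' * l \<le> y"
    proof -
      have "(K' + C2 + 1) * l = K' * l + C2 * l + l" by (simp add: distrib_right)
      then show ?thesis
        using ln_th abs_le_D1[OF C2(2)[OF n3]] unfolding y_def lnv x_def K_def l_def[symmetric] by linarith
    qed
    then have "(s * q / sqrt (real n) + K' * l) * sqrt (real n) / s \<le> y * sqrt (real n) / s"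
      using s by (intro divide_right_mono mult_right_mono) auto
    also have "(s * q / sqrt (real n) + K' * l) * sqrt (real n) / s = q + t"
      using s n0 by (simp add: t_def distrib_right add_divide_distrib)
    finally have "Qfun (y * sqrt (real n) / s) \<le> Qfun (q + t)" by (rule Qfun_antimono)
    moreover have "Qfun (q + t) \<le> Qfun q - m * t" by (rule m(3)[OF t])
    moreover have "Qfun q = \<epsilon>" unfolding q_def by (rule Qfun_Qinv[OF eps])
    moreover have "measure (channel f n v) (exceed f n v y) \<le> Qfun (y * sqrt (real n) / s) + C1 / sqrt (real n)"
      using C1(2)[of n v y] n v by simp
    moreover have "C1 / sqrt (real n) + \<theta> + 2 * \<theta> \<le> m * t"
    proof -
      have lq: "l * sqrt (real n) = ln (real n) / sqrt (real n)" unfolding l_def by (rule rate_times_sqrt[OF n0])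
      have "m * t = (C1 + 3) * (l * sqrt (real n))"
        using m s by (simp add: t_def K'_def)
      then have "m * t = (C1 + 3) * ln (real n) / sqrt (real n)" unfolding lq by simp
      moreover have "C1 + 3 \<le> (C1 + 3) * ln (real n)" using mult_left_mono[OF ln1, of "C1 + 3"] C1(1) by simp
      moreover have "C1 / sqrt (real n) + \<theta> + 2 * \<theta> = (C1 + 3) / sqrt (real n)" by (simp add: \<theta>_def add_divide_distrib)
      ultimately show ?thesis by (simp add: divide_right_mono)
    qed
    ultimately have "Pe f n S v \<le> \<epsilon>" using Pe by linarith
    then show "\<exists>S v. IC n S \<and> dens n S = 1 \<and> v > 0 \<and>
      ln (VNR f n S v) = s * q / sqrt (real n) + K * (ln (real n) / real n) \<and> Pe f n S v \<le> \<epsilon>"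
      using S v V unfolding x_def l_def by (intro exI[of _ S] exI[of _ v]) simp
  qed
qed

text \<open>The lower bound is the converse applied to every admissible pair. For the upper bound, a
  good code with error at most \<open>\<epsilon>\<close> need not be admissible. Raising the
  variance lowers the ratio; once the ratio is below the converse threshold the error exceeds
  \<open>\<epsilon>\<close>, and by continuity equality holds in between.\<close>

lemma mu_star_bounds:
  obtains K1 K2 N where "\<And>n. n \<ge> N \<Longrightarrow>
      exp (s * q / sqrt (real n) - K1 * (ln (real n) / real n)) \<le> mu_star f n \<epsilon> \<and>
      mu_star f n \<epsilon> \<le> exp (s * q / sqrt (real n) + K2 * (ln (real n) / real n))"
proof -
  obtain K1 N1 where conv: "\<And>n S v. n \<ge> N1 \<Longrightarrow> IC n S \<Longrightarrow> 0 < dens n S \<Longrightarrow> dens n S < \<infinity> \<Longrightarrow> v > 0 \<Longrightarrow>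
    ln (VNR f n S v) \<le> s * q / sqrt (real n) - K1 * (ln (real n) / real n) \<Longrightarrow> \<epsilon> < Pe f n S v"
    by (rule converse) (rule that; blast)
  obtain K2 N2 where ach: "\<And>n. n \<ge> N2 \<Longrightarrow> \<exists>S v. IC n S \<and> dens n S = 1 \<and> v > 0 \<and>
    ln (VNR f n S v) = s * q / sqrt (real n) + K2 * (ln (real n) / real n) \<and> Pe f n S v \<le> \<epsilon>"
    by (rule achievability) (rule that; blast)
  show thesis
  proof (rule that[of "max N1 N2" K1 K2])
    fix n assume n: "n \<ge> max N1 N2"
    define a where "a = s * q / sqrt (real n) - K1 * (ln (real n) / real n)"
    define b where "b = s * q / sqrt (real n) + K2 * (ln (real n) / real n)"
    define X where "X = {VNR f n S v | S v. IC n S \<and> 0 < dens n S \<and> dens n S < \<infinity> \<and> 0 < v \<and> Pe f n S v = \<epsilon>}"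
    have lower: "exp a \<le> \<mu>" if mu: "\<mu> \<in> X" for \<mu>
    proof -
      obtain S v where Sv: "IC n S" "0 < dens n S" "dens n S < \<infinity>" "0 < v" "Pe f n S v = \<epsilon>" "\<mu> = VNR f n S v"
        using mu unfolding X_def by blast
      have "a < ln \<mu>" using conv[of n S v] n Sv unfolding a_def by force
      then show ?thesis using VNR_pos[OF Sv(4), of f n S] Sv(6) by (metis exp_less_cancel_iff exp_ln less_imp_le)
    qed
    obtain S v where S: "IC n S" "dens n S = 1" and v: "v > 0" and V: "ln (VNR f n S v) = b" and P: "Pe f n S v \<le> \<epsilon>"
      using ach[of n] n unfolding b_def by auto
    \<comment> \<open>Scaling the variance by \<open>exp |b - a|\<close> moves the logarithm of the
      ratio from \<open>b\<close> to at most \<open>a\<close>, into the range of the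
      converse.\<close>
    define w where "w = v * exp (\<bar>b - a\<bar>)"
    have w: "w \<ge> v" "w > 0" using v by (auto simp: w_def)
    have "VNR f n S w = VNR f n S v / exp (\<bar>b - a\<bar>)" by (simp add: VNR_def w_def)
    then have "ln (VNR f n S w) = b - \<bar>b - a\<bar>" using VNR_pos[OF v] V by (simp add: ln_divide_pos)
    then have "ln (VNR f n S w) \<le> a" by linarith
    then have Pw: "\<epsilon> < Pe f n S w" using conv[of n S w] n S w unfolding a_def by simp
    have "continuous_on {v..w} (Pe f n S)"
      using Pe_continuous[OF f S(1)] by (rule continuous_on_subset) (use v in auto)
    then obtain u where u: "v \<le> u" "u \<le> w" "Pe f n S u = \<epsilon>"
      using IVT'[of "Pe f n S" v \<epsilon> w] P Pw w by auto
    have uX: "VNR f n S u \<in> X" unfolding X_def using S u v by (intro CollectI exI[of _ S] exI[of _ u]) auto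
    have "VNR f n S u \<le> VNR f n S v" by (rule VNR_antimono[OF v u(1)])
    also have "\<dots> = exp b" using VNR_pos[OF v, of f n S] V by (metis exp_ln)
    finally have ub: "VNR f n S u \<le> exp b" .
    \<comment> \<open>The real infimum is meaningful here because \<open>X\<close> is bounded below
      and, by \<open>uX\<close>, nonempty.\<close>
    have "bdd_below X" using lower by (rule bdd_belowI)
    then have "Inf X \<le> exp b" using cInf_lower[OF uX] ub by simp
    moreover have "exp a \<le> Inf X" using uX lower by (intro cInf_greatest) auto
    ultimately show "exp (s * q / sqrt (real n) - K1 * (ln (real n) / real n)) \<le> mu_star f n \<epsilon> \<and>
      mu_star f n \<epsilon> \<le> exp (s * q / sqrt (real n) + K2 * (ln (real n) / real n))"
      unfolding mu_star_def X_def[symmetric] a_def b_def by simp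
  qed
qed

end

theorem theorem4p7:
  fixes f :: "real \<Rightarrow> real" and \<epsilon> :: real
  assumes "regular_fading f"
    and "0 < \<epsilon>" and "\<epsilon> < 1"
  shows "(\<lambda>n::nat. mu_star f n \<epsilon>
            - (1 + sqrt ((2 + Var_lnH2 f) / real n) * Qinv \<epsilon>))
         \<in> O(\<lambda>n. ln (real n) / real n)"
proof -
  define s where "s = sqrt (2 + Var_lnH2 f)"
  define q where "q = Qinv \<epsilon>"
  obtain K1 K2 N where mu: "\<And>n. n \<ge> N \<Longrightarrow>
      exp (s * q / sqrt (real n) - K1 * (ln (real n) / real n)) \<le> mu_star f n \<epsilon> \<and>
      mu_star f n \<epsilon> \<le> exp (s * q / sqrt (real n) + K2 * (ln (real n) / real n))"
    by (rule mu_star_bounds[OF assms, folded s_def q_def]) (rule that; blast)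
  define x where "x n = s * q / sqrt (real n) + K2 * (ln (real n) / real n)" for n :: nat
  have "x \<longlonglongrightarrow> 0" unfolding x_def by real_asymp
  then have "(\<lambda>n. \<bar>x n\<bar>) \<longlonglongrightarrow> \<bar>0\<bar>" by (rule tendsto_rabs)
  then have ev: "eventually (\<lambda>n. \<bar>x n\<bar> < 1) sequentially" by (rule order_tendstoD) simp
  \<comment> \<open>The exponent is O(1 / sqrt n), so its square, the price of replacing
    \<open>exp\<close> by its linear part from above, is O(1 / n) and is absorbed by the remainder.
    From below \<open>1 + y \<le> exp y\<close> costs nothing.\<close>
  have "x \<in> O(\<lambda>n. 1 / sqrt (real n))" unfolding x_def by real_asymp
  then have "(\<lambda>n. (x n)\<^sup>2) \<in> O(\<lambda>n. (1 / sqrt (real n))\<^sup>2)" by (rule landau_o.big_power)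
  then have x2: "(\<lambda>n. (x n)\<^sup>2) \<in> O(\<lambda>n. ln (real n) / real n)"
  proof (rule landau_o.big_trans)
    show "(\<lambda>n. (1 / sqrt (real n))\<^sup>2) \<in> O(\<lambda>n. ln (real n) / real n)" by real_asymp
  qed
  have "eventually (\<lambda>n. norm (mu_star f n \<epsilon> - (1 + sqrt ((2 + Var_lnH2 f) / real n) * Qinv \<epsilon>))
      \<le> 1 * norm ((\<bar>K1\<bar> + \<bar>K2\<bar>) * (ln (real n) / real n) + (x n)\<^sup>2)) sequentially"
    using ev eventually_ge_at_top[of "max N 1"]
  proof eventually_elim
    case (elim n)
    define l where "l = ln (real n) / real n"
    have l: "l \<ge> 0" using elim by (simp add: l_def)
    have e: "sqrt ((2 + Var_lnH2 f) / real n) * Qinv \<epsilon> = s * q / sqrt (real n)"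
      by (simp add: s_def q_def real_sqrt_divide)
    have "exp (x n) \<le> 1 + x n + (x n)\<^sup>2" using elim by (intro exp_le_second_order) auto
    then have "mu_star f n \<epsilon> \<le> 1 + s * q / sqrt (real n) + K2 * l + (x n)\<^sup>2"
      using mu[of n] elim unfolding x_def l_def by simp
    moreover have "1 + (s * q / sqrt (real n) - K1 * l) \<le> mu_star f n \<epsilon>"
      unfolding l_def by (rule order_trans[OF exp_ge_add_one_self conjunct1[OF mu]]) (use elim in auto)
    moreover have "K2 * l \<le> \<bar>K2\<bar> * l" "K1 * l \<le> \<bar>K1\<bar> * l" "0 \<le> \<bar>K2\<bar> * l" "0 \<le> \<bar>K1\<bar> * l" using l by (auto intro: mult_right_mono)
    moreover have "0 \<le> (x n)\<^sup>2" by simp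
    ultimately have "\<bar>mu_star f n \<epsilon> - (1 + s * q / sqrt (real n))\<bar> \<le> \<bar>K1\<bar> * l + \<bar>K2\<bar> * l + (x n)\<^sup>2" by linarith
    then show ?case unfolding e l_def[symmetric] by (simp add: distrib_right)
  qed
  then have "(\<lambda>n. mu_star f n \<epsilon> - (1 + sqrt ((2 + Var_lnH2 f) / real n) * Qinv \<epsilon>))
      \<in> O(\<lambda>n. (\<bar>K1\<bar> + \<bar>K2\<bar>) * (ln (real n) / real n) + (x n)\<^sup>2)"
    by (rule landau_o.bigI[rotated]) simp
  also have "(\<lambda>n. (\<bar>K1\<bar> + \<bar>K2\<bar>) * (ln (real n) / real n) + (x n)\<^sup>2) \<in> O(\<lambda>n. ln (real n) / real n)"
  proof (intro sum_in_bigo x2)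
    show "(\<lambda>n. (\<bar>K1\<bar> + \<bar>K2\<bar>) * (ln (real n) / real n)) \<in> O(\<lambda>n. ln (real n) / real n)"
      by (rule bigoI[of _ "\<bar>K1\<bar> + \<bar>K2\<bar>"]) (simp add: abs_mult)
  qed
  finally show ?thesis .
qed

end
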